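(* Let $G$ be a finite non-abelian group and let $\Gamma_G$ be its non-commuting graph. Then $\mathrm{rc}_2(\Gamma_G)=2$. In particular, $\mathrm{rc}(\Gamma_G)=2$.
   Context: For a non-abelian group $G$ with center $Z(G)$, the non-commuting graph $\Gamma_G$ is the simple graph with vertex set $G\setminus Z(G)$ in which two distinct vertices $x,y$ are adjacent if and only if $xy\neq yx$. Let $\Gamma$ be a connected finite simple graph. Its vertex connectivity $\kappa(\Gamma)$ is the smallest number of vertices whose deletion disconnects $\Gamma$. An edge coloring of $\Gamma$ is an arbitrary assignment of colors to the edges (adjacent edges may receive the same color). Given an edge coloring, a path is rainbow if no two of its edges have the same color. For a positive integer $k\le\kappa(\Gamma)$, an edge-colored graph $\Gamma$ is rainbow-$k$-connected if any two distinct vertices of $\Gamma$ are connected by at least $k$ (distinct) internally disjoint rainbow paths (a single edge counts as a rainbow path). The rainbow-$k$-connectivity $\mathrm{rc}_k(\Gamma)$ is the minimum number of colors required to color the edges of $\Gamma$ so that it becomes rainbow-$k$-connected. One writes $\mathrm{rc}(\Gamma)=\mathrm{rc}_1(\Gamma)$, the rainbow connection number of $\Gamma$. *)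

theory Defs
  imports
    "HOL-Algebra.Group"
    "HOL-Library.Extended_Nat"
    "Graph_Theory.Graph_Theory"
begin

section \<open>The non-commuting graph of a group\<close>

definition group_center :: "('a, 'm) monoid_scheme \<Rightarrow> 'a set" where
  "group_center G = {z \<in> carrier G. \<forall>g \<in> carrier G. z \<otimes>\<^bsub>G\<^esub> g = g \<otimes>\<^bsub>G\<^esub> z}"

text \<open>
  Simple graphs are the \<^locale>\<open>pair_graph\<close>s of \<^theory>\<open>Graph_Theory.Pair_Digraph\<close>: an undirected
  edge between \<open>x\<close> and \<open>y\<close> is represented by the two arcs \<open>(x, y)\<close> and \<open>(y, x)\<close>.
\<close>

definition non_commuting_graph :: "('a, 'm) monoid_scheme \<Rightarrow> 'a pair_pre_digraph" where
  "non_commuting_graph G =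
     \<lparr> pverts = carrier G - group_center G,
       parcs = {(x, y). x \<in> carrier G - group_center G \<and> y \<in> carrier G - group_center G
                  \<and> x \<noteq> y \<and> x \<otimes>\<^bsub>G\<^esub> y \<noteq> y \<otimes>\<^bsub>G\<^esub> x} \<rparr>"

lemma pair_graph_non_commuting_graph:
  assumes "finite (carrier G)"
  shows "pair_graph (non_commuting_graph G)"
proof
  show "finite (parcs (non_commuting_graph G))"
    by (rule finite_subset[of _ "carrier G \<times> carrier G"])
       (use assms in \<open>auto simp: non_commuting_graph_def\<close>)
qed (use assms in \<open>auto simp: non_commuting_graph_def symmetric_def sym_def\<close>)


section \<open>Vertex connectivity\<close>

text \<open>
  Deleting all but one vertex also counts, which gives the complete graph on \<open>n\<close> vertices
  its customary connectivity \<open>n - 1\<close>.  (The library's \<^const>\<open>connected\<close> is false for the graph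
  without vertices, and true for the one-vertex graph.)
\<close>

definition vertex_connectivity :: "'a pair_pre_digraph \<Rightarrow> nat" where
  "vertex_connectivity \<Gamma> =
     (LEAST n. \<exists>S \<subseteq> pverts \<Gamma>. card S = n \<and>
        (\<not> connected (with_proj \<Gamma> \<restriction> (pverts \<Gamma> - S)) \<or> card (pverts \<Gamma> - S) = 1))"


section \<open>Rainbow connectivity\<close>

definition undirected_edges :: "'a pair_pre_digraph \<Rightarrow> 'a set set" where
  "undirected_edges \<Gamma> = {{x, y} | x y. (x, y) \<in> parcs \<Gamma>}"

text \<open>
  Paths are given by their lists of vertices, and an edge coloring assigns a color to
  each unordered pair \<open>{x, y}\<close>; only its values on \<^const>\<open>undirected_edges\<close> matter.
\<close>

definition rainbow_path ::
  "('a set \<Rightarrow> nat) \<Rightarrow> 'a pair_pre_digraph \<Rightarrow> 'a \<Rightarrow> 'a list \<Rightarrow> 'a \<Rightarrow> bool" where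
  "rainbow_path c \<Gamma> u p v \<longleftrightarrow>
     vpath p (with_proj \<Gamma>) \<and> hd p = u \<and> last p = v \<and>
     distinct (map (\<lambda>(x, y). c {x, y}) (vwalk_arcs p))"

definition internally_disjoint :: "'a \<Rightarrow> 'a \<Rightarrow> 'a list set \<Rightarrow> bool" where
  "internally_disjoint u v P \<longleftrightarrow> (\<forall>p \<in> P. \<forall>q \<in> P. p \<noteq> q \<longrightarrow> set p \<inter> set q \<subseteq> {u, v})"

text \<open>
  The notion is restricted to \<open>1 \<le> k \<le> \<kappa>(\<Gamma>)\<close>; in particular \<open>\<Gamma>\<close> is connected, because a
  disconnected graph has \<open>\<kappa>(\<Gamma>) = 0\<close>.
\<close>

definition rainbow_connected ::
  "nat \<Rightarrow> ('a set \<Rightarrow> nat) \<Rightarrow> 'a pair_pre_digraph \<Rightarrow> bool" where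
  "rainbow_connected k c \<Gamma> \<longleftrightarrow>
     1 \<le> k \<and> k \<le> vertex_connectivity \<Gamma> \<and>
     (\<forall>u \<in> pverts \<Gamma>. \<forall>v \<in> pverts \<Gamma>. u \<noteq> v \<longrightarrow>
        (\<exists>P. finite P \<and> k \<le> card P \<and> (\<forall>p \<in> P. rainbow_path c \<Gamma> u p v) \<and>
             internally_disjoint u v P))"

text \<open>
  The value is \<open>\<infinity>\<close> when no coloring is admissible, that is, for \<open>k\<close> outside \<open>{1..\<kappa>(\<Gamma>)}\<close>.
\<close>

definition rainbow_connectivity :: "nat \<Rightarrow> 'a pair_pre_digraph \<Rightarrow> enat" where
  "rainbow_connectivity k \<Gamma> =
     Inf {enat n | n. \<exists>c. c ` undirected_edges \<Gamma> \<subseteq> {..<n} \<and> rainbow_connected k c \<Gamma>}"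

abbreviation rainbow_connection_number :: "'a pair_pre_digraph \<Rightarrow> enat" where
  "rainbow_connection_number \<equiv> rainbow_connectivity 1"

end

theory Submission
  imports Defs "HOL-Algebra.Sylow" "HOL-Algebra.Group_Action"
begin

text \<open>
  With two colors a rainbow path has at most two edges, so the task is to find a symmetric
  two-valued \<open>\<kappa>\<close> on pairs of elements such that any two noncentral \<open>x \<noteq> y\<close> have common neighbors \<open>w\<close>
  with \<open>\<kappa> x w \<noteq> \<kappa> y w\<close>: one if \<open>x\<close> and \<open>y\<close> do not commute, two if they do. Let \<open>n\<close> be the order
  of the group. If \<open>x\<close> and \<open>y\<close> have \<open>m\<close> common neighbors, a uniformly random \<open>\<kappa>\<close> fails on them with
  probability \<open>1 / 2^m\<close>, respectively \<open>(m + 1) / 2^m\<close>, and \<open>m\<close> is bounded below because two subgroups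
  of index \<open>a\<close> and \<open>b\<close> miss at least \<open>(1 - 1/a) (1 - 1/b) n\<close> elements. The union bound is good enough
  unless \<open>n\<close> is small and some centralizers have index 2. Then there are three cases. If \<open>G\<close> has an
  abelian subgroup of index 2, there is an explicit coloring. If two elements whose centralizers have
  index 2 do not commute, \<open>G\<close> is a central product of the subgroup that they generate and the
  intersection \<open>D\<close> of their centralizers, and a coloring for \<open>D\<close> (induction on the order) extends
  to \<open>G\<close>. If all such elements commute, only the orders 32, 36 and 48 remain,
  and there are few enough such elements for the union bound to work after all.
\<close>

section \<open>From separating colorings to rainbow connectivity\<close>

text \<open>Besides the coloring, two facts are needed. One color is too few, because some two
  distinct noncentral elements commute and a rainbow path in one color is a single edge. And
  rainbow-2-connectivity presupposes connectivity at least 2; the separating vertices themselves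
  supply the two common neighbors for this. The obstacle is that two centralizers of index 2 may
  leave only \<open>n / 4\<close> common neighbors against roughly \<open>n^2 / 2\<close> pairs.
  Index at least 2 everywhere suffices only from \<open>n = 53\<close> on. Index at least 3 leaves
  \<open>4 * n / 9\<close> and suffices from \<open>n = 14\<close> on; below that only
  \<open>n = 12\<close> occurs, by a finer count. Excluding abelian subgroups of index 2 serves both
  remaining cases. It makes \<open>D\<close> nonabelian, so that the induction applies. And it
  forces a centralizer \<open>H\<close> of index 2 to have order \<open>z * e * p * q\<close>, where
  \<open>z\<close> is the order of the center, \<open>z * e\<close> that of the center of
  \<open>H\<close>, and \<open>e\<close>, \<open>p\<close>, \<open>q\<close> are at least 2. Below
  53, parity arguments then leave only the orders 32, 36 and 48.\<close>

definition cent :: "('a, 'm) monoid_scheme \<Rightarrow> 'a \<Rightarrow> 'a set" where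
  "cent G x = {g \<in> carrier G. x \<otimes>\<^bsub>G\<^esub> g = g \<otimes>\<^bsub>G\<^esub> x}"

text \<open>For \<open>x\<close> and \<open>y\<close> in the carrier, noncommutation alone makes
  such a \<open>w\<close> noncentral and different from both, so it is a vertex of the
  graph.\<close>

definition separators :: "('a, 'm) monoid_scheme \<Rightarrow> ('a \<Rightarrow> 'a \<Rightarrow> bool) \<Rightarrow> 'a \<Rightarrow> 'a \<Rightarrow> 'a set" where
  "separators G \<kappa> x y =
     {w \<in> carrier G. w \<notin> cent G x \<and> w \<notin> cent G y \<and> \<kappa> x w \<noteq> \<kappa> y w}"

definition separating :: "('a, 'm) monoid_scheme \<Rightarrow> ('a \<Rightarrow> 'a \<Rightarrow> bool) \<Rightarrow> bool" where
  "separating G \<kappa> \<longleftrightarrow> (\<forall>x y. \<kappa> x y = \<kappa> y x) \<and>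
     (\<forall>x \<in> carrier G - group_center G. \<forall>y \<in> carrier G - group_center G. x \<noteq> y \<longrightarrow>
        (if y \<in> cent G x then 2 else 1) \<le> card (separators G \<kappa> x y))"

lemma separatingD:
  assumes "separating G \<kappa>"
  shows "\<kappa> x y = \<kappa> y x"
    and "x \<in> carrier G - group_center G \<Longrightarrow> y \<in> carrier G - group_center G \<Longrightarrow> x \<noteq> y \<Longrightarrow>
      y \<in> cent G x \<Longrightarrow> 2 \<le> card (separators G \<kappa> x y)"
    and "x \<in> carrier G - group_center G \<Longrightarrow> y \<in> carrier G - group_center G \<Longrightarrow> x \<noteq> y \<Longrightarrow>
      y \<notin> cent G x \<Longrightarrow> separators G \<kappa> x y \<noteq> {}"
proof -
  have *: "\<forall>x \<in> carrier G - group_center G. \<forall>y \<in> carrier G - group_center G. x \<noteq> y \<longrightarrow>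
        (if y \<in> cent G x then 2 else 1) \<le> card (separators G \<kappa> x y)"
    and "\<forall>x y. \<kappa> x y = \<kappa> y x"
    using assms unfolding separating_def by (rule conjunct2, rule conjunct1)
  then show "\<kappa> x y = \<kappa> y x" by metis
  show "2 \<le> card (separators G \<kappa> x y)" if "x \<in> carrier G - group_center G"
    "y \<in> carrier G - group_center G" "x \<noteq> y" "y \<in> cent G x"
    using *[rule_format, OF that(1-3)] that(4) by simp
  show "separators G \<kappa> x y \<noteq> {}" if "x \<in> carrier G - group_center G"
    "y \<in> carrier G - group_center G" "x \<noteq> y" "y \<notin> cent G x"
    using *[rule_format, OF that(1-3)] that(4) by auto
qed

lemma pverts_ncg [simp]: "pverts (non_commuting_graph G) = carrier G - group_center G"
  by (simp add: non_commuting_graph_def)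

lemma not_in_cent_noncentral:
  "x \<in> carrier G \<Longrightarrow> y \<in> carrier G \<Longrightarrow> y \<notin> cent G x \<Longrightarrow> x \<notin> group_center G \<and> y \<notin> group_center G \<and> x \<noteq> y"
  by (auto simp: cent_def group_center_def dest: sym)

lemma parcs_ncg:
  "(x, y) \<in> parcs (non_commuting_graph G) \<longleftrightarrow>
     x \<in> carrier G \<and> y \<in> carrier G \<and> y \<notin> cent G x"
  using not_in_cent_noncentral[of x G y] by (auto simp: non_commuting_graph_def cent_def)

lemma cent_sym: "x \<in> carrier G \<Longrightarrow> y \<in> carrier G \<Longrightarrow> y \<in> cent G x \<longleftrightarrow> x \<in> cent G y"
  by (auto simp: cent_def)

lemma card_ge_2_obtain:
  assumes "2 \<le> card A" obtains a b where "a \<in> A" "b \<in> A" "a \<noteq> b"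
proof -
  obtain B where B: "B \<subseteq> A" "card B = 2" using assms obtain_subset_with_card_n by metis
  then obtain a b where "B = {a, b}" "a \<noteq> b" by (meson card_2_iff)
  then show thesis using that[of a b] B by blast
qed

text \<open>Deleting at most one vertex spares one of the two common neighbors of a nonadjacent
  pair, so the rest stays connected; with three vertices, at least two remain, which rules out the
  one-vertex clause.\<close>

lemma vertex_connectivity_ge_2:
  assumes fin: "finite (pverts \<Gamma>)" and card3: "3 \<le> card (pverts \<Gamma>)"
    and wf: "\<And>x y. (x, y) \<in> parcs \<Gamma> \<Longrightarrow> x \<in> pverts \<Gamma> \<and> y \<in> pverts \<Gamma>"
    and linked: "\<And>x y. x \<in> pverts \<Gamma> \<Longrightarrow> y \<in> pverts \<Gamma> \<Longrightarrow> x \<noteq> y \<Longrightarrow> (x, y) \<notin> parcs \<Gamma> \<Longrightarrow>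
      \<exists>a b. a \<noteq> b \<and> (x, a) \<in> parcs \<Gamma> \<and> (a, y) \<in> parcs \<Gamma> \<and> (x, b) \<in> parcs \<Gamma> \<and> (b, y) \<in> parcs \<Gamma>"
  shows "2 \<le> vertex_connectivity \<Gamma>"
proof -
  define Cut where "Cut = (\<lambda>n. \<exists>S \<subseteq> pverts \<Gamma>. card S = n \<and>
        (\<not> connected (with_proj \<Gamma> \<restriction> (pverts \<Gamma> - S)) \<or> card (pverts \<Gamma> - S) = 1))"
  have "\<not> Cut n" if n: "n < 2" for n
  proof
    assume "Cut n"
    then obtain S where S: "S \<subseteq> pverts \<Gamma>" "card S = n"
      and or: "\<not> connected (with_proj \<Gamma> \<restriction> (pverts \<Gamma> - S)) \<or> card (pverts \<Gamma> - S) = 1"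
      unfolding Cut_def by blast
    let ?W = "pverts \<Gamma> - S"
    have finS: "finite S" using S fin finite_subset by blast
    have "card ?W = card (pverts \<Gamma>) - card S" using S finS by (simp add: card_Diff_subset)
    then have W2: "2 \<le> card ?W" using card3 S n by linarith
    let ?H = "with_proj \<Gamma> \<restriction> ?W"
    have arc: "u \<rightarrow>\<^bsub>mk_symmetric ?H\<^esub> v" if "(u, v) \<in> parcs \<Gamma>" "u \<in> ?W" "v \<in> ?W" for u v
      using that by (force simp: mk_symmetric_def)
    interpret H: wf_digraph "with_proj (mk_symmetric ?H)"
      by unfold_locales (auto simp: mk_symmetric_def)
    have "u \<rightarrow>\<^sup>*\<^bsub>mk_symmetric ?H\<^esub> v" if uv: "u \<in> ?W" "v \<in> ?W" for u v
    proof (cases "u = v \<or> (u, v) \<in> parcs \<Gamma>")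
      case True
      then show ?thesis using arc[of u v] uv H.reachable_adjI[of u v] H.reachable_refl[of u]
        by (auto simp: mk_symmetric_def)
    next
      case False
      then obtain a b where ab: "a \<noteq> b" "(u, a) \<in> parcs \<Gamma>" "(a, v) \<in> parcs \<Gamma>"
        "(u, b) \<in> parcs \<Gamma>" "(b, v) \<in> parcs \<Gamma>"
        using linked uv by blast
      have "\<not> (a \<in> S \<and> b \<in> S)"
        using S n ab(1) finS card_le_Suc0_iff_eq[OF finS] by auto
      then obtain w where "w \<in> ?W" "(u, w) \<in> parcs \<Gamma>" "(w, v) \<in> parcs \<Gamma>"
        using ab wf by blast
      then have "u \<rightarrow>\<^bsub>mk_symmetric ?H\<^esub> w" "w \<rightarrow>\<^bsub>mk_symmetric ?H\<^esub> v"
        using arc uv by blast+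
      then show ?thesis using H.reachable_adjI H.reachable_trans by blast
    qed
    moreover have "?W \<noteq> {}" using W2 by (metis card.empty not_numeral_le_zero)
    ultimately have "connected ?H"
      unfolding connected_def strongly_connected_def by (simp add: mk_symmetric_def)
    then show False using or W2 by auto
  qed
  \<comment> \<open>\<open>LEAST\<close> says nothing about an unsatisfiable predicate, so some cut
    has to be exhibited: all vertices but one.\<close>
  moreover have "Cut (card (pverts \<Gamma>) - 1)"
  proof -
    obtain v where v: "v \<in> pverts \<Gamma>" using card3 by fastforce
    then have "pverts \<Gamma> - (pverts \<Gamma> - {v}) = {v}" by blast
    then show ?thesis unfolding Cut_def
      using v fin by (intro exI[of _ "pverts \<Gamma> - {v}"]) auto
  qed
  ultimately have "2 \<le> (LEAST n. Cut n)"
    using LeastI[of Cut] linorder_not_less by blast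
  then show ?thesis unfolding vertex_connectivity_def Cut_def .
qed

lemma rainbow_path_edge:
  assumes "(x, y) \<in> parcs \<Gamma>" "x \<in> pverts \<Gamma>" "y \<in> pverts \<Gamma>" "x \<noteq> y"
  shows "rainbow_path c \<Gamma> x [x, y] y"
  using assms by (auto simp: rainbow_path_def vpath_def vwalk_def)

lemma rainbow_path_2:
  assumes "(x, w) \<in> parcs \<Gamma>" "(w, y) \<in> parcs \<Gamma>" "{x, w, y} \<subseteq> pverts \<Gamma>" "distinct [x, w, y]"
    and "c {x, w} \<noteq> c {w, y}"
  shows "rainbow_path c \<Gamma> x [x, w, y] y"
  using assms by (auto simp: rainbow_path_def vpath_def vwalk_def)

text \<open>Two consecutive edges would both have color 0, so the path is a single edge. Hence any
  nonadjacent pair rules out one color.\<close>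

lemma rainbow_path_one_color:
  assumes "c ` undirected_edges \<Gamma> \<subseteq> {..<1}" "rainbow_path c \<Gamma> x p y" "x \<noteq> y"
  shows "(x, y) \<in> parcs \<Gamma>"
proof -
  have c0: "c {a, b} = 0" if "(a, b) \<in> parcs \<Gamma>" for a b
  proof -
    have "{a, b} \<in> undirected_edges \<Gamma>" using that unfolding undirected_edges_def by blast
    then have "c {a, b} \<in> {..<1}" using assms(1) by blast
    then show ?thesis by simp
  qed
  have p: "p \<noteq> []" "set (vwalk_arcs p) \<subseteq> parcs \<Gamma>" "hd p = x" "last p = y"
    "distinct (map (\<lambda>(x, y). c {x, y}) (vwalk_arcs p))"
    using assms(2) by (auto simp: rainbow_path_def vpath_def vwalk_def)
  obtain p' where p': "p = x # p'" using p by (cases p) auto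
  obtain a p'' where p'': "p' = a # p''" using p' p assms(3) by (cases p') auto
  show ?thesis
  proof (cases p'')
    case Nil then show ?thesis using p p' p'' by auto
  next
    case (Cons b q)
    then show ?thesis using p p' p'' c0[of x a] c0[of a b] by auto
  qed
qed

lemma rainbow_connectivity_eq_2I:
  assumes k: "1 \<le> k"
    and col: "c ` undirected_edges \<Gamma> \<subseteq> {..<2}" "rainbow_connected k c \<Gamma>"
    and xy: "x \<in> pverts \<Gamma>" "y \<in> pverts \<Gamma>" "x \<noteq> y" "(x, y) \<notin> parcs \<Gamma>"
  shows "rainbow_connectivity k \<Gamma> = 2"
proof (rule antisym)
  let ?X = "{enat n | n. \<exists>c. c ` undirected_edges \<Gamma> \<subseteq> {..<n} \<and> rainbow_connected k c \<Gamma>}"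
  have "enat 2 \<in> ?X" using col by blast
  then show "rainbow_connectivity k \<Gamma> \<le> 2"
    unfolding rainbow_connectivity_def numeral_eq_enat by (rule Inf_lower)
  have "2 \<le> n" if n: "c ` undirected_edges \<Gamma> \<subseteq> {..<n}" "rainbow_connected k c \<Gamma>" for n c
  proof (rule ccontr)
    assume "\<not> 2 \<le> n"
    then have "{..<n} \<subseteq> {..<1}" by auto
    then have c1: "c ` undirected_edges \<Gamma> \<subseteq> {..<1}" using n(1) by (rule subset_trans[rotated])
    obtain P where "finite P" "k \<le> card P" "\<forall>p \<in> P. rainbow_path c \<Gamma> x p y"
      using n(2) xy unfolding rainbow_connected_def by blast
    moreover from this obtain p where "p \<in> P" using k by (metis card.empty ex_in_conv not_one_le_zero le_trans)
    ultimately show False using rainbow_path_one_color[OF c1] xy by blast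
  qed
  then show "2 \<le> rainbow_connectivity k \<Gamma>"
    unfolding rainbow_connectivity_def
    unfolding numeral_eq_enat
    by (intro Inf_greatest) auto
qed

lemma (in group) all_involutions_comm:
  assumes "\<And>x. x \<in> carrier G \<Longrightarrow> x \<otimes> x = \<one>"
  shows "comm_group G"
proof (rule group_comm_groupI)
  fix x y assume xy: "x \<in> carrier G" "y \<in> carrier G"
  have inv: "inv g = g" if "g \<in> carrier G" for g using assms[OF that] that inv_equality by blast
  have "x \<otimes> y = inv (x \<otimes> y)" using inv xy by simp
  also have "\<dots> = inv y \<otimes> inv x" using xy by (rule inv_mult_group)
  also have "\<dots> = y \<otimes> x" using xy inv by metis
  finally show "x \<otimes> y = y \<otimes> x" .
qed

text \<open>Some \<open>x\<close> has \<open>x \<otimes> x \<noteq> \<one>\<close>. If it is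
  noncentral, \<open>x\<close> and \<open>inv x\<close> will do; if it is central, \<open>u\<close>
  and \<open>x \<otimes> u\<close> for a noncentral \<open>u\<close>. This nonadjacent pair is what
  makes two colors necessary.\<close>

lemma (in group) ex_commuting_pair:
  assumes "\<not> comm_group G"
  obtains x y where "x \<in> carrier G - group_center G" "y \<in> carrier G - group_center G"
    "x \<noteq> y" "y \<in> cent G x"
proof -
  obtain x where x: "x \<in> carrier G" "x \<otimes> x \<noteq> \<one>" using all_involutions_comm assms by blast
  show thesis
  proof (cases "x \<in> group_center G")
    case False
    have "inv x \<noteq> x" using x by (metis r_inv)
    moreover have "inv x \<notin> group_center G"
    proof
      assume *: "inv x \<in> group_center G"
      have "x \<otimes> g = g \<otimes> x" if g: "g \<in> carrier G" for g
      proof -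
        have "inv x \<otimes> inv g = inv g \<otimes> inv x" using * g by (auto simp: group_center_def)
        then have "inv (g \<otimes> x) = inv (x \<otimes> g)" using x g by (simp add: inv_mult_group)
        then show ?thesis using x g by (metis inv_inv m_closed)
      qed
      then have "x \<in> group_center G" using x unfolding group_center_def by blast
      then show False using False by contradiction
    qed
    moreover have "inv x \<in> cent G x" using x by (simp add: cent_def)
    ultimately show thesis using False x that[of x "inv x"] by simp
  next
    case True
    obtain u v where uv: "u \<in> carrier G" "v \<in> carrier G" "u \<otimes> v \<noteq> v \<otimes> u"
      using assms group_comm_groupI by blast
    have comm: "x \<otimes> g = g \<otimes> x" if "g \<in> carrier G" for g
      using True that unfolding group_center_def by blast
    have "v \<otimes> (x \<otimes> u) = (v \<otimes> x) \<otimes> u" using uv x by (simp add: m_assoc)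
    also have "\<dots> = (x \<otimes> v) \<otimes> u" using comm[OF uv(2)] by metis
    also have "\<dots> = x \<otimes> (v \<otimes> u)" using uv x by (simp add: m_assoc)
    finally have "(x \<otimes> u) \<otimes> v \<noteq> v \<otimes> (x \<otimes> u)" using uv x by (simp add: m_assoc)
    then have 1: "v \<notin> cent G (x \<otimes> u)" and 2: "v \<notin> cent G u" using uv by (simp_all add: cent_def)
    have "x \<noteq> \<one>" using x by auto
    then have "u \<noteq> x \<otimes> u" using uv x r_cancel_one' by blast
    moreover have "x \<otimes> u \<in> cent G u"
      using comm[OF uv(1)] uv x by (simp add: cent_def m_assoc)
    ultimately show thesis
      using that[of u "x \<otimes> u"] not_in_cent_noncentral[OF _ uv(2) 1] not_in_cent_noncentral[OF _ uv(2) 2] uv x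
      by simp
  qed
qed

lemma (in group) rainbow_of_separating:
  assumes fin: "finite (carrier G)" and nc: "\<not> comm_group G" and sep: "separating G \<kappa>"
  shows "rainbow_connectivity 2 (non_commuting_graph G) = 2
       \<and> rainbow_connection_number (non_commuting_graph G) = 2"
proof -
  let ?\<Gamma> = "non_commuting_graph G"
  let ?V = "carrier G - group_center G"
  \<comment> \<open>Colors of unordered pairs are read off from a function of ordered ones; the
    existential is harmless since \<open>\<kappa>\<close> is symmetric.\<close>
  define c where "c X = (if \<exists>a b. X = {a, b} \<and> \<kappa> a b then 1 else 0 :: nat)" for X
  have c: "c {a, b} = (if \<kappa> a b then 1 else 0)" for a b
  proof -
    have "(\<exists>a' b'. {a, b} = {a', b'} \<and> \<kappa> a' b') \<longleftrightarrow> \<kappa> a b"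
      using separatingD(1)[OF sep] by (metis doubleton_eq_iff)
    then show ?thesis unfolding c_def by simp
  qed
  have c2: "c ` undirected_edges ?\<Gamma> \<subseteq> {..<2}" by (auto simp: c_def)
  have sepE: "w \<in> ?V" "(x, w) \<in> parcs ?\<Gamma>" "(w, y) \<in> parcs ?\<Gamma>" "distinct [x, w, y]"
     "c {x, w} \<noteq> c {w, y}"
    if "w \<in> separators G \<kappa> x y" "x \<in> ?V" "y \<in> ?V" "x \<noteq> y" for w x y
  proof -
    have w: "w \<in> carrier G" "w \<notin> cent G x" "w \<notin> cent G y" "\<kappa> x w \<noteq> \<kappa> y w"
      using that(1) by (auto simp: separators_def)
    then show "w \<in> ?V" "(x, w) \<in> parcs ?\<Gamma>" "(w, y) \<in> parcs ?\<Gamma>" "distinct [x, w, y]"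
      using that not_in_cent_noncentral[of x G w] not_in_cent_noncentral[of y G w] cent_sym[of w G y]
      by (auto simp: parcs_ncg)
    show "c {x, w} \<noteq> c {w, y}" using w c[of x w] c[of y w] by (simp add: insert_commute split: if_splits)
  qed
  have paths: "\<exists>P. finite P \<and> 2 \<le> card P \<and> (\<forall>p \<in> P. rainbow_path c ?\<Gamma> x p y) \<and>
      internally_disjoint x y P" if xy: "x \<in> ?V" "y \<in> ?V" "x \<noteq> y" for x y
  proof (cases "y \<in> cent G x")
    case True
    then have "2 \<le> card (separators G \<kappa> x y)" using separatingD(2)[OF sep xy] by simp
    then obtain a b where ab: "a \<in> separators G \<kappa> x y" "b \<in> separators G \<kappa> x y" "a \<noteq> b"
      by (rule card_ge_2_obtain)
    have "rainbow_path c ?\<Gamma> x [x, a, y] y" "rainbow_path c ?\<Gamma> x [x, b, y] y"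
      using sepE[OF ab(1) xy] sepE[OF ab(2) xy] xy by (auto intro!: rainbow_path_2)
    then show ?thesis using ab(3)
      by (intro exI[of _ "{[x, a, y], [x, b, y]}"]) (auto simp: internally_disjoint_def)
  next
    case False
    then obtain a where a: "a \<in> separators G \<kappa> x y" using separatingD(3)[OF sep xy] by blast
    have "rainbow_path c ?\<Gamma> x [x, a, y] y"
      using sepE[OF a xy] xy by (auto intro!: rainbow_path_2)
    moreover have "rainbow_path c ?\<Gamma> x [x, y] y"
      using False xy by (intro rainbow_path_edge) (auto simp: parcs_ncg)
    ultimately show ?thesis
      by (intro exI[of _ "{[x, a, y], [x, y]}"]) (auto simp: internally_disjoint_def)
  qed
  obtain x y where xy: "x \<in> ?V" "y \<in> ?V" "x \<noteq> y" "y \<in> cent G x"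
    using ex_commuting_pair[OF nc] .
  have vc: "2 \<le> vertex_connectivity ?\<Gamma>"
  proof (rule vertex_connectivity_ge_2)
    show "finite (pverts ?\<Gamma>)" using fin by simp
    have "2 \<le> card (separators G \<kappa> x y)" using separatingD(2)[OF sep] xy by simp
    then obtain a b where ab: "a \<in> separators G \<kappa> x y" by (rule card_ge_2_obtain)
    have "{x, y, a} \<subseteq> ?V" "card {x, y, a} = 3" using sepE[OF ab(1) xy(1-3)] xy by auto
    then show "3 \<le> card (pverts ?\<Gamma>)" using fin by (metis card_mono finite_Diff pverts_ncg)
  next
    fix u v assume "(u, v) \<in> parcs ?\<Gamma>"
    then show "u \<in> pverts ?\<Gamma> \<and> v \<in> pverts ?\<Gamma>" by (auto simp: non_commuting_graph_def)
  next
    fix u v assume uv: "u \<in> pverts ?\<Gamma>" "v \<in> pverts ?\<Gamma>" "u \<noteq> v" "(u, v) \<notin> parcs ?\<Gamma>"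
    then have "v \<in> cent G u" by (auto simp: parcs_ncg)
    then have "2 \<le> card (separators G \<kappa> u v)" using separatingD(2)[OF sep] uv by simp
    then obtain a b where ab: "a \<in> separators G \<kappa> u v" "b \<in> separators G \<kappa> u v" "a \<noteq> b"
      by (rule card_ge_2_obtain)
    then show "\<exists>a b. a \<noteq> b \<and> (u, a) \<in> parcs ?\<Gamma> \<and> (a, v) \<in> parcs ?\<Gamma> \<and>
        (u, b) \<in> parcs ?\<Gamma> \<and> (b, v) \<in> parcs ?\<Gamma>"
      using sepE[OF ab(1)] sepE[OF ab(2)] uv by (metis pverts_ncg)
  qed
  have rc2: "rainbow_connected 2 c ?\<Gamma>" and rc1: "rainbow_connected 1 c ?\<Gamma>"
  proof -
    show "rainbow_connected 2 c ?\<Gamma>"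
      using paths vc unfolding rainbow_connected_def by simp
    then show "rainbow_connected 1 c ?\<Gamma>"
      unfolding rainbow_connected_def by (meson le_trans one_le_numeral order_refl)
  qed
  have "(x, y) \<notin> parcs ?\<Gamma>" using xy by (auto simp: parcs_ncg)
  then show ?thesis
    using rainbow_connectivity_eq_2I[OF _ c2 rc2] rainbow_connectivity_eq_2I[OF _ c2 rc1] xy by auto
qed

section \<open>The union bound\<close>

definition common_nbrs :: "('a, 'm) monoid_scheme \<Rightarrow> 'a \<Rightarrow> 'a \<Rightarrow> 'a set" where
  "common_nbrs G x y = carrier G - (cent G x \<union> cent G y)"

definition risk :: "('a, 'm) monoid_scheme \<Rightarrow> 'a \<Rightarrow> 'a \<Rightarrow> real" where
  "risk G x y = (if y \<in> cent G x then real (card (common_nbrs G x y)) + 1 else 1)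
     / 2 ^ card (common_nbrs G x y)"

lemma card_subsets_less_1: "finite T \<Longrightarrow> card {D \<in> Pow T. card D < 1} = 1"
proof -
  assume "finite T"
  then have "{D \<in> Pow T. card D < 1} = {{}}" by (auto simp: finite_subset)
  then show ?thesis by simp
qed

lemma card_subsets_less_2: "finite T \<Longrightarrow> card {D \<in> Pow T. card D < 2} = card T + 1"
proof -
  assume T: "finite T"
  have "{D \<in> Pow T. card D < 2} = insert {} ((\<lambda>a. {a}) ` T)"
  proof (intro Set.set_eqI iffI)
    fix D assume "D \<in> {D \<in> Pow T. card D < 2}"
    then have D: "D \<subseteq> T" "card D = 0 \<or> card D = 1" "finite D" using T finite_subset by auto
    then show "D \<in> insert {} ((\<lambda>a. {a}) ` T)" by (auto simp: card_1_singleton_iff)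
  qed auto
  moreover have "card ((\<lambda>a. {a}) ` T) = card T" by (rule card_image) auto
  moreover have "{} \<notin> (\<lambda>a. {a}) ` T" by auto
  ultimately show ?thesis using T by simp
qed

text \<open>
  Once the edges other than \<open>{x, w}\<close> for \<open>w \<in> T\<close> are colored, the colors of the latter correspond
  bijectively to the set of separating vertices.
\<close>

lemma card_bad_colorings:
  fixes T :: "'a set" and U :: "'a set set"
  assumes U: "finite U" and T: "finite T" and sub: "(\<lambda>w. {x, w}) ` T \<subseteq> U"
    and xy: "x \<notin> T" "y \<notin> T" "x \<noteq> y"
  shows "card {X \<in> Pow U. card {w \<in> T. ({x, w} \<in> X) \<noteq> ({y, w} \<in> X)} < r} * 2 ^ card T
    \<le> 2 ^ card U * card {D \<in> Pow T. card D < r}"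
proof -
  let ?P = "(\<lambda>w. {x, w}) ` T"
  let ?D = "\<lambda>X. {w \<in> T. ({x, w} \<in> X) \<noteq> ({y, w} \<in> X)}"
  let ?B = "{X \<in> Pow U. card (?D X) < r}"
  let ?F = "{D \<in> Pow T. card D < r}"
  have cP: "card ?P = card T" by (rule card_image) (auto simp: inj_on_def doubleton_eq_iff)
  have "inj_on (\<lambda>X. (X - ?P, ?D X)) ?B"
  proof (rule inj_onI)
    fix X X' assume X: "X \<in> ?B" "X' \<in> ?B" and eq: "(X - ?P, ?D X) = (X' - ?P, ?D X')"
    have out: "e \<in> X \<longleftrightarrow> e \<in> X'" if "e \<notin> ?P" for e using eq that by auto
    have inn: "e \<in> X \<longleftrightarrow> e \<in> X'" if e: "e \<in> ?P" for e
    proof -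
      obtain w where w: "w \<in> T" "e = {x, w}" using e by blast
      \<comment> \<open>The first component keeps the color of \<open>{y, w}\<close>; together with
        the membership of \<open>w\<close> in \<open>?D X\<close> it recovers the color of
        \<open>{x, w}\<close>.\<close>
      have "{y, w} \<notin> ?P" using xy w by (auto simp: doubleton_eq_iff)
      then have "{y, w} \<in> X \<longleftrightarrow> {y, w} \<in> X'" using out by blast
      moreover have "w \<in> ?D X \<longleftrightarrow> w \<in> ?D X'" using eq by simp
      ultimately show ?thesis using w by auto
    qed
    show "X = X'"
    proof (rule Set.set_eqI)
      show "e \<in> X \<longleftrightarrow> e \<in> X'" for e by (cases "e \<in> ?P") (rule inn, assumption, rule out)
    qed
  qed
  moreover have "(\<lambda>X. (X - ?P, ?D X)) ` ?B \<subseteq> Pow (U - ?P) \<times> ?F" by auto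
  ultimately have "card ?B \<le> card (Pow (U - ?P) \<times> ?F)"
    using U T by (intro card_inj_on_le) auto
  also have "\<dots> = 2 ^ (card U - card T) * card ?F"
    using U T sub cP by (simp add: card_cartesian_product card_Pow card_Diff_subset)
  finally have "card ?B * 2 ^ card T \<le> (2 ^ (card U - card T) * 2 ^ card T) * card ?F"
    by (simp add: mult.commute mult.left_commute)
  moreover have "card T \<le> card U" using cP sub U card_mono by metis
  ultimately show ?thesis by (simp flip: power_add)
qed

lemma (in group) separators_commute:
  "separators G \<kappa> x y = separators G \<kappa> y x"
  by (auto simp: separators_def)

lemma (in group) exists_separating:
  assumes fin: "finite (carrier G)"
    and small: "(\<Sum>x \<in> carrier G - group_center G. \<Sum>y \<in> carrier G - group_center G - {x}. risk G x y) < 2"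
  shows "\<exists>\<kappa>. separating G \<kappa>"
proof (rule ccontr)
  assume contra: "\<not> ?thesis"
  let ?V = "carrier G - group_center G"
  \<comment> \<open>\<open>U\<close> contains more than the edges; the additional bits multiply the
    numbers of all and of bad colorings by the same factor.\<close>
  define U where "U = Pow (carrier G)"
  define col where "col X = (\<lambda>a b. {a, b} \<in> X)" for X :: "'a set set"
  define need where "need x y = (if y \<in> cent G x then 2 else 1 :: nat)" for x y
  define bad where "bad x y = {X \<in> Pow U. card (separators G (col X) x y) < need x y}" for x y
  define Pairs where "Pairs = (SIGMA x:?V. ?V - {x})"
  have finU: "finite U" using fin by (simp add: U_def)
  have finP: "finite Pairs" using fin by (simp add: Pairs_def)
  have risk: "real (card (bad x y)) \<le> 2 ^ card U * risk G x y" if "(x, y) \<in> Pairs" for x y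
  proof -
    let ?T = "common_nbrs G x y"
    have xy: "x \<in> carrier G" "y \<in> carrier G" "x \<noteq> y" using that by (auto simp: Pairs_def)
    have T: "finite ?T" "x \<notin> ?T" "y \<notin> ?T" "(\<lambda>w. {x, w}) ` ?T \<subseteq> U"
      using fin xy by (auto simp: common_nbrs_def cent_def U_def)
    have sep: "separators G (col X) x y = {w \<in> ?T. ({x, w} \<in> X) \<noteq> ({y, w} \<in> X)}" for X
      by (auto simp: separators_def common_nbrs_def col_def)
    have "card (bad x y) * 2 ^ card ?T \<le> 2 ^ card U * card {D \<in> Pow ?T. card D < need x y}"
      unfolding bad_def sep by (rule card_bad_colorings) (use finU T xy in auto)
    also have "card {D \<in> Pow ?T. card D < need x y} = (if y \<in> cent G x then card ?T + 1 else 1)"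
      using card_subsets_less_1[OF T(1)] card_subsets_less_2[OF T(1)] by (simp add: need_def)
    finally have "real (card (bad x y) * 2 ^ card ?T)
        \<le> real (2 ^ card U * (if y \<in> cent G x then card ?T + 1 else 1))"
      by (rule of_nat_mono)
    then show ?thesis unfolding risk_def by (auto simp: field_simps split: if_splits)
  qed
  have need_sym: "need x y = need y x" if "x \<in> carrier G" "y \<in> carrier G" for x y
    using cent_sym[OF that] by (simp add: need_def)
  \<comment> \<open>A bad pair is counted in both orders, whence the bound 2 instead of 1.\<close>
  have two: "2 \<le> card {p \<in> Pairs. X \<in> bad (fst p) (snd p)}" if X: "X \<in> Pow U" for X
  proof -
    have "\<not> separating G (col X)" using contra by blast
    moreover have "col X a b = col X b a" for a b by (simp add: col_def insert_commute)
    ultimately obtain x y where xy: "x \<in> ?V" "y \<in> ?V" "x \<noteq> y"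
      and less: "card (separators G (col X) x y) < need x y"
      unfolding separating_def need_def by (meson not_le)
    then have "(x, y) \<in> {p \<in> Pairs. X \<in> bad (fst p) (snd p)}"
      using X by (simp add: Pairs_def bad_def)
    moreover have "(y, x) \<in> {p \<in> Pairs. X \<in> bad (fst p) (snd p)}"
      using X xy less separators_commute[of "col X" x y] need_sym[of x y]
      by (simp add: Pairs_def bad_def)
    ultimately have "card {(x, y), (y, x)} \<le> card {p \<in> Pairs. X \<in> bad (fst p) (snd p)}"
      using finP by (intro card_mono) auto
    then show ?thesis using xy by simp
  qed
  have "2 * card (Pow U) = (\<Sum>X \<in> Pow U. 2)" by simp
  also have "\<dots> \<le> (\<Sum>X \<in> Pow U. card {p \<in> Pairs. X \<in> bad (fst p) (snd p)})"
    by (rule sum_mono) (use two in blast)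
  also have "\<dots> = (\<Sum>p \<in> Pairs. card {X \<in> Pow U. X \<in> bad (fst p) (snd p)})"
    using sum.swap_restrict[OF _ finP, of "Pow U" "\<lambda>_ _. 1 :: nat" "\<lambda>X p. X \<in> bad (fst p) (snd p)"] finU
    by simp
  also have "\<dots> = (\<Sum>p \<in> Pairs. card (bad (fst p) (snd p)))"
    by (rule sum.cong) (auto simp: bad_def intro!: arg_cong[of _ _ card])
  finally have "real (2 * card (Pow U)) \<le> (\<Sum>p \<in> Pairs. real (card (bad (fst p) (snd p))))"
    by (metis of_nat_mono of_nat_sum)
  also have "\<dots> \<le> (\<Sum>p \<in> Pairs. 2 ^ card U * risk G (fst p) (snd p))"
    by (rule sum_mono) (use risk in auto)
  also have "\<dots> = 2 ^ card U * (\<Sum>x \<in> ?V. \<Sum>y \<in> ?V - {x}. risk G x y)"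
    unfolding Pairs_def using fin by (simp add: sum.Sigma sum_distrib_left case_prod_beta')
  also have "\<dots> < 2 ^ card U * 2" using small by simp
  finally show False using finU by (simp add: card_Pow)
qed

section \<open>Centralizers and subgroups of small index\<close>

definition commutative :: "('a, 'm) monoid_scheme \<Rightarrow> 'a set \<Rightarrow> bool" where
  "commutative G H \<longleftrightarrow> (\<forall>a \<in> H. \<forall>b \<in> H. a \<otimes>\<^bsub>G\<^esub> b = b \<otimes>\<^bsub>G\<^esub> a)"

definition center_of :: "('a, 'm) monoid_scheme \<Rightarrow> 'a set \<Rightarrow> 'a set" where
  "center_of G H = {z \<in> H. \<forall>g \<in> H. z \<otimes>\<^bsub>G\<^esub> g = g \<otimes>\<^bsub>G\<^esub> z}"

lemma group_center_eq: "group_center G = center_of G (carrier G)"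
  by (simp add: group_center_def center_of_def)

lemma group_center_restrict [simp]: "group_center (G\<lparr>carrier := H\<rparr>) = center_of G H"
  by (simp add: group_center_def center_of_def)

lemma cent_restrict [simp]: "H \<subseteq> carrier G \<Longrightarrow> cent (G\<lparr>carrier := H\<rparr>) x = H \<inter> cent G x"
  by (auto simp: cent_def)

context group
begin

lemma commute_inv:
  assumes "x \<in> carrier G" "g \<in> carrier G" "x \<otimes> g = g \<otimes> x"
  shows "x \<otimes> inv g = inv g \<otimes> x"
proof -
  have "x \<otimes> inv g = inv g \<otimes> (g \<otimes> x) \<otimes> inv g" using assms(1,2) by (simp flip: m_assoc)
  also have "\<dots> = inv g \<otimes> (x \<otimes> g) \<otimes> inv g" using assms by simp
  also have "\<dots> = inv g \<otimes> x" using assms(1,2) by (simp add: m_assoc)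
  finally show ?thesis .
qed

lemma commute_mult:
  assumes "x \<in> carrier G" "g \<in> carrier G" "h \<in> carrier G"
    and "x \<otimes> g = g \<otimes> x" "x \<otimes> h = h \<otimes> x"
  shows "x \<otimes> (g \<otimes> h) = g \<otimes> h \<otimes> x"
proof -
  have "x \<otimes> (g \<otimes> h) = g \<otimes> x \<otimes> h" using assms by (metis m_assoc)
  also have "\<dots> = g \<otimes> h \<otimes> x" using assms by (metis m_assoc)
  finally show ?thesis .
qed

lemma subgroup_cent: "x \<in> carrier G \<Longrightarrow> subgroup (cent G x) G"
  by (rule subgroupI) (auto simp: cent_def commute_inv commute_mult)

lemma self_in_cent: "x \<in> carrier G \<Longrightarrow> x \<in> cent G x"
  by (simp add: cent_def)

lemma subgroup_center_of: "subgroup H G \<Longrightarrow> subgroup (center_of G H) G"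
proof (rule subgroupI)
  assume H: "subgroup H G"
  interpret H: subgroup H G by fact
  show "center_of G H \<subseteq> carrier G" by (auto simp: center_of_def)
  have "\<one> \<in> center_of G H" by (simp add: center_of_def)
  then show "center_of G H \<noteq> {}" by blast
  fix a assume a: "a \<in> center_of G H"
  then have aH: "a \<in> H" and comm: "\<And>g. g \<in> H \<Longrightarrow> g \<otimes> a = a \<otimes> g" by (auto simp: center_of_def)
  have "g \<otimes> inv a = inv a \<otimes> g" if "g \<in> H" for g
    using commute_inv[of g a] comm[OF that] that aH by simp
  then show "inv a \<in> center_of G H" using aH by (simp add: center_of_def)
  fix b assume b: "b \<in> center_of G H"
  then have bH: "b \<in> H" and commb: "\<And>g. g \<in> H \<Longrightarrow> g \<otimes> b = b \<otimes> g" by (auto simp: center_of_def)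
  have "g \<otimes> (a \<otimes> b) = a \<otimes> b \<otimes> g" if "g \<in> H" for g
    using commute_mult[of g a b] comm[OF that] commb[OF that] that aH bH by simp
  then show "a \<otimes> b \<in> center_of G H" using aH bH by (simp add: center_of_def)
qed

lemma subgroup_center: "subgroup (group_center G) G"
  unfolding group_center_eq by (rule subgroup_center_of) (rule subgroup_self)

lemma center_of_subset: "center_of G H \<subseteq> H"
  by (auto simp: center_of_def)

lemma center_subset_cent: "x \<in> carrier G \<Longrightarrow> group_center G \<subseteq> cent G x"
  by (auto simp: cent_def group_center_def)

lemma center_iff_cent: "x \<in> carrier G \<Longrightarrow> x \<in> group_center G \<longleftrightarrow> cent G x = carrier G"
  by (auto simp: cent_def group_center_def)

lemma subgroup_Int: "subgroup H G \<Longrightarrow> subgroup K G \<Longrightarrow> subgroup (H \<inter> K) G"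
  by (rule subgroups_Inter_pair)

lemma card_subgroup_dvd:
  assumes "subgroup K G" "subgroup H G" "K \<subseteq> H"
  shows "card K dvd card H"
proof -
  interpret H: group "G\<lparr>carrier := H\<rparr>" by (rule subgroup_imp_group) fact
  have "subgroup K (G\<lparr>carrier := H\<rparr>)" using assms by (simp add: subgroup_incl)
  from H.lagrange[OF this] obtain r where "card H = r * card K" by (auto simp: order_def dest: sym)
  then show ?thesis by simp
qed

lemma card_subgroup_proper:
  assumes fin: "finite (carrier G)" and K: "subgroup K G" and H: "subgroup H G" and sub: "K \<subset> H"
  shows "2 * card K \<le> card H"
proof -
  have finH: "finite H" using subgroup.subset[OF H] fin finite_subset by blast
  obtain q where q: "card H = card K * q" using card_subgroup_dvd[OF K H] sub by (auto elim: dvdE)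
  have "card K < card H" using psubset_card_mono[OF finH sub] .
  then have "2 \<le> q" using q by (cases q; cases "q - 1"; auto)
  then show ?thesis using q by (metis mult.commute mult_le_mono2)
qed

text \<open>Each fiber of the multiplication map on \<open>H \<times> K\<close> injects into
  \<open>H \<inter> K\<close>: \<open>h \<otimes> k = h0 \<otimes> k0\<close> gives
  \<open>inv h0 \<otimes> h = k0 \<otimes> inv k\<close>.\<close>

lemma card_prod_subgroups:
  assumes fin: "finite (carrier G)" and H: "subgroup H G" and K: "subgroup K G"
  shows "card H * card K \<le> card (carrier G) * card (H \<inter> K)"
proof -
  let ?f = "\<lambda>(h, k). h \<otimes> k"
  interpret H: subgroup H G by fact
  interpret K: subgroup K G by fact
  have finHK: "finite H" "finite K" using H.subset K.subset fin finite_subset by blast+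
  have fib: "card {p \<in> H \<times> K. ?f p = g} \<le> card (H \<inter> K)" if g: "g \<in> ?f ` (H \<times> K)" for g
  proof -
    obtain h0 k0 where 0: "h0 \<in> H" "k0 \<in> K" "g = h0 \<otimes> k0" using g by auto
    have "inj_on (\<lambda>(h, k). inv h0 \<otimes> h) {p \<in> H \<times> K. ?f p = g}"
    proof (rule inj_onI, clarsimp)
      fix h k h' k' assume *: "h \<in> H" "k \<in> K" "g = h \<otimes> k" "h' \<in> H" "k' \<in> K"
        "h' \<otimes> k' = h \<otimes> k" "inv h0 \<otimes> h = inv h0 \<otimes> h'"
      then have "h = h'" using 0 by simp
      then show "h = h' \<and> k = k'" using * by simp
    qed
    moreover have "(\<lambda>(h, k). inv h0 \<otimes> h) ` {p \<in> H \<times> K. ?f p = g} \<subseteq> H \<inter> K"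
    proof (rule image_subsetI)
      fix p assume "p \<in> {p \<in> H \<times> K. ?f p = g}"
      then obtain h k where *: "p = (h, k)" "h \<in> H" "k \<in> K" "g = h \<otimes> k" by auto
      then have "h \<otimes> k = h0 \<otimes> k0" using 0 by simp
      then have "inv h0 \<otimes> h = k0 \<otimes> inv k"
        using * 0 by (metis H.mem_carrier K.mem_carrier inv_solve_left inv_solve_right m_assoc
            m_closed inv_closed)
      moreover have "inv h0 \<otimes> h \<in> H" "k0 \<otimes> inv k \<in> K" using * 0 by simp_all
      ultimately show "(\<lambda>(h, k). inv h0 \<otimes> h) p \<in> H \<inter> K" using * by simp
    qed
    ultimately show ?thesis using finHK by (intro card_inj_on_le) auto
  qed
  have "card H * card K = (\<Sum>p \<in> H \<times> K. 1)" by (simp add: card_cartesian_product)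
  also have "\<dots> = (\<Sum>g \<in> ?f ` (H \<times> K). \<Sum>p \<in> {p \<in> H \<times> K. ?f p = g}. 1)"
    using finHK by (intro sum.image_gen) auto
  also have "\<dots> = (\<Sum>g \<in> ?f ` (H \<times> K). card {p \<in> H \<times> K. ?f p = g})" by simp
  also have "\<dots> \<le> card (?f ` (H \<times> K)) * card (H \<inter> K)"
    using sum_bounded_above[of "?f ` (H \<times> K)" _ "card (H \<inter> K)"] fib by simp
  also have "\<dots> \<le> card (carrier G) * card (H \<inter> K)"
    using fin by (intro mult_right_mono card_mono) auto
  finally show ?thesis .
qed

lemma card_common_nbrs:
  assumes fin: "finite (carrier G)" and x: "x \<in> carrier G" and y: "y \<in> carrier G"
  shows "card (common_nbrs G x y) + card (cent G x) + card (cent G y)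
    = card (carrier G) + card (cent G x \<inter> cent G y)"
proof -
  have sub: "cent G x \<subseteq> carrier G" "cent G y \<subseteq> carrier G" by (auto simp: cent_def)
  have finc: "finite (cent G x)" "finite (cent G y)" using sub fin finite_subset by blast+
  have "card (common_nbrs G x y) = card (carrier G) - card (cent G x \<union> cent G y)"
    unfolding common_nbrs_def using sub finc by (intro card_Diff_subset) auto
  moreover have "card (cent G x \<union> cent G y) \<le> card (carrier G)"
    using sub fin by (intro card_mono) auto
  moreover have "card (cent G x) + card (cent G y) = card (cent G x \<union> cent G y) + card (cent G x \<inter> cent G y)"
    using finc by (rule card_Un_Int)
  ultimately show ?thesis by linarith
qed

text \<open>With \<open>n\<close>, \<open>k\<close>, \<open>l\<close>, \<open>d\<close> the orders
  of the group, the two centralizers and their intersection, there are \<open>n + d - k - l\<close>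
  common neighbors. By \<open>k * l \<le> n * d\<close>, \<open>n\<close> times this number is at
  least \<open>(n - k) * (n - l)\<close>. The result is cleared of denominators to stay in the
  natural numbers.\<close>

lemma card_common_nbrs_ge:
  assumes fin: "finite (carrier G)" and x: "x \<in> carrier G" and y: "y \<in> carrier G"
    and a: "a * card (cent G x) \<le> card (carrier G)" and b: "b * card (cent G y) \<le> card (carrier G)"
    and pos: "1 \<le> a" "1 \<le> b"
  shows "(a - 1) * (b - 1) * card (carrier G) \<le> a * b * card (common_nbrs G x y)"
proof -
  let ?n = "int (card (carrier G))" and ?k = "int (card (cent G x))" and ?l = "int (card (cent G y))"
    and ?d = "int (card (cent G x \<inter> cent G y))" and ?m = "int (card (common_nbrs G x y))"
  have 1: "?m = ?n + ?d - ?k - ?l" using card_common_nbrs[OF fin x y] by linarith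
  have 2: "?k * ?l \<le> ?n * ?d"
    using card_prod_subgroups[OF fin subgroup_cent[OF x] subgroup_cent[OF y]]
    by (metis of_nat_le_iff of_nat_mult)
  have n: "?n > 0" using fin x by (auto simp: card_gt_0_iff)
  have a': "int a * ?k \<le> ?n" and b': "int b * ?l \<le> ?n" using a b by (metis of_nat_le_iff of_nat_mult)+
  have 3: "(int a - 1) * ?n \<le> int a * (?n - ?k)" using a' by (simp add: algebra_simps)
  have 4: "(int b - 1) * ?n \<le> int b * (?n - ?l)" using b' by (simp add: algebra_simps)
  have 5: "0 \<le> (int a - 1) * ?n" "0 \<le> (int b - 1) * ?n" using pos by simp_all
  have "((int a - 1) * ?n) * ((int b - 1) * ?n) \<le> (int a * (?n - ?k)) * (int b * (?n - ?l))"
    by (rule mult_mono[OF 3 4 order_trans[OF 5(1) 3] 5(2)])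
  also have "\<dots> = int a * int b * ((?n - ?k) * (?n - ?l))" by (simp add: algebra_simps)
  also have "\<dots> \<le> int a * int b * (?n * ?m)"
    using 2 unfolding 1 by (intro mult_left_mono) (auto simp: algebra_simps)
  finally have "?n * ((int a - 1) * (int b - 1) * ?n) \<le> ?n * (int a * int b * ?m)"
    by (simp add: algebra_simps)
  then have "(int a - 1) * (int b - 1) * ?n \<le> int a * int b * ?m" using n by simp
  then have "int ((a - 1) * (b - 1) * card (carrier G)) \<le> int (a * b * card (common_nbrs G x y))"
    using pos by (simp add: of_nat_diff)
  then show ?thesis by linarith
qed

text \<open>For a noncentral \<open>a\<close> of \<open>H\<close>, the centralizer of
  \<open>a\<close> in \<open>H\<close> lies strictly between the center of \<open>H\<close> and
  \<open>H\<close>; \<open>p\<close> and \<open>q\<close> are the two indices.\<close>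

lemma noncommutative_card:
  assumes fin: "finite (carrier G)" and H: "subgroup H G" and nc: "\<not> commutative G H"
  obtains p q where "2 \<le> p" "2 \<le> q" "card H = card (center_of G H) * p * q"
proof -
  obtain a where a: "a \<in> H" "a \<notin> center_of G H"
    using nc by (auto simp: commutative_def center_of_def)
  have aG: "a \<in> carrier G" using a H subgroup.mem_carrier by metis
  let ?C = "H \<inter> cent G a"
  have C: "subgroup ?C G" using H aG subgroup_Int subgroup_cent by blast
  have Z: "subgroup (center_of G H) G" using H by (rule subgroup_center_of)
  have "center_of G H \<subseteq> ?C" using a H by (auto simp: center_of_def cent_def subgroup.mem_carrier)
  moreover have "a \<in> ?C" using a aG by (simp add: cent_def)
  ultimately have ZC: "center_of G H \<subset> ?C" using a by blast
  have CH: "?C \<subset> H"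
  proof -
    obtain b where "b \<in> H" "a \<otimes> b \<noteq> b \<otimes> a" using a by (auto simp: center_of_def)
    then have "b \<notin> ?C" by (simp add: cent_def)
    then show ?thesis using \<open>b \<in> H\<close> by blast
  qed
  obtain p where p: "card ?C = card (center_of G H) * p"
    using card_subgroup_dvd[OF Z C] ZC by (auto elim: dvdE)
  obtain q where q: "card H = card ?C * q" using card_subgroup_dvd[OF C H] by (auto elim: dvdE)
  have pos: "0 < card (center_of G H)" "0 < card ?C"
    using Z C fin subgroup.finite_imp_card_positive by blast+
  have "2 * card (center_of G H) \<le> card ?C" "2 * card ?C \<le> card H"
    using card_subgroup_proper[OF fin] Z C H ZC CH by blast+
  then have "2 \<le> p" "2 \<le> q" using p q pos by (simp_all add: mult.commute)
  then show thesis using that p q by simp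
qed

text \<open>The translate of \<open>H\<close> by \<open>inv a\<close> avoids \<open>H\<close> and
  has the size of the complement, so it is the complement and contains \<open>b\<close>.\<close>

lemma index_2_mult:
  assumes fin: "finite (carrier G)" and H: "subgroup H G" and idx: "2 * card H = card (carrier G)"
    and a: "a \<in> carrier G - H" and b: "b \<in> carrier G - H"
  shows "a \<otimes> b \<in> H"
proof -
  interpret H: subgroup H G by fact
  have finH: "finite H" using H.subset fin finite_subset by blast
  have aG: "a \<in> carrier G" and bG: "b \<in> carrier G" using a b by auto
  let ?aH = "(\<lambda>h. inv a \<otimes> h) ` H"
  have ia: "inv a \<in> carrier G - H" using a by (metis Diff_iff H.m_inv_closed inv_closed inv_inv)
  have "?aH \<subseteq> carrier G - H"
  proof (intro image_subsetI DiffI)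
    fix h assume h: "h \<in> H"
    show "inv a \<otimes> h \<in> carrier G" using h aG by simp
    show "inv a \<otimes> h \<notin> H"
    proof
      assume "inv a \<otimes> h \<in> H"
      then have "inv a \<otimes> h \<otimes> inv h \<in> H" using h by simp
      then show False using ia h aG by (simp add: m_assoc)
    qed
  qed
  moreover have "card ?aH = card (carrier G - H)"
  proof -
    have "card ?aH = card H" using aG by (intro card_image) (auto simp: inj_on_def)
    moreover have "card (carrier G - H) = card (carrier G) - card H"
      using finH H.subset by (rule card_Diff_subset)
    ultimately show ?thesis using idx by linarith
  qed
  ultimately have "?aH = carrier G - H" using fin by (metis card_subset_eq finite_Diff)
  then obtain h where h: "h \<in> H" "b = inv a \<otimes> h" using b by blast
  then have "a \<otimes> b = h" using aG by (simp flip: m_assoc)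
  then show ?thesis using h by simp
qed

text \<open>Membership in \<open>H\<close> is a parity homomorphism. Two such parities will serve as
  coordinates in the central product.\<close>

lemma index_2_mult_iff:
  assumes fin: "finite (carrier G)" and H: "subgroup H G" and idx: "2 * card H = card (carrier G)"
    and a: "a \<in> carrier G" and b: "b \<in> carrier G"
  shows "a \<otimes> b \<in> H \<longleftrightarrow> (a \<in> H \<longleftrightarrow> b \<in> H)"
proof -
  interpret H: subgroup H G by fact
  have "a \<otimes> b \<in> H" if "a \<notin> H" "b \<notin> H"
    using index_2_mult[OF fin H idx] that a b by blast
  moreover have "b \<in> H" if ab: "a \<otimes> b \<in> H" "a \<in> H"
  proof -
    have "inv a \<otimes> (a \<otimes> b) \<in> H" using ab by blast
    then show ?thesis using a b by (simp flip: m_assoc)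
  qed
  moreover have "a \<in> H" if ab: "a \<otimes> b \<in> H" "b \<in> H"
  proof -
    have "a \<otimes> b \<otimes> inv b \<in> H" using ab by blast
    then show ?thesis using a b by (simp add: m_assoc)
  qed
  ultimately show ?thesis by blast
qed

lemma index_2_conj:
  assumes fin: "finite (carrier G)" and H: "subgroup H G" and idx: "2 * card H = card (carrier G)"
    and h: "h \<in> H" and g: "g \<in> carrier G"
  shows "inv g \<otimes> h \<otimes> g \<in> H"
proof (cases "g \<in> H")
  case True then show ?thesis using h H by (simp add: subgroup.m_closed subgroup.m_inv_closed)
next
  case False
  interpret H: subgroup H G by fact
  have ig: "inv g \<in> carrier G - H" using False g by (metis Diff_iff H.m_inv_closed inv_closed inv_inv)
  have "h \<otimes> g \<notin> H"
  proof
    assume "h \<otimes> g \<in> H"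
    then have "inv h \<otimes> (h \<otimes> g) \<in> H" using h by simp
    then show False using False g h by (simp flip: m_assoc)
  qed
  then have "inv g \<otimes> (h \<otimes> g) \<in> H" using index_2_mult[OF fin H idx ig] g h by simp
  then show ?thesis using g h by (simp add: m_assoc)
qed

end

section \<open>Groups with an abelian subgroup of index 2\<close>

context group
begin

text \<open>The condition on a pair is symmetric, so one order suffices; in a mixed pair the element
  with \<open>P\<close> comes first.\<close>

lemma separatingI_wlog:
  assumes sym: "\<And>a b. \<kappa> a b = \<kappa> b a"
    and sep: "\<And>x y. x \<in> carrier G - group_center G \<Longrightarrow> y \<in> carrier G - group_center G \<Longrightarrow> x \<noteq> y \<Longrightarrow>
      P x \<or> \<not> P y \<Longrightarrow> (if y \<in> cent G x then 2 else 1) \<le> card (separators G \<kappa> x y)"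
  shows "separating G \<kappa>"
  unfolding separating_def
proof (intro conjI allI ballI impI)
  show "\<kappa> x y = \<kappa> y x" for x y by (rule sym)
  fix x y assume xy: "x \<in> carrier G - group_center G" "y \<in> carrier G - group_center G" "x \<noteq> y"
  show "(if y \<in> cent G x then 2 else 1) \<le> card (separators G \<kappa> x y)"
  proof (cases "P x \<or> \<not> P y")
    case True then show ?thesis using sep xy by blast
  next
    case False
    then have "(if x \<in> cent G y then 2 else 1) \<le> card (separators G \<kappa> y x)" using sep[of y x] xy by simp
    then show ?thesis using xy cent_sym[of x G y] separators_commute[of \<kappa> x y] by simp
  qed
qed

lemma finite_separators: "finite (carrier G) \<Longrightarrow> finite (separators G \<kappa> x y)"
  by (simp add: separators_def)

lemma card_separators_ge_2I:
  assumes "finite (carrier G)" "a \<in> separators G \<kappa> x y" "b \<in> separators G \<kappa> x y" "a \<noteq> b"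
  shows "2 \<le> card (separators G \<kappa> x y)"
proof -
  have "card {a, b} \<le> card (separators G \<kappa> x y)"
    using assms by (intro card_mono finite_separators) auto
  then show ?thesis using assms(4) by simp
qed

text \<open>A proper subgroup strictly above \<open>H\<close> would force
  \<open>4 * card H \<le> card (carrier G)\<close>. In use, \<open>K\<close> is mostly a
  centralizer: what commutes with \<open>H\<close> and with one element outside is central.\<close>

lemma index_2_maximal:
  assumes fin: "finite (carrier G)" and H: "subgroup H G" and idx: "2 * card H = card (carrier G)"
    and K: "subgroup K G" and sub: "H \<subseteq> K" and g: "g \<in> K" "g \<notin> H"
  shows "K = carrier G"
proof (rule ccontr)
  assume "K \<noteq> carrier G"
  then have "K \<subset> carrier G" using subgroup.subset[OF K] by blast
  then have "2 * card K \<le> card (carrier G)" using card_subgroup_proper[OF fin K subgroup_self] by blast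
  moreover have "2 * card H \<le> card K" using card_subgroup_proper[OF fin H K] sub g by blast
  moreover have "0 < card (carrier G)" using fin by (auto simp: card_gt_0_iff)
  ultimately show False using idx by linarith
qed

text \<open>By maximality of \<open>H\<close>, its noncentral elements have centralizer exactly
  \<open>H\<close>, and elements outside \<open>H\<close> commute only if they differ by a central
  factor. The graph is thus known explicitly for every order.\<close>

lemma separating_abelian_index_2:
  assumes fin: "finite (carrier G)" and nc: "\<not> commutative G (carrier G)"
    and H: "subgroup H G" and comm: "commutative G H" and idx: "2 * card H = card (carrier G)"
  shows "\<exists>\<kappa>. separating G \<kappa>"
proof -
  let ?Z = "group_center G"
  interpret H: subgroup H G by fact
  interpret Z: subgroup ?Z G by (rule subgroup_center)
  have maxi: "K = carrier G" if "subgroup K G" "H \<subseteq> K" "g \<in> K" "g \<notin> H" for K g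
    using index_2_maximal[OF fin H idx] that by blast
  have Hcent: "H \<subseteq> cent G h" if "h \<in> H" for h
    using comm that H.subset by (auto simp: commutative_def cent_def)
  have centH: "h \<in> ?Z" if "h \<in> H" "g \<in> carrier G" "g \<notin> H" "g \<in> cent G h" for h g
    using maxi[OF subgroup_cent[of h] Hcent[OF that(1)] that(4,3)] that(1) center_iff_cent[of h] by simp
  have HZ: "\<not> H \<subseteq> ?Z"
  proof
    assume *: "H \<subseteq> ?Z"
    have "a \<in> ?Z" if a: "a \<in> carrier G" for a
    proof (cases "a \<in> H")
      case False
      have "H \<subseteq> cent G a" using * center_subset_cent[OF a] by blast
      then have "cent G a = carrier G" using maxi[OF subgroup_cent[OF a]] self_in_cent[OF a] False by blast
      then show ?thesis using center_iff_cent[OF a] by simp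
    qed (use * in blast)
    then show False using nc unfolding commutative_def group_center_def by blast
  qed
  have ZH: "?Z \<subseteq> H"
  proof
    fix z assume z: "z \<in> ?Z"
    show "z \<in> H"
    proof (rule ccontr)
      assume zH: "z \<notin> H"
      have "h \<in> ?Z" if h: "h \<in> H" for h
      proof (rule centH[OF h _ zH])
        show "z \<in> carrier G" using z by simp
        show "z \<in> cent G h" using z h center_subset_cent[of h] by auto
      qed
      then have "H \<subseteq> ?Z" by (rule subsetI)
      then show False using HZ by contradiction
    qed
  qed
  define R where "R = H - ?Z"
  have RH: "r \<in> H" "r \<in> carrier G" "r \<notin> ?Z" if "r \<in> R" for r using that by (auto simp: R_def)
  have cR: "cent G r = H" if r: "r \<in> R" for r
    using Hcent[of r] centH[of r] RH[OF r] by (auto simp: cent_def)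
  obtain r0 where r0: "r0 \<in> R" using HZ by (auto simp: R_def)
  have "0 < card H" using fin by (rule H.finite_imp_card_positive)
  then have "H \<noteq> carrier G" using idx by auto
  then obtain t where t: "t \<in> carrier G" "t \<notin> H" using H.subset by blast
  have finH: "finite H" using H.subset fin finite_subset by blast
  then have finR: "finite R" by (simp add: R_def)
  \<comment> \<open>A second element of \<open>R\<close> is the conjugate of \<open>r0\<close> by
    \<open>t\<close>: it differs from \<open>r0\<close> because \<open>t\<close> lies outside
    \<open>cent G r0\<close>, and a central conjugate would equal \<open>r0\<close>.\<close>
  have R2: "2 \<le> card R"
  proof -
    let ?r = "inv t \<otimes> r0 \<otimes> t"
    have rH: "?r \<in> H" using index_2_conj[OF fin H idx] RH[OF r0] t by blast
    have tr: "t \<otimes> ?r = r0 \<otimes> t" using t RH[OF r0] by (simp flip: m_assoc)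
    have "?r \<noteq> r0"
    proof
      assume "?r = r0"
      then have "t \<in> cent G r0" using tr t by (simp add: cent_def)
      then show False using cR[OF r0] t by blast
    qed
    moreover have "?r \<notin> ?Z"
    proof
      assume *: "?r \<in> ?Z"
      then have "?r \<otimes> t = t \<otimes> ?r" using t unfolding group_center_def by blast
      then have "?r = r0" using tr t RH[OF r0] rH by (metis H.mem_carrier right_cancel)
      then show False using \<open>?r \<noteq> r0\<close> by contradiction
    qed
    ultimately have "{r0, ?r} \<subseteq> R" "card {r0, ?r} = 2" using r0 rH by (auto simp: R_def)
    then show ?thesis using finR card_mono by metis
  qed
  have ZR: "card ?Z \<le> card R"
  proof -
    have "2 * card ?Z \<le> card H" using card_subgroup_proper[OF fin subgroup_center H] ZH HZ by blast
    moreover have "card R = card H - card ?Z" unfolding R_def using ZH finH finite_subset by (intro card_Diff_subset) auto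
    ultimately show ?thesis by linarith
  qed
  txt \<open>
    Each \<open>r \<in> R\<close> is adjacent to the whole of the other coset \<open>t H\<close>, and edges inside \<open>t H\<close> get color 0.
    So \<open>code h\<close>, the set of those \<open>r\<close> for which the edge between \<open>r\<close> and \<open>t h\<close> has color 1, must determine
    \<open>h\<close>, with distance at least 2 when the elements of \<open>t H\<close> commute, that is, on the cosets of the center.
    The singletons on \<open>R\<close> separate the rows; on the center any sets at mutual
    distance 2 will do that cover \<open>R\<close> and are no singletons.
  \<close>
  define \<delta> where "\<delta> s = inv t \<otimes> s" for s
  \<comment> \<open>Normally the code of a central \<open>h\<close> omits the point
    \<open>r0 \<otimes> h\<close>; multiplication by \<open>r0\<close> embeds the center into
    \<open>R\<close>, so different \<open>h\<close> omit different points. For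
    \<open>card R = 2\<close> these codes would be singletons, and for a trivial center
    \<open>r0\<close> would stay uncovered. Then \<open>R\<close> and \<open>{}\<close> serve
    instead; by \<open>ZR\<close>, at most two central codes are required when
    \<open>card R = 2\<close>.\<close>
  define small where "small \<longleftrightarrow> card ?Z = 1 \<or> card R = 2"
  define code where "code h = (if h \<in> R then {h} else if small then (if h = \<one> then R else {}) else R - {r0 \<otimes> h})" for h
  define \<kappa> where "\<kappa> a b \<longleftrightarrow> a \<in> R \<and> b \<in> carrier G - H \<and> a \<in> code (\<delta> b) \<or>
      b \<in> R \<and> a \<in> carrier G - H \<and> b \<in> code (\<delta> a)" for a b
  have it: "inv t \<in> carrier G - H" using t H.m_inv_closed[of "inv t"] by auto
  have \<delta>H: "\<delta> s \<in> H" if "s \<in> carrier G - H" for s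
    using index_2_mult[OF fin H idx it that] by (simp add: \<delta>_def)
  have \<delta>t: "\<delta> (t \<otimes> h) = h" "t \<otimes> h \<in> carrier G - H" if "h \<in> H" for h
  proof -
    show "\<delta> (t \<otimes> h) = h" using that t by (simp add: \<delta>_def flip: m_assoc)
    have "t \<otimes> h \<notin> H"
    proof
      assume "t \<otimes> h \<in> H"
      then have "t \<otimes> h \<otimes> inv h \<in> H" using that by simp
      then show False using that t by (simp add: m_assoc)
    qed
    then show "t \<otimes> h \<in> carrier G - H" using that t by simp
  qed
  have \<delta>inj: "\<delta> s \<noteq> \<delta> s'" if "s \<in> carrier G" "s' \<in> carrier G" "s \<noteq> s'" for s s'
    using that t by (simp add: \<delta>_def)
  have outside_H: "s \<notin> ?Z" if "s \<in> carrier G - H" for s using that ZH by blast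
  \<comment> \<open>The quotient lies in \<open>H\<close> and commutes with \<open>s\<close> outside
    \<open>H\<close>, so it is central.\<close>
  have cS: "inv (\<delta> s) \<otimes> \<delta> s' \<in> ?Z" if s: "s \<in> carrier G - H" "s' \<in> carrier G - H" "s' \<in> cent G s" for s s'
  proof -
    have "inv (\<delta> s) \<otimes> \<delta> s' = inv s \<otimes> s'"
      using s t by (simp add: \<delta>_def inv_mult_group m_assoc) (simp flip: m_assoc)
    moreover have "inv s \<otimes> s' \<in> H"
      using index_2_mult[OF fin H idx, of "inv s" s'] s H.m_inv_closed[of "inv s"] by auto
    moreover have "inv s \<otimes> s' \<in> cent G s"
      using subgroup_cent[of s] s self_in_cent[of s] by (simp add: subgroup.m_closed subgroup.m_inv_closed)
    ultimately show ?thesis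
      using centH[of "inv s \<otimes> s'" s] s cent_sym[of s G "inv s \<otimes> s'"] by auto
  qed
  have Rs: "r \<notin> cent G s" if "r \<in> R" "s \<in> carrier G - H" for r s
    using cR[OF that(1)] that RH[OF that(1)] cent_sym[of r G s] by auto
  have codeR: "code h \<subseteq> R" for h using r0 by (auto simp: code_def)
  have \<kappa>RS: "\<kappa> r s \<longleftrightarrow> r \<in> code (\<delta> s)" "\<kappa> s r \<longleftrightarrow> r \<in> code (\<delta> s)"
    if "r \<in> R" "s \<in> carrier G - H" for r s
    using that by (auto simp: \<kappa>_def R_def)
  have \<kappa>SS: "\<not> \<kappa> s s'" if "s \<in> carrier G - H" "s' \<in> carrier G - H" for s s'
    using that by (auto simp: \<kappa>_def R_def)
  have cover: "\<exists>z \<in> ?Z. r \<in> code z" if r: "r \<in> R" for r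
  proof (cases small)
    case True
    then have "r \<in> code \<one>" using r by (auto simp: code_def R_def)
    then show ?thesis by auto
  next
    case False
    have "card ?Z \<noteq> 0" using Z.finite_imp_card_positive fin by simp
    then have "2 \<le> card ?Z" using False by (auto simp: small_def)
    then obtain z z' where z: "z \<in> ?Z" "z' \<in> ?Z" "z \<noteq> z'" by (rule card_ge_2_obtain)
    then have "r0 \<otimes> z \<noteq> r0 \<otimes> z'" using RH[OF r0] by simp
    then have "r \<in> code z \<or> r \<in> code z'" using z r False by (auto simp: code_def R_def)
    then show ?thesis using z by blast
  qed
  have r0Z: "r0 \<otimes> z \<in> R" if "z \<in> ?Z" for z
  proof -
    have "r0 \<otimes> z \<in> H" using that ZH RH[OF r0] by blast
    moreover have "r0 \<otimes> z \<notin> ?Z"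
    proof
      assume "r0 \<otimes> z \<in> ?Z"
      then have "r0 \<otimes> z \<otimes> inv z \<in> ?Z" using that by simp
      then show False using that RH[OF r0] by (simp add: m_assoc)
    qed
    ultimately show ?thesis by (simp add: R_def)
  qed
  have code_sep: "separators G \<kappa> s s' \<supseteq> (code (\<delta> s) - code (\<delta> s')) \<union> (code (\<delta> s') - code (\<delta> s))"
    if s: "s \<in> carrier G - H" "s' \<in> carrier G - H" for s s'
    using codeR Rs[OF _ s(1)] Rs[OF _ s(2)] \<kappa>RS(2)[OF _ s(1)] \<kappa>RS(2)[OF _ s(2)] RH(2)
    unfolding separators_def by blast
  have "separating G \<kappa>"
  proof (rule separatingI_wlog[where P = "\<lambda>x. x \<in> H"])
    show "\<kappa> a b = \<kappa> b a" for a b by (auto simp: \<kappa>_def)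
    fix x y assume x: "x \<in> carrier G - ?Z" and y: "y \<in> carrier G - ?Z" and ne: "x \<noteq> y"
      and or: "x \<in> H \<or> y \<notin> H"
    consider (RR) "x \<in> R" "y \<in> R" | (RS) "x \<in> R" "y \<in> carrier G - H"
      | (SS) "x \<in> carrier G - H" "y \<in> carrier G - H"
      using x y or by (auto simp: R_def)
    then show "(if y \<in> cent G x then 2 else 1) \<le> card (separators G \<kappa> x y)"
    proof cases
      case RR
      have "t \<otimes> x \<in> separators G \<kappa> x y" "t \<otimes> y \<in> separators G \<kappa> x y"
        using \<delta>t[of x] \<delta>t[of y] RH[OF RR(1)] RH[OF RR(2)] cR[OF RR(1)] cR[OF RR(2)] RR ne
        by (auto simp: separators_def \<kappa>RS code_def)
      moreover have "t \<otimes> x \<noteq> t \<otimes> y" using ne RH[OF RR(1)] RH[OF RR(2)] t by simp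
      ultimately have "2 \<le> card (separators G \<kappa> x y)" by (rule card_separators_ge_2I[OF fin])
      then show ?thesis by simp
    next
      case RS
      obtain z where z: "z \<in> ?Z" "x \<in> code z" using cover[OF RS(1)] by blast
      have zH: "z \<in> H" using z ZH by blast
      have sepI: "t \<otimes> h \<in> separators G \<kappa> x y" if h: "h \<in> H" "t \<otimes> h \<notin> cent G y" "x \<in> code h" for h
        using \<delta>t[OF h(1)] h RS cR[OF RS(1)] \<kappa>RS(1)[OF RS(1), of "t \<otimes> h"] \<kappa>SS[of y "t \<otimes> h"]
        by (auto simp: separators_def)
      have "separators G \<kappa> x y \<noteq> {}"
      \<comment> \<open>Since edges inside the coset have color 0, any \<open>t \<otimes> h\<close>
        not commuting with \<open>y\<close> separates if \<open>x \<in> code h\<close>. If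
        \<open>h = x\<close> fails because \<open>t \<otimes> x\<close> commutes with
        \<open>y\<close>, the central \<open>z\<close> from \<open>cover\<close> works: otherwise
        \<open>x\<close> and \<open>z\<close> would lie in the same coset of the center.\<close>
      proof (cases "t \<otimes> x \<in> cent G y")
        case False
        then show ?thesis using sepI[of x] RH[OF RS(1)] RS by (auto simp: code_def)
      next
        case True
        have 1: "inv (\<delta> y) \<otimes> x \<in> ?Z" using cS[OF RS(2) _ True] \<delta>t[OF RH(1)[OF RS(1)]] by simp
        have "t \<otimes> z \<notin> cent G y"
        proof
          assume *: "t \<otimes> z \<in> cent G y"
          have dH: "\<delta> y \<in> H" using \<delta>H RS by blast
          have "inv (\<delta> y) \<otimes> z \<in> ?Z" using cS[OF RS(2) _ *] \<delta>t[OF zH] by simp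
          then have "inv (\<delta> y) \<otimes> z \<otimes> inv z \<in> ?Z" using z(1) by simp
          then have "inv (\<delta> y) \<in> ?Z" using dH z(1) by (simp add: m_assoc)
          then have "inv (inv (\<delta> y)) \<otimes> (inv (\<delta> y) \<otimes> x) \<in> ?Z" using 1 by blast
          then have "x \<in> ?Z" using dH RH[OF RS(1)] by (simp flip: m_assoc)
          then show False using x by blast
        qed
        then show ?thesis using sepI[OF zH] z by blast
      qed
      then have "1 \<le> card (separators G \<kappa> x y)"
        using finite_separators[OF fin] by (simp add: Suc_le_eq card_gt_0_iff)
      moreover have "y \<notin> cent G x" using cR[OF RS(1)] RS by blast
      ultimately show ?thesis by simp
    next
      case SS
      let ?h = "\<delta> x" and ?h' = "\<delta> y"
      let ?\<Delta> = "(code ?h - code ?h') \<union> (code ?h' - code ?h)"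
      have hh: "?h \<in> H" "?h' \<in> H" "?h \<noteq> ?h'" using \<delta>H SS \<delta>inj ne by blast+
      have le: "card ?\<Delta> \<le> card (separators G \<kappa> x y)"
        by (rule card_mono[OF finite_separators[OF fin] code_sep[OF SS]])
      have size_code: "card (code h) \<noteq> 1" if "h \<notin> R" "h \<in> H" for h
      proof (cases small)
        case True then show ?thesis using that R2 by (auto simp: code_def)
      next
        case False
        then have "card (code h) = card R - 1" using that r0Z[of h] finR by (simp add: code_def R_def)
        moreover have "3 \<le> card R" using False R2 by (auto simp: small_def)
        ultimately show ?thesis by linarith
      qed
      \<comment> \<open>Exactly one of the two codes is a singleton. Commuting elements have
        \<open>\<delta>\<close> values in one coset of the center, so \<open>x\<close> and
        \<open>y\<close> do not commute and one separator is enough.\<close>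
      have mixed: "1 \<le> card ?\<Delta> \<and> y \<notin> cent G x" if m: "?h \<in> R \<and> ?h' \<notin> R \<or> ?h \<notin> R \<and> ?h' \<in> R"
      proof
        have "code ?h \<noteq> code ?h'"
          using m size_code[of ?h] size_code[of ?h'] hh by (metis card.empty code_def empty_iff is_singletonI is_singleton_altdef)
        then have "?\<Delta> \<noteq> {}" by blast
        moreover have "finite ?\<Delta>" using codeR finR finite_subset by (meson finite_Diff finite_UnI)
        ultimately show "1 \<le> card ?\<Delta>" by (simp add: Suc_le_eq card_gt_0_iff)
        show "y \<notin> cent G x"
        proof
          assume "y \<in> cent G x"
          then have q: "inv ?h \<otimes> ?h' \<in> ?Z" using cS[OF SS] by blast
          have "?h \<in> ?Z \<longleftrightarrow> ?h' \<in> ?Z"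
          proof
            assume "?h \<in> ?Z"
            then have "?h \<otimes> (inv ?h \<otimes> ?h') \<in> ?Z" using q by blast
            then show "?h' \<in> ?Z" using hh by (simp flip: m_assoc)
          next
            assume *: "?h' \<in> ?Z"
            have "?h' \<otimes> inv (inv ?h \<otimes> ?h') \<in> ?Z" using q * by blast
            then show "?h \<in> ?Z" using hh by (simp add: inv_mult_group flip: m_assoc)
          qed
          then show False using m hh by (auto simp: R_def)
        qed
      qed
      have same: "2 \<le> card ?\<Delta>" if m: "?h \<in> R \<longleftrightarrow> ?h' \<in> R"
      proof (cases "?h \<in> R")
        case True
        then have "?\<Delta> = {?h, ?h'}" using m hh by (auto simp: code_def)
        then show ?thesis using hh by simp
      next
        case False
        then have Zs: "?h \<in> ?Z" "?h' \<in> ?Z" using m hh by (auto simp: R_def)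
        show ?thesis
        proof (cases small)
          case True
          have finZ: "finite ?Z" using Z.subset fin finite_subset by blast
          have "card {?h, ?h'} \<le> card ?Z" using Zs finZ by (intro card_mono) auto
          then have cR2: "card R = 2" using True hh by (auto simp: small_def)
          have "?h = \<one> \<or> ?h' = \<one>"
          proof (rule ccontr)
            assume "\<not> ?thesis"
            then have "card {\<one>, ?h, ?h'} = 3" using hh by auto
            moreover have "card {\<one>, ?h, ?h'} \<le> card ?Z" using Zs finZ by (intro card_mono) auto
            ultimately show False using ZR cR2 by linarith
          qed
          then have "?\<Delta> = R" using True False m hh unfolding code_def by auto
          then show ?thesis using cR2 by simp
        next
          case ns: False
          have "r0 \<otimes> ?h \<noteq> r0 \<otimes> ?h'" using hh RH[OF r0] by simp
          moreover have "code ?h = R - {r0 \<otimes> ?h}" "code ?h' = R - {r0 \<otimes> ?h'}"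
            using False m ns by (simp_all add: code_def)
          moreover have "r0 \<otimes> ?h \<in> R" "r0 \<otimes> ?h' \<in> R" using r0Z Zs by blast+
          moreover have "(R - {a} - (R - {b})) \<union> (R - {b} - (R - {a})) = {a, b}"
            if "a \<in> R" "b \<in> R" "a \<noteq> b" for a b using that by auto
          ultimately have "?\<Delta> = {r0 \<otimes> ?h, r0 \<otimes> ?h'}" "r0 \<otimes> ?h \<noteq> r0 \<otimes> ?h'" by simp_all
          then show ?thesis by simp
        qed
      qed
      show ?thesis using same mixed le by (cases "?h \<in> R \<longleftrightarrow> ?h' \<in> R") auto
    qed
  qed
  then show ?thesis by blast
qed

end

section \<open>Noncommuting elements with centralizers of index 2\<close>

context group
begin

lemma center_comm: "z \<in> group_center G \<Longrightarrow> g \<in> carrier G \<Longrightarrow> z \<otimes> g = g \<otimes> z"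
  by (auto simp: group_center_def)

lemma centD: "y \<in> cent G x \<Longrightarrow> x \<otimes> y = y \<otimes> x"
  by (simp add: cent_def)

lemma cent_iff: "y \<in> carrier G \<Longrightarrow> y \<in> cent G x \<longleftrightarrow> x \<otimes> y = y \<otimes> x"
  by (simp add: cent_def)

lemma in_centerI: "z \<in> carrier G \<Longrightarrow> (\<And>g. g \<in> carrier G \<Longrightarrow> g \<in> cent G z) \<Longrightarrow> z \<in> group_center G"
  by (auto simp: group_center_def cent_def)

text \<open>\<open>cent G x\<close> has index 2, hence is normal, so conjugating \<open>x\<close>
  does not change its centralizer.\<close>

lemma conj_cent_index_2:
  assumes fin: "finite (carrier G)" and x: "x \<in> carrier G" and y: "y \<in> carrier G"
    and idx: "2 * card (cent G x) = card (carrier G)" and h: "h \<in> cent G x"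
  shows "h \<in> cent G (inv y \<otimes> x \<otimes> y)"
proof -
  have hG: "h \<in> carrier G" using h by (simp add: cent_def)
  have "inv (inv y) \<otimes> h \<otimes> inv y \<in> cent G x"
    by (rule index_2_conj[OF fin subgroup_cent[OF x] idx h]) (use y in simp)
  then have *: "x \<otimes> (y \<otimes> h \<otimes> inv y) = y \<otimes> h \<otimes> inv y \<otimes> x" using y by (simp add: cent_def)
  have "inv y \<otimes> x \<otimes> y \<otimes> h = inv y \<otimes> (x \<otimes> (y \<otimes> h \<otimes> inv y)) \<otimes> y"
    using x y hG by (simp add: m_assoc)
  also have "\<dots> = inv y \<otimes> (y \<otimes> h \<otimes> inv y \<otimes> x) \<otimes> y" using * by (rule arg_cong)
  also have "\<dots> = h \<otimes> (inv y \<otimes> x \<otimes> y)" using x y hG by (simp add: m_assoc) (simp flip: m_assoc)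
  finally show ?thesis using hG by (simp add: cent_def)
qed

text \<open>The commutator of \<open>x\<close> and \<open>y\<close> commutes with both centralizers, so it is central.\<close>

lemma card_center_ge_2:
  assumes fin: "finite (carrier G)" and x: "x \<in> carrier G" and y: "y \<in> carrier G"
    and idx: "2 * card (cent G x) = card (carrier G)" and idy: "2 * card (cent G y) = card (carrier G)"
    and nc: "y \<notin> cent G x"
  shows "2 \<le> card (group_center G)"
proof -
  let ?c = "inv x \<otimes> (inv y \<otimes> x \<otimes> y)"
  have c: "?c \<in> carrier G" using x y by simp
  have "?c \<noteq> \<one>"
  proof
    assume "?c = \<one>"
    then have "x = inv y \<otimes> x \<otimes> y" using x y by (metis c inv_closed inv_equality inv_inv m_closed r_one inv_solve_left)
    then have "y \<otimes> x = x \<otimes> y" using x y by (metis inv_closed inv_solve_left m_assoc m_closed)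
    then show False using nc y by (simp add: cent_def)
  qed
  have 1: "h \<in> cent G ?c" if h: "h \<in> cent G x" for h
  proof -
    have hG: "h \<in> carrier G" and "h \<otimes> x = x \<otimes> h" using h by (simp_all add: cent_def)
    then have "h \<otimes> inv x = inv x \<otimes> h" using commute_inv[of h x] x by simp
    moreover have "h \<otimes> (inv y \<otimes> x \<otimes> y) = inv y \<otimes> x \<otimes> y \<otimes> h"
      using conj_cent_index_2[OF fin x y idx h] by (simp add: cent_def)
    ultimately have "h \<otimes> ?c = ?c \<otimes> h" using commute_mult[of h "inv x" "inv y \<otimes> x \<otimes> y"] hG x y by simp
    then show ?thesis using hG by (simp add: cent_def)
  qed
  have 2: "h \<in> cent G ?c" if h: "h \<in> cent G y" for h
  proof -
    have hG: "h \<in> carrier G" and hy: "h \<otimes> y = y \<otimes> h" using h by (simp_all add: cent_def)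
    \<comment> \<open>Bracketed the other way, the commutator is a conjugate of \<open>inv y\<close>
      times \<open>y\<close>, so the argument applies to \<open>cent G y\<close> too.\<close>
    have e: "?c = inv (inv x \<otimes> y \<otimes> x) \<otimes> y" using x y by (simp add: inv_mult_group m_assoc)
    have "h \<otimes> (inv x \<otimes> y \<otimes> x) = inv x \<otimes> y \<otimes> x \<otimes> h"
      using conj_cent_index_2[OF fin y x idy h] by (simp add: cent_def)
    then have "h \<otimes> inv (inv x \<otimes> y \<otimes> x) = inv (inv x \<otimes> y \<otimes> x) \<otimes> h"
      using commute_inv[of h "inv x \<otimes> y \<otimes> x"] hG x y by simp
    then have "h \<otimes> ?c = ?c \<otimes> h" unfolding e
      using commute_mult[of h "inv (inv x \<otimes> y \<otimes> x)" y] hG hy x y by simp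
    then show ?thesis using hG by (simp add: cent_def)
  qed
  have "cent G ?c = carrier G"
    by (rule index_2_maximal[OF fin subgroup_cent[OF x] idx subgroup_cent[OF c] _ 2[OF self_in_cent[OF y]] nc])
       (use 1 in blast)
  then have "?c \<in> group_center G" using center_iff_cent[OF c] by simp
  moreover have "\<one> \<in> group_center G" using subgroup.one_closed[OF subgroup_center] .
  moreover have "finite (group_center G)" using fin by (simp add: group_center_def)
  ultimately have "card {\<one>, ?c} \<le> card (group_center G)" by (intro card_mono) auto
  then show ?thesis using \<open>?c \<noteq> \<one>\<close> by simp
qed

text \<open>Membership in the two centralizers gives two parities, so \<open>\<one>\<close>,
  \<open>x\<close>, \<open>y\<close> and \<open>x \<otimes> y\<close> represent the cosets of
  \<open>D\<close>. As \<open>D\<close> commutes with these representatives, products are computed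
  separately in the two coordinates.\<close>

lemma separating_central_product:
  assumes fin: "finite (carrier G)" and x: "x \<in> carrier G" and y: "y \<in> carrier G"
    and idx: "2 * card (cent G x) = card (carrier G)" and idy: "2 * card (cent G y) = card (carrier G)"
    and nc: "y \<notin> cent G x" and D: "D = cent G x \<inter> cent G y"
    and Dnc: "\<not> commutative G D" and sepD: "separating (G\<lparr>carrier := D\<rparr>) \<kappa>D"
  shows "\<exists>\<kappa>. separating G \<kappa>"
proof -
  let ?Z = "group_center G"
  let ?X = "cent G x" and ?Y = "cent G y"
  interpret X: subgroup ?X G by (rule subgroup_cent[OF x])
  interpret Y: subgroup ?Y G by (rule subgroup_cent[OF y])
  interpret D: subgroup D G unfolding D by (rule subgroup_Int[OF subgroup_cent[OF x] subgroup_cent[OF y]])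
  have Z2: "2 \<le> card ?Z" by (rule card_center_ge_2[OF fin x y idx idy nc])
  have ncom: "x \<otimes> y \<noteq> y \<otimes> x" using nc y unfolding cent_def by blast
  have xX: "x \<in> ?X" "x \<notin> ?Y" and yY: "y \<in> ?Y" "y \<notin> ?X"
    using self_in_cent[OF x] self_in_cent[OF y] nc cent_sym[OF x y] by simp_all
  note multX = index_2_mult_iff[OF fin subgroup_cent[OF x] idx]
    and multY = index_2_mult_iff[OF fin subgroup_cent[OF y] idy]

  \<comment> \<open>Coordinates: the layer and the component of an element\<close>
  define rep where "rep v = (if v = 0 then \<one> else if v = 1 then x else if v = 2 then y else x \<otimes> y)" for v :: nat
  define el where "el v d = rep v \<otimes> d" for v d
  define lay where "lay g = (if g \<in> ?X then if g \<in> ?Y then 0 else 1 else if g \<in> ?Y then 2 else 3 :: nat)" for g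
  define comp where "comp g = inv (rep (lay g)) \<otimes> g" for g
  have DG: "d \<in> carrier G" "d \<in> ?X" "d \<in> ?Y" if "d \<in> D" for d using that D.subset D by auto
  have repG: "rep v \<in> carrier G" for v using x y by (simp add: rep_def)
  have elG: "el v d \<in> carrier G" if "d \<in> D" for v d using repG DG that by (simp add: el_def)
  have rep_mem: "rep v \<in> ?X \<longleftrightarrow> v = 0 \<or> v = 1" "rep v \<in> ?Y \<longleftrightarrow> v = 0 \<or> v = 2" for v
    using xX yY multX[OF x y] multY[OF x y] by (auto simp: rep_def)
  have lay_lt: "lay g < 4" for g by (simp add: lay_def)
  have lay_el: "lay (el v d) = v" if "v < 4" "d \<in> D" for v d
    using that multX[OF repG[of v] DG(1)[of d]] multY[OF repG[of v] DG(1)[of d]] DG[of d] rep_mem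
    by (auto simp: lay_def el_def)
  have comp_el: "comp (el v d) = d" if "v < 4" "d \<in> D" for v d
    unfolding comp_def lay_el[OF that] using that repG[of v] DG[of d] by (simp add: el_def flip: m_assoc)
  have inv_mem: "inv a \<in> ?X \<longleftrightarrow> a \<in> ?X" "inv a \<in> ?Y \<longleftrightarrow> a \<in> ?Y" if "a \<in> carrier G" for a
    using X.m_inv_closed[of a] X.m_inv_closed[of "inv a"] Y.m_inv_closed[of a] Y.m_inv_closed[of "inv a"] that
    by auto
  have comp_D: "comp g \<in> D" if g: "g \<in> carrier G" for g
    unfolding D comp_def using multX[of "inv (rep (lay g))" g] multY[of "inv (rep (lay g))" g]
      inv_mem[OF repG, of "lay g"] rep_mem[of "lay g"] repG[of "lay g"] g
    by (auto simp: lay_def)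
  have el_comp: "el (lay g) (comp g) = g" if "g \<in> carrier G" for g
    using that repG by (simp add: el_def comp_def flip: m_assoc)
  have elE: "\<exists>v d. v < 4 \<and> d \<in> D \<and> g = el v d" if "g \<in> carrier G" for g
    using el_comp[OF that] comp_D[OF that] lay_lt by metis
  have rep_comm: "rep v \<otimes> d = d \<otimes> rep v" if d: "d \<in> D" for v d
  proof -
    have "d \<otimes> x = x \<otimes> d" by (rule centD[OF DG(2)[OF d], symmetric])
    moreover have "d \<otimes> y = y \<otimes> d" by (rule centD[OF DG(3)[OF d], symmetric])
    ultimately have "d \<otimes> rep v = rep v \<otimes> d"
      using commute_mult[of d x y] x y DG(1)[OF d] unfolding rep_def by simp
    then show ?thesis by simp
  qed
  have el_mult: "el v d \<otimes> el u e = rep v \<otimes> rep u \<otimes> (d \<otimes> e)" if "d \<in> D" "e \<in> D" for v d u e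
  proof -
    have "el v d \<otimes> el u e = rep v \<otimes> (d \<otimes> rep u) \<otimes> e"
      using that repG DG by (simp add: el_def m_assoc)
    also have "\<dots> = rep v \<otimes> (rep u \<otimes> d) \<otimes> e" using rep_comm[OF that(1)] by simp
    finally show ?thesis using that repG DG by (simp add: m_assoc)
  qed
  \<comment> \<open>In these layers the representatives commute, so commutation is decided inside
    \<open>D\<close>.\<close>
  have nb1: "el u e \<in> cent G (el v d) \<longleftrightarrow> e \<in> cent G d" if "d \<in> D" "e \<in> D" "v = u \<or> v = 0 \<or> u = 0" for v d u e
  proof -
    have rep0: "rep 0 = \<one>" by (simp add: rep_def)
    have c: "rep u \<otimes> rep v = rep v \<otimes> rep u"
      using that(3) repG[of u] repG[of v] by (elim disjE) (simp_all add: rep0)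
    have "el u e \<in> cent G (el v d) \<longleftrightarrow> el v d \<otimes> el u e = el u e \<otimes> el v d"
      by (rule cent_iff[OF elG[OF that(2)]])
    also have "\<dots> \<longleftrightarrow> rep v \<otimes> rep u \<otimes> (d \<otimes> e) = rep v \<otimes> rep u \<otimes> (e \<otimes> d)"
      unfolding el_mult[OF that(1,2)] el_mult[OF that(2,1)] c ..
    also have "\<dots> \<longleftrightarrow> d \<otimes> e = e \<otimes> d" using repG DG(1) that(1,2) by simp
    also have "\<dots> \<longleftrightarrow> e \<in> cent G d" by (rule cent_iff[OF DG(1)[OF that(2)], symmetric])
    finally show ?thesis .
  qed
  have rep_ncomm: "rep v \<otimes> rep u \<noteq> rep u \<otimes> rep v" if "v < 4" "u < 4" "v \<noteq> 0" "u \<noteq> 0" "v \<noteq> u" for v u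
  proof -
    have 1: "x \<otimes> (x \<otimes> y) \<noteq> x \<otimes> y \<otimes> x" using ncom x y by (simp add: m_assoc)
    have 2: "y \<otimes> (x \<otimes> y) \<noteq> x \<otimes> y \<otimes> y" using ncom x y by (simp flip: m_assoc)
    have "v = 1 \<or> v = 2 \<or> v = 3" "u = 1 \<or> u = 2 \<or> u = 3" using that by linarith+
    then show ?thesis using that(5) ncom 1 2 by (auto simp: rep_def)
  qed
  \<comment> \<open>One component is central, so the noncommuting representatives decide. With two
    noncentral components the two commutators could cancel, and such pairs are avoided
    below.\<close>
  have nb2: "el u e \<notin> cent G (el v d)"
    if "d \<in> D" "e \<in> D" "v < 4" "u < 4" "v \<noteq> 0" "u \<noteq> 0" "v \<noteq> u" "d \<in> ?Z \<or> e \<in> ?Z" for v d u e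
  proof
    assume "el u e \<in> cent G (el v d)"
    then have "el v d \<otimes> el u e = el u e \<otimes> el v d" by (rule centD)
    then have "rep v \<otimes> rep u \<otimes> (d \<otimes> e) = rep u \<otimes> rep v \<otimes> (e \<otimes> d)"
      unfolding el_mult[OF that(1,2)] el_mult[OF that(2,1)] .
    moreover have "e \<otimes> d = d \<otimes> e" using that(8) center_comm DG(1) that(1,2) by metis
    ultimately show False using rep_ncomm[OF that(3-7)] repG DG that(1,2) by simp
  qed
  have ZD: "?Z \<subseteq> D" using center_subset_cent x y D by blast
  have ZDeq: "center_of G D = ?Z"
  proof
    show "?Z \<subseteq> center_of G D"
    proof
      fix z assume z: "z \<in> ?Z"
      then show "z \<in> center_of G D"
        using ZD DG(1) center_comm[OF z] unfolding center_of_def by blast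
    qed
    show "center_of G D \<subseteq> ?Z"
    proof
      fix d assume d: "d \<in> center_of G D"
      then have dD: "d \<in> D" by (simp add: center_of_def)
      show "d \<in> ?Z"
      proof (rule in_centerI)
        show "d \<in> carrier G" using DG dD by simp
        fix g assume "g \<in> carrier G"
        then obtain v e where ge: "e \<in> D" "g = el v e" using elE by blast
        have "e \<in> cent G d" using d ge(1) DG(1)[OF ge(1)] unfolding center_of_def cent_def by blast
        then have "el v e \<in> cent G (el 0 d)" using nb1[OF dD ge(1)] by simp
        then show "g \<in> cent G d" using ge DG dD by (simp add: el_def rep_def)
      qed
    qed
  qed
  have elZ: "el v d \<in> ?Z \<longleftrightarrow> v = 0 \<and> d \<in> ?Z" if "v < 4" "d \<in> D" for v d
  proof (cases "v = 0")
    case True then show ?thesis using DG that by (simp add: el_def rep_def)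
  next
    case False
    have "\<exists>u<4. u \<noteq> 0 \<and> u \<noteq> v" by (rule exI[of _ "if v = 1 then 2 else 1"]) auto
    then obtain u where u: "u < 4" "u \<noteq> 0" "u \<noteq> v" by blast
    have "el u \<one> \<notin> cent G (el v d)"
      using nb2[of d \<one> v u] that u False subgroup.one_closed[OF subgroup_center] by auto
    then show ?thesis using False center_subset_cent[OF elG[OF that(2)]] elG[of \<one> u]
        center_iff_cent[OF elG[OF that(2)]] by auto
  qed
  txt \<open>
    The elements are written as pairs of a layer \<open>v < 4\<close> and some \<open>d \<in> D\<close>. The colors \<open>\<kappa>D\<close> separate
    different components in \<open>D\<close>, their complement in a layer \<open>v \<noteq> 0\<close> separates it from layer 0, and the
    cyclic orientation \<open>arr\<close> of the other layers makes the two orientations towards a third layer differ.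
  \<close>
  define arr where "arr v u \<longleftrightarrow> v = 1 \<and> u = 2 \<or> v = 2 \<and> u = 3 \<or> v = 3 \<and> u = (1 :: nat)" for v u :: nat
  \<comment> \<open>Between different nonzero layers, an edge with exactly one central component is
    colored by \<open>arr\<close>, read from the layer of its noncentral end to that of its central
    end. For two central components the color tests equality, so that choosing the component yields
    either color. Two noncentral components may commute or not; they get a default color.\<close>
  define kk where "kk v d u e \<longleftrightarrow>
     (if v = 0 \<or> u = 0 then \<kappa>D d e else if v = u then \<not> \<kappa>D d e
      else if d \<in> ?Z \<and> e \<in> ?Z then d = e else if e \<in> ?Z then arr v u else if d \<in> ?Z then arr u v
      else False)" for v u :: nat and d e
  define \<kappa> where "\<kappa> g h = kk (lay g) (comp g) (lay h) (comp h)" for g h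
  have sep: "el u e \<in> separators G \<kappa> (el v d) (el v' d')"
    if "u < 4" "e \<in> D" "v < 4" "d \<in> D" "v' < 4" "d' \<in> D"
      "el u e \<notin> cent G (el v d)" "el u e \<notin> cent G (el v' d')" "kk v d u e \<noteq> kk v' d' u e" for u e v d v' d'
    using that elG by (simp add: separators_def \<kappa>_def lay_el comp_el)
  have sepW: "el u q \<in> separators G \<kappa> (el v d) (el v' d')"
    if "q \<in> ?Z" "u < 4" "v < 4" "v' < 4" "u \<noteq> 0" "v \<noteq> 0" "v' \<noteq> 0" "u \<noteq> v" "u \<noteq> v'" "d \<in> D" "d' \<in> D"
      "kk v d u q \<noteq> kk v' d' u q" for u q v d v' d'
  proof (rule sep[OF that(2) _ that(3,10,4,11) _ _ that(12)])
    show q: "q \<in> D" using that ZD by blast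
    show "el u q \<notin> cent G (el v d)" by (rule nb2[OF that(10) q that(3,2,6,5)]) (use that in auto)
    show "el u q \<notin> cent G (el v' d')" by (rule nb2[OF that(11) q that(4,2,7,5)]) (use that in auto)
  qed
  have el_ne: "el v d \<noteq> el u e" if "v < 4" "u < 4" "d \<in> D" "e \<in> D" "v \<noteq> u \<or> d \<noteq> e" for v d u e
    using that lay_el comp_el by metis
  have other: "\<exists>e. e \<in> ?Z \<and> e \<noteq> z" for z
    using Z2 card_ge_2_obtain[of ?Z] by metis
  have twoD: "\<exists>e e'. e \<in> D \<and> e' \<in> D \<and> e \<noteq> e' \<and> e \<notin> cent G d \<and> e' \<notin> cent G d"
    if d: "d \<in> D" "d \<notin> ?Z" for d
  proof -
    have "d \<notin> center_of G D" using d ZDeq by simp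
    then have "\<exists>e \<in> D. d \<otimes> e \<noteq> e \<otimes> d" using d(1) unfolding center_of_def by blast
    then obtain e where e: "e \<in> D" "e \<notin> cent G d" unfolding cent_def by blast
    have "d \<in> cent G d" using DG d self_in_cent by blast
    have "e \<otimes> d \<notin> cent G d"
    proof
      assume "e \<otimes> d \<in> cent G d"
      then have "e \<otimes> d \<otimes> inv d \<in> cent G d"
        using \<open>d \<in> cent G d\<close> subgroup_cent[of d] DG d by (simp add: subgroup.m_closed subgroup.m_inv_closed)
      then show False using e DG d by (simp add: m_assoc)
    qed
    moreover have "e \<otimes> d \<noteq> e" using e d DG subgroup.one_closed[OF subgroup_center] by auto
    ultimately show ?thesis using e d by blast
  qed
  have third: "\<exists>u. u < 4 \<and> u \<noteq> 0 \<and> u \<noteq> v \<and> u \<noteq> v' \<and> arr v u \<noteq> arr v' u \<and> arr u v \<noteq> arr u v'"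
    if "v < 4" "v' < 4" "v \<noteq> 0" "v' \<noteq> 0" "v \<noteq> v'" for v v' :: nat
  proof -
    have "v = 1 \<or> v = 2 \<or> v = 3" "v' = 1 \<or> v' = 2 \<or> v' = 3" using that by linarith+
    \<comment> \<open>The nonzero layers add up to 6, and in the cycle exactly one of
      \<open>v\<close> and \<open>v'\<close> points to the remaining layer.\<close>
    then show ?thesis using that(5)
      by (intro exI[of _ "6 - v - v'"]) (auto simp: arr_def)
  qed
  have two: "\<exists>u1 u2. u1 < 4 \<and> u2 < 4 \<and> u1 \<noteq> 0 \<and> u2 \<noteq> 0 \<and> u1 \<noteq> v \<and> u2 \<noteq> v \<and> u1 \<noteq> u2 \<and>
      arr v u1 \<and> \<not> arr v u2 \<and> \<not> arr u1 v \<and> arr u2 v" if "v < 4" "v \<noteq> 0" for v :: nat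
  proof -
    have "v = 1 \<or> v = 2 \<or> v = 3" using that by linarith
    then consider "v = 1" | "v = 2" | "v = 3" by blast
    then show ?thesis
    proof cases
      case 1
      show ?thesis by (rule exI[of _ 2], rule exI[of _ 3]) (simp add: arr_def 1)
    next
      case 2
      show ?thesis by (rule exI[of _ 3], rule exI[of _ 1]) (simp add: arr_def 2)
    next
      case 3
      show ?thesis by (rule exI[of _ 1], rule exI[of _ 2]) (simp add: arr_def 3)
    qed
  qed
  have \<kappa>D_sym: "\<kappa>D a b = \<kappa>D b a" for a b by (rule separatingD(1)[OF sepD])
  have arr_anti: "arr u v \<longleftrightarrow> \<not> arr v u" if "v < 4" "u < 4" "v \<noteq> 0" "u \<noteq> 0" "v \<noteq> u" for u v
  proof -
    have "v = 1 \<or> v = 2 \<or> v = 3" "u = 1 \<or> u = 2 \<or> u = 3" using that by linarith+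
    then show ?thesis using that(5) by (auto simp: arr_def)
  qed
  have kk_sym: "kk v d u e = kk u e v d" if "v < 4" "u < 4" for v u d e
    using \<kappa>D_sym[of d e] by (auto simp: kk_def)
  define need where "need g h = (if h \<in> cent G g then 2 else 1 :: nat)" for g h
  have need2: "need g h \<le> 2" for g h by (simp add: need_def)

  \<comment> \<open>Pairs in which at least one component is central\<close>
  have sepZ: "need (el v d) (el v' d') \<le> card (separators G \<kappa> (el v d) (el v' d'))"
    if a: "v < 4" "v' < 4" "d \<in> D" "d' \<in> D" "el v d \<noteq> el v' d'" and dZ: "d \<in> ?Z" "v \<noteq> 0"
      and v': "d' \<in> ?Z \<Longrightarrow> v' \<noteq> 0" for v d v' d'
  proof -
    note I = card_separators_ge_2I[OF fin]
    have one: "1 \<le> card (separators G \<kappa> (el v d) (el v' d'))" if "w \<in> separators G \<kappa> (el v d) (el v' d')" for w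
      using that finite_separators[OF fin, of \<kappa> "el v d" "el v' d'"] by (auto simp: Suc_le_eq card_gt_0_iff)
    obtain z where z: "z \<in> ?Z" "z \<noteq> d" using other by blast
    have zD: "z \<in> D" using z ZD by blast
    show ?thesis
    proof (cases "d' \<in> ?Z")
      case False
      consider "v' \<noteq> 0" "v' \<noteq> v" | "v' = v" | "v' = 0" by blast
      then show ?thesis
      proof cases
        case 1
        obtain u where u: "u < 4" "u \<noteq> 0" "u \<noteq> v" "u \<noteq> v'" using third[of v v'] a dZ 1 by metis
        \<comment> \<open>Towards \<open>el u q\<close>, one color is the truth value of
          \<open>d = q\<close> and the other is the fixed \<open>arr v' u\<close>; \<open>q\<close>
          is chosen to make them differ.\<close>
        define q where "q = (if arr v' u then z else d)"
        have q: "q \<in> ?Z" "q \<in> D" using z zD dZ a by (auto simp: q_def)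
        have "kk v d u q \<noteq> kk v' d' u q" using u 1 dZ False q z by (auto simp: kk_def q_def)
        then have "el u q \<in> separators G \<kappa> (el v d) (el v' d')"
          using u 1 dZ q a by (intro sep nb2) auto
        moreover have "need (el v d) (el v' d') = 1"
          using nb2[of d d' v v'] a dZ 1 by (simp add: need_def)
        ultimately show ?thesis using one by simp
      next
        case 2
        obtain u1 u2 where u: "u1 < 4" "u2 < 4" "u1 \<noteq> 0" "u2 \<noteq> 0" "u1 \<noteq> v" "u2 \<noteq> v" "u1 \<noteq> u2"
          "arr v u1" "\<not> arr v u2" using two[OF a(1) dZ(2)] by blast
        \<comment> \<open>Towards central components in \<open>u1\<close> and \<open>u2\<close>, the
          noncentral element has both colors by \<open>arr\<close>; each time the component is
          chosen so that the central element has the opposite one.\<close>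
        have "kk v d u1 z \<noteq> kk v' d' u1 z" "kk v d u2 d \<noteq> kk v' d' u2 d"
          using u 2 dZ False z by (auto simp: kk_def)
        then have "el u1 z \<in> separators G \<kappa> (el v d) (el v' d')" "el u2 d \<in> separators G \<kappa> (el v d) (el v' d')"
          using u 2 dZ z zD a by (simp_all add: sepW)
        moreover have "el u1 z \<noteq> el u2 d" using u zD a by (intro el_ne) auto
        ultimately have "2 \<le> card (separators G \<kappa> (el v d) (el v' d'))" by (rule I)
        then show ?thesis using need2 le_trans by blast
      next
        case 3
        obtain u1 u2 where u: "u1 < 4" "u2 < 4" "u1 \<noteq> 0" "u2 \<noteq> 0" "u1 \<noteq> v" "u2 \<noteq> v" "u1 \<noteq> u2"
          "\<not> arr u1 v" "arr u2 v" using two[OF a(1) dZ(2)] by blast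
        have ex: "\<exists>u. u < 4 \<and> el u e \<in> separators G \<kappa> (el v d) (el v' d')"
          if e: "e \<in> D" "e \<notin> cent G d'" for e
        proof -
          \<comment> \<open>The color from layer 0 is dictated by \<open>\<kappa>D d' e\<close>. The
            free choice is the layer of \<open>e\<close>, since \<open>arr u v\<close> takes both
            values on the other two layers.\<close>
          define u where "u = (if \<kappa>D d' e then u1 else u2)"
          have u': "u < 4" "u \<noteq> 0" "u \<noteq> v" "arr u v \<longleftrightarrow> \<not> \<kappa>D d' e" using u by (auto simp: u_def)
          have eZ: "e \<notin> ?Z" using e center_subset_cent DG[OF a(4)] DG[OF e(1)] cent_sym center_iff_cent by metis
          have "kk v d u e \<noteq> kk v' d' u e" using u' 3 dZ eZ by (auto simp: kk_def)
          then have "el u e \<in> separators G \<kappa> (el v d) (el v' d')"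
          proof (intro sep)
            show "el u e \<notin> cent G (el v d)"
              by (rule nb2[OF a(3) e(1) a(1) u'(1) dZ(2) u'(2)]) (use u' dZ in auto)
            show "el u e \<notin> cent G (el v' d')" using nb1[OF a(4) e(1), of v' u] 3 e by simp
          qed (use u' e a in auto)
          then show ?thesis using u' by blast
        qed
        obtain e e' where e: "e \<in> D" "e' \<in> D" "e \<noteq> e'" "e \<notin> cent G d'" "e' \<notin> cent G d'"
          using twoD[OF a(4) False] by blast
        obtain u where "u < 4" "el u e \<in> separators G \<kappa> (el v d) (el v' d')" using ex[OF e(1,4)] by blast
        moreover obtain u' where "u' < 4" "el u' e' \<in> separators G \<kappa> (el v d) (el v' d')" using ex[OF e(2,5)] by blast
        moreover have "el u e \<noteq> el u' e'" using calculation e by (intro el_ne) auto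
        ultimately have "2 \<le> card (separators G \<kappa> (el v d) (el v' d'))" using I by blast
        then show ?thesis using need2 le_trans by blast
      qed
    next
      case True
      then have v'0: "v' \<noteq> 0" using v' by blast
      show ?thesis
      proof (cases "v = v'")
        case False
        obtain u where u: "u < 4" "u \<noteq> 0" "u \<noteq> v" "u \<noteq> v'" "arr u v \<noteq> arr u v'"
          using third[of v v'] a dZ v'0 False by metis
        obtain e where e: "e \<in> D" "e \<notin> ?Z"
          using Dnc ZDeq by (auto simp: commutative_def center_of_def)
        have "kk v d u e \<noteq> kk v' d' u e" using u v'0 dZ True e by (auto simp: kk_def)
        then have "el u e \<in> separators G \<kappa> (el v d) (el v' d')"
          using u v'0 dZ True e a by (intro sep nb2) auto
        moreover have "need (el v d) (el v' d') = 1"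
          using nb2[of d d' v v'] a dZ v'0 False by (simp add: need_def)
        ultimately show ?thesis using one by simp
      next
        case vv: True
        have dd: "d \<noteq> d'" using a(5) vv by auto
        obtain u1 u2 where u: "u1 < 4" "u2 < 4" "u1 \<noteq> 0" "u2 \<noteq> 0" "u1 \<noteq> v" "u2 \<noteq> v" "u1 \<noteq> u2"
          using two[OF a(1) dZ(2)] by blast
        have "kk v d u1 d \<noteq> kk v' d' u1 d" "kk v d u2 d \<noteq> kk v' d' u2 d"
          using u vv dZ True dd by (auto simp: kk_def)
        then have "el u1 d \<in> separators G \<kappa> (el v d) (el v' d')" "el u2 d \<in> separators G \<kappa> (el v d) (el v' d')"
          using u vv dZ True a by (simp_all add: sepW)
        moreover have "el u1 d \<noteq> el u2 d" using u a by (intro el_ne) auto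
        ultimately have "2 \<le> card (separators G \<kappa> (el v d) (el v' d'))" by (rule I)
        then show ?thesis using need2 le_trans by blast
      qed
    qed
  qed

  \<comment> \<open>Pairs of noncentral components\<close>
  have sepN: "need (el v d) (el v' d') \<le> card (separators G \<kappa> (el v d) (el v' d'))"
    if a: "v < 4" "v' < 4" "d \<in> D" "d' \<in> D" "el v d \<noteq> el v' d'" and dZ: "d \<notin> ?Z" "d' \<notin> ?Z"
      and v': "v' = 0 \<Longrightarrow> v = 0" for v d v' d'
  proof -
    note I = card_separators_ge_2I[OF fin]
    show ?thesis
    proof (cases "v \<noteq> 0 \<and> v \<noteq> v'")
      case True
      then have v'0: "v' \<noteq> 0" using v' by blast
      obtain u where u: "u < 4" "u \<noteq> 0" "u \<noteq> v" "u \<noteq> v'" "arr v u \<noteq> arr v' u"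
        using third[of v v'] a True v'0 by metis
      \<comment> \<open>Towards a central component the color depends on the layers only, so any two
        central elements provide two separators in the third layer.\<close>
      obtain z z' where z: "z \<in> ?Z" "z' \<in> ?Z" "z \<noteq> z'" using Z2 by (rule card_ge_2_obtain)
      then have zD: "z \<in> D" "z' \<in> D" using ZD by auto
      have "kk v d u q \<noteq> kk v' d' u q" if "q \<in> ?Z" for q using that u True v'0 dZ by (auto simp: kk_def)
      then have "el u z \<in> separators G \<kappa> (el v d) (el v' d')" "el u z' \<in> separators G \<kappa> (el v d) (el v' d')"
        using u True v'0 z zD a by (simp_all add: sepW)
      moreover have "el u z \<noteq> el u z'" using u z zD by (intro el_ne) auto
      ultimately have "2 \<le> card (separators G \<kappa> (el v d) (el v' d'))" by (rule I)
      then show ?thesis using need2 le_trans by blast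
    next
      case False
      then have vv: "v = 0 \<or> v = v'" by blast
      show ?thesis
      proof (cases "d = d'")
        case dd: True
        then have "v \<noteq> v'" using a(5) by blast
        then have v0: "v = 0" "v' \<noteq> 0" using vv by auto
        obtain e e' where e: "e \<in> D" "e' \<in> D" "e \<noteq> e'" "e \<notin> cent G d" "e' \<notin> cent G d"
          using twoD[OF a(3) dZ(1)] by blast
        have "el v' q \<in> separators G \<kappa> (el v d) (el v' d')" if "q \<in> D" "q \<notin> cent G d" for q
          using v0 dd a that nb1[of d q v v'] nb1[of d q v' v'] by (intro sep) (auto simp: kk_def)
        then have "el v' e \<in> separators G \<kappa> (el v d) (el v' d')" "el v' e' \<in> separators G \<kappa> (el v d) (el v' d')"
          using e by blast+
        moreover have "el v' e \<noteq> el v' e'" using e a by (intro el_ne) auto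
        ultimately have "2 \<le> card (separators G \<kappa> (el v d) (el v' d'))" by (rule I)
        then show ?thesis using need2 le_trans by blast
      next
        case dd: False
        let ?S = "separators (G\<lparr>carrier := D\<rparr>) \<kappa>D d d'"
        have SD: "q \<in> D" "q \<notin> cent G d" "q \<notin> cent G d'" "\<kappa>D d q \<noteq> \<kappa>D d' q" if "q \<in> ?S" for q
          using that D.subset by (auto simp: separators_def)
        have "el 0 q \<in> separators G \<kappa> (el v d) (el v' d')" if "q \<in> ?S" for q
          using SD[OF that] a nb1[of d q v 0] nb1[of d' q v' 0] by (intro sep) (auto simp: kk_def)
        then have "el 0 ` ?S \<subseteq> separators G \<kappa> (el v d) (el v' d')" by blast
        moreover have "inj_on (el 0) ?S"
        proof (rule inj_onI)
          fix p q assume "p \<in> ?S" "q \<in> ?S" "el 0 p = el 0 q"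
          then show "p = q" using el_ne[of 0 0 p q] SD(1) by auto
        qed
        ultimately have le: "card ?S \<le> card (separators G \<kappa> (el v d) (el v' d'))"
          using finite_separators[OF fin] by (metis card_image card_mono)
        have mem: "d \<in> carrier (G\<lparr>carrier := D\<rparr>) - group_center (G\<lparr>carrier := D\<rparr>)"
          "d' \<in> carrier (G\<lparr>carrier := D\<rparr>) - group_center (G\<lparr>carrier := D\<rparr>)"
          using a dZ ZDeq by simp_all
        have com: "el v' d' \<in> cent G (el v d) \<longleftrightarrow> d' \<in> cent G d" using nb1[of d d' v v'] a vv by auto
        have finS: "finite ?S" using finite_subset[OF D.subset fin] by (simp add: separators_def)
        show ?thesis
        proof (cases "d' \<in> cent G d")
          case True
          then have "2 \<le> card ?S" using separatingD(2)[OF sepD mem dd] a D.subset by simp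
          then show ?thesis using le need2 le_trans by blast
        next
          case False
          then have "?S \<noteq> {}" using separatingD(3)[OF sepD mem dd] D.subset by simp
          then have "1 \<le> card ?S" using finS by (simp add: Suc_le_eq card_gt_0_iff)
          then show ?thesis using le com False by (simp add: need_def)
        qed
      qed
    qed
  qed
  have "separating G \<kappa>"
  proof (rule separatingI_wlog[where P = "\<lambda>g. comp g \<in> ?Z \<or> comp g \<notin> ?Z \<and> lay g = 0"])
    show "\<kappa> a b = \<kappa> b a" for a b using kk_sym lay_lt by (simp add: \<kappa>_def)
    fix g h assume g: "g \<in> carrier G - ?Z" and h: "h \<in> carrier G - ?Z" and ne: "g \<noteq> h"
      and P: "(comp g \<in> ?Z \<or> comp g \<notin> ?Z \<and> lay g = 0) \<or> \<not> (comp h \<in> ?Z \<or> comp h \<notin> ?Z \<and> lay h = 0)"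
    obtain v d where vd: "v < 4" "d \<in> D" "g = el v d" using elE g by blast
    obtain v' d' where vd': "v' < 4" "d' \<in> D" "h = el v' d'" using elE h by blast
    have Zs: "d \<in> ?Z \<Longrightarrow> v \<noteq> 0" "d' \<in> ?Z \<Longrightarrow> v' \<noteq> 0"
      using g h elZ[OF vd(1,2)] elZ[OF vd'(1,2)] vd(3) vd'(3) by auto
    have "need g h \<le> card (separators G \<kappa> g h)"
    proof (cases "d \<in> ?Z")
      case True
      then show ?thesis unfolding vd(3) vd'(3)
        using ne vd vd' Zs by (intro sepZ) auto
    next
      case dN: False
      have gh: "h \<in> cent G g \<longleftrightarrow> g \<in> cent G h" using g h cent_sym[of g G h] by simp
      show ?thesis
      proof (cases "d' \<in> ?Z")
        case True
        then have "need h g \<le> card (separators G \<kappa> h g)" unfolding vd(3) vd'(3)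
          using ne vd vd' Zs by (intro sepZ) auto
        then show ?thesis using gh separators_commute[of \<kappa> g h] by (simp add: need_def)
      next
        case False
        show ?thesis
        proof (cases "v' = 0 \<and> v \<noteq> 0")
          case True
          then have "need h g \<le> card (separators G \<kappa> h g)" unfolding vd(3) vd'(3)
            using ne vd vd' False dN by (intro sepN) auto
          then show ?thesis using gh separators_commute[of \<kappa> g h] by (simp add: need_def)
        next
          case c: False
          show ?thesis unfolding vd(3) vd'(3)
            using ne vd vd' False dN c by (intro sepN) auto
        qed
      qed
    qed
    then show "(if h \<in> cent G g then 2 else 1) \<le> card (separators G \<kappa> g h)" by (simp add: need_def)
  qed
  then show ?thesis by blast
qed

end

section \<open>Groups without centralizers of index 2\<close>

definition commuting_risk :: "nat \<Rightarrow> real" where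
  "commuting_risk m = (real m + 1) / 2 ^ m"

lemma commuting_risk_Suc: "commuting_risk (Suc m) \<le> commuting_risk m"
  by (simp add: commuting_risk_def field_simps)

lemma commuting_risk_antimono: "m \<le> m' \<Longrightarrow> commuting_risk m' \<le> commuting_risk m"
  using decseqD[OF decseq_SucI[of commuting_risk]] commuting_risk_Suc by blast

lemma commuting_risk_nonneg: "0 \<le> commuting_risk m"
  by (simp add: commuting_risk_def)

lemma inverse_power_le_commuting_risk: "1 / 2 ^ m \<le> commuting_risk m"
  by (simp add: commuting_risk_def divide_right_mono)

context group
begin

lemma risk_commute: "x \<in> carrier G \<Longrightarrow> y \<in> carrier G \<Longrightarrow> risk G x y = risk G y x"
  using cent_sym[of x G y] by (simp add: risk_def common_nbrs_def Un_commute)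

lemma risk_le_commuting_risk: "m \<le> card (common_nbrs G x y) \<Longrightarrow> risk G x y \<le> commuting_risk m"
  using commuting_risk_antimono[of m "card (common_nbrs G x y)"] inverse_power_le_commuting_risk[of "card (common_nbrs G x y)"]
  by (auto simp: risk_def commuting_risk_def)

lemma risk_le_adjacent: "y \<notin> cent G x \<Longrightarrow> m \<le> card (common_nbrs G x y) \<Longrightarrow> risk G x y \<le> 1 / 2 ^ m"
  by (simp add: risk_def frac_le)

lemma sum_risk_le:
  assumes S: "finite S"
    and com: "\<And>y. y \<in> S \<Longrightarrow> y \<in> cent G x \<Longrightarrow> a \<le> card (common_nbrs G x y)"
    and adj: "\<And>y. y \<in> S \<Longrightarrow> y \<notin> cent G x \<Longrightarrow> b \<le> card (common_nbrs G x y)"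
  shows "(\<Sum>y \<in> S. risk G x y) \<le> card (S \<inter> cent G x) * commuting_risk a + card (S - cent G x) / 2 ^ b"
proof -
  have "(\<Sum>y \<in> S. risk G x y) = (\<Sum>y \<in> S \<inter> cent G x. risk G x y) + (\<Sum>y \<in> S - cent G x. risk G x y)"
    using S by (rule sum.Int_Diff)
  moreover have "(\<Sum>y \<in> S \<inter> cent G x. risk G x y) \<le> card (S \<inter> cent G x) * commuting_risk a"
    using com by (intro sum_bounded_above risk_le_commuting_risk) auto
  moreover have "(\<Sum>y \<in> S - cent G x. risk G x y) \<le> card (S - cent G x) * (1 / 2 ^ b)"
    using adj by (intro sum_bounded_above risk_le_adjacent) auto
  ultimately show ?thesis by simp
qed

lemma finite_cent: "finite (carrier G) \<Longrightarrow> finite (cent G x)"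
  by (simp add: cent_def)

lemma finite_center: "finite (carrier G) \<Longrightarrow> finite (group_center G)"
  by (simp add: group_center_def)

lemma card_noncentral: "finite (carrier G) \<Longrightarrow>
    card (carrier G - group_center G) = card (carrier G) - card (group_center G)"
  using finite_center subgroup.subset[OF subgroup_center] by (simp add: card_Diff_subset)

lemma card_cent_noncentral:
  assumes fin: "finite (carrier G)" and x: "x \<in> carrier G - group_center G"
  shows "card ((carrier G - group_center G - {x}) \<inter> cent G x) = card (cent G x) - card (group_center G) - 1"
    and "card (carrier G - group_center G - {x} - cent G x) = card (carrier G) - card (cent G x)"
proof -
  have xx: "x \<in> cent G x" "cent G x \<subseteq> carrier G" "group_center G \<subseteq> cent G x"
    using x self_in_cent center_subset_cent by (auto simp: cent_def)
  have "(carrier G - group_center G - {x}) \<inter> cent G x = cent G x - group_center G - {x}"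
    using xx by blast
  then show "card ((carrier G - group_center G - {x}) \<inter> cent G x) = card (cent G x) - card (group_center G) - 1"
    using xx x fin finite_center finite_cent by (simp add: card_Diff_subset)
  have "carrier G - group_center G - {x} - cent G x = carrier G - cent G x" using xx by blast
  then show "card (carrier G - group_center G - {x} - cent G x) = card (carrier G) - card (cent G x)"
    using xx fin finite_cent by (simp add: card_Diff_subset)
qed

lemma row_risk_le:
  assumes fin: "finite (carrier G)" and x: "x \<in> carrier G - group_center G"
    and com: "\<And>y. y \<in> carrier G - group_center G \<Longrightarrow> y \<noteq> x \<Longrightarrow> y \<in> cent G x \<Longrightarrow> a \<le> card (common_nbrs G x y)"
    and adj: "\<And>y. y \<in> carrier G - group_center G \<Longrightarrow> y \<notin> cent G x \<Longrightarrow> b \<le> card (common_nbrs G x y)"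
  shows "(\<Sum>y \<in> carrier G - group_center G - {x}. risk G x y)
     \<le> real (card (cent G x) - card (group_center G) - 1) * commuting_risk a + real (card (carrier G) - card (cent G x)) / 2 ^ b"
  using sum_risk_le[of "carrier G - group_center G - {x}" x a b] com adj fin
  unfolding card_cent_noncentral[OF fin x] by simp

text \<open>The identity is central, so there are at most \<open>card (carrier G) - 1\<close>
  rows.\<close>

lemma separating_by_rows:
  assumes fin: "finite (carrier G)" and nc: "\<not> commutative G (carrier G)"
    and row: "\<And>x. x \<in> carrier G - group_center G \<Longrightarrow>
      real (card (carrier G) - 1) * (\<Sum>y \<in> carrier G - group_center G - {x}. risk G x y) < 2"
  shows "\<exists>\<kappa>. separating G \<kappa>"
proof (rule exists_separating[OF fin])
  let ?V = "carrier G - group_center G"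
  obtain v where v: "v \<in> ?V" using nc by (auto simp: commutative_def group_center_def)
  have finV: "finite ?V" using fin by simp
  have cV: "0 < card ?V" using v finV by (auto simp: card_gt_0_iff)
  have "0 < card (group_center G)" using subgroup.finite_imp_card_positive[OF subgroup_center fin] .
  then have le: "card ?V \<le> card (carrier G) - 1" using card_noncentral[OF fin] by linarith
  have pos: "0 < card (carrier G) - 1" using le cV by linarith
  have "(\<Sum>x \<in> ?V. \<Sum>y \<in> ?V - {x}. risk G x y) < of_nat (card ?V) * (2 / real (card (carrier G) - 1))"
    by (rule sum_bounded_above_strict[OF _ cV]) (use row pos in \<open>simp add: field_simps\<close>)
  also have "\<dots> \<le> 2" using le pos by (simp add: field_simps)
  finally show "(\<Sum>x \<in> ?V. \<Sum>y \<in> ?V - {x}. risk G x y) < 2" .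
qed

lemma card_cent_ge:
  assumes fin: "finite (carrier G)" and x: "x \<in> carrier G - group_center G"
  shows "card (group_center G) < card (cent G x)" "2 \<le> card (cent G x)"
    "card (group_center G) dvd card (cent G x)" "card (cent G x) dvd card (carrier G)"
    "0 < card (group_center G)"
proof -
  have sub: "group_center G \<subset> cent G x" using x self_in_cent[of x] center_subset_cent[of x] by auto
  show 1: "card (group_center G) < card (cent G x)" using psubset_card_mono[OF finite_cent[OF fin] sub] .
  show 2: "0 < card (group_center G)" using subgroup.finite_imp_card_positive[OF subgroup_center fin] .
  then show "2 \<le> card (cent G x)" using 1 by linarith
  show "card (group_center G) dvd card (cent G x)"
    using card_subgroup_dvd[OF subgroup_center subgroup_cent] x sub by blast
  have "cent G x \<subseteq> carrier G" by (auto simp: cent_def)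
  then show "card (cent G x) dvd card (carrier G)"
    using card_subgroup_dvd[OF subgroup_cent subgroup_self] x by blast
qed

text \<open>A noncommutative centralizer has at least four times the order of its center by
  \<open>noncommutative_card\<close>, and that center contains \<open>\<one>\<close> and
  \<open>x\<close>.\<close>

lemma commutative_cent:
  assumes fin: "finite (carrier G)" and x: "x \<in> carrier G - group_center G" and small: "card (cent G x) < 8"
  shows "commutative G (cent G x)"
proof (rule ccontr)
  assume "\<not> ?thesis"
  then obtain p q where pq: "2 \<le> p" "2 \<le> q" "card (cent G x) = card (center_of G (cent G x)) * p * q"
    using noncommutative_card[OF fin subgroup_cent] x by blast
  have C: "subgroup (center_of G (cent G x)) G" using subgroup_center_of subgroup_cent x by blast
  have "x \<in> center_of G (cent G x)" using x by (auto simp: center_of_def cent_def)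
  moreover have "\<one> \<in> center_of G (cent G x)" using C by (rule subgroup.one_closed)
  moreover have "x \<noteq> \<one>" using x subgroup.one_closed[OF subgroup_center] by auto
  moreover have "finite (center_of G (cent G x))" using finite_cent[OF fin] center_of_subset finite_subset by metis
  ultimately have "card {\<one>, x} \<le> card (center_of G (cent G x))" by (intro card_mono) auto
  then have "2 \<le> card (center_of G (cent G x))" using \<open>x \<noteq> \<one>\<close> by simp
  then have "2 * 2 * 2 \<le> card (center_of G (cent G x)) * p * q" using pq(1,2) by (intro mult_le_mono) auto
  then show False using pq(3) small by linarith
qed

text \<open>Commutative centralizers of noncentral elements meet only in the center. A commuting
  pair then has everything outside its shared centralizer as common neighbors, more than the general
  bound gives; the small orders depend on this.\<close>

lemma cent_eq_if_commutative:
  assumes "x \<in> carrier G" "y \<in> cent G x" "commutative G (cent G x)" "commutative G (cent G y)"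
  shows "cent G y = cent G x"
proof -
  have y: "y \<in> carrier G" "x \<in> cent G y" using assms cent_sym[of x G y] by (auto simp: cent_def)
  have "cent G x \<subseteq> cent G y" using assms(2,3) unfolding commutative_def cent_def by blast
  moreover have "cent G y \<subseteq> cent G x" using y(2) assms(4) unfolding commutative_def cent_def by blast
  ultimately show ?thesis by blast
qed

lemma card_common_nbrs_same_cent:
  assumes fin: "finite (carrier G)" and x: "x \<in> carrier G" and eq: "cent G y = cent G x"
  shows "card (common_nbrs G x y) = card (carrier G) - card (cent G x)"
proof -
  have "cent G x \<subseteq> carrier G" by (auto simp: cent_def)
  then show ?thesis using eq finite_cent[OF fin] by (simp add: common_nbrs_def card_Diff_subset)
qed

lemma index_3_common_nbrs:
  assumes fin: "finite (carrier G)" and x: "x \<in> carrier G" and y: "y \<in> carrier G"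
    and "3 * card (cent G x) \<le> card (carrier G)" "3 * card (cent G y) \<le> card (carrier G)"
  shows "4 * card (carrier G) \<le> 9 * card (common_nbrs G x y)"
  using card_common_nbrs_ge[OF assms] by simp

text \<open>With \<open>4 * n \<le> 9 * m\<close>, this yields the requirement
  \<open>n^2 * (m + 3) / (3 * 2^m) < 2\<close> on the rows. It fails at
  \<open>m = 10\<close>.\<close>

lemma power_bound_11: "11 \<le> m \<Longrightarrow> 27 * m ^ 2 * (m + 3) < 32 * 2 ^ m" for m :: nat
proof (induction m rule: nat_induct_at_least)
  case base show ?case by simp
next
  case (Suc m)
  have "11 * m \<le> m * m" "11 * (m * m) \<le> m * (m * m)" using Suc.hyps by simp_all
  then have "9 * m + 4 \<le> m * (m * m)" using Suc.hyps by linarith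
  moreover have "Suc m ^ 2 * (Suc m + 3) = m * (m * m) + 6 * (m * m) + (9 * m + 4)"
    "2 * (m ^ 2 * (m + 3)) = 2 * (m * (m * m)) + 6 * (m * m)"
    by (simp_all add: power2_eq_square algebra_simps)
  ultimately have "Suc m ^ 2 * (Suc m + 3) \<le> 2 * (m ^ 2 * (m + 3))" by linarith
  then show ?case using Suc.IH by simp
qed

text \<open>\<open>m\<close> is \<open>4 * n / 9\<close> rounded up, at least 11 here. Below 24,
  centralizers of index at least 3 have fewer than 8 elements, so they are commutative and a sharper
  estimate takes over.\<close>

lemma separating_index_3_large:
  assumes fin: "finite (carrier G)" and nc: "\<not> commutative G (carrier G)"
    and idx: "\<And>x. x \<in> carrier G - group_center G \<Longrightarrow> 3 * card (cent G x) \<le> card (carrier G)"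
    and n: "24 \<le> card (carrier G)"
  shows "\<exists>\<kappa>. separating G \<kappa>"
proof (rule separating_by_rows[OF fin nc])
  fix x assume x: "x \<in> carrier G - group_center G"
  let ?n = "card (carrier G)" and ?k = "card (cent G x)" and ?z = "card (group_center G)"
  define m where "m = (4 * ?n + 8) div 9"
  have m: "4 * ?n \<le> 9 * m" "11 \<le> m" using n unfolding m_def by linarith+
  have M: "m \<le> card (common_nbrs G x y)" if "y \<in> carrier G - group_center G" for y
    using index_3_common_nbrs[OF fin _ _ idx[OF x] idx[OF that]] x that unfolding m_def by simp
  have k: "3 * ?k \<le> ?n" using idx[OF x] .
  have "(\<Sum>y \<in> carrier G - group_center G - {x}. risk G x y)
      \<le> real (?k - ?z - 1) * commuting_risk m + real (?n - ?k) / 2 ^ m"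
    using row_risk_le[OF fin x, of m m] M by blast
  also have "\<dots> \<le> real ?k * commuting_risk m + real (?n - ?k) / 2 ^ m"
    by (intro add_right_mono mult_right_mono commuting_risk_nonneg) simp
  also have "\<dots> = (real ?k * real m + real ?n) / 2 ^ m"
    using k by (simp add: commuting_risk_def of_nat_diff field_simps)
  also have "\<dots> \<le> (real ?n / 3 * real m + real ?n) / 2 ^ m"
    using k by (intro divide_right_mono add_right_mono mult_right_mono) auto
  finally have row: "(\<Sum>y \<in> carrier G - group_center G - {x}. risk G x y) \<le> real ?n * (real m + 3) / (3 * 2 ^ m)"
    by (simp add: field_simps)
  have "16 * (real ?n * real ?n) \<le> 81 * (real m * real m)"
  proof -
    have "(4 * ?n) * (4 * ?n) \<le> (9 * m) * (9 * m)" by (rule mult_le_mono[OF m(1) m(1)])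
    then have "real (4 * ?n * (4 * ?n)) \<le> real (9 * m * (9 * m))" by (rule of_nat_mono)
    then show ?thesis by simp
  qed
  then have "16 * (real ?n * real ?n) * (real m + 3) \<le> 81 * (real m * real m) * (real m + 3)"
    by (intro mult_right_mono) auto
  also have "\<dots> < 96 * 2 ^ m"
  proof -
    have "real (27 * m ^ 2 * (m + 3)) < real (32 * 2 ^ m)"
      using power_bound_11[OF m(2)] by (simp only: of_nat_less_iff)
    then show ?thesis by (simp add: power2_eq_square)
  qed
  finally have key: "real ?n * (real ?n * (real m + 3) / (3 * 2 ^ m)) < 2" by (simp add: field_simps)
  have "real (?n - 1) * (\<Sum>y \<in> carrier G - group_center G - {x}. risk G x y)
      \<le> real ?n * (real ?n * (real m + 3) / (3 * 2 ^ m))"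
    using row by (intro mult_mono) (auto intro!: sum_nonneg simp: risk_def)
  then show "real (?n - 1) * (\<Sum>y \<in> carrier G - group_center G - {x}. risk G x y) < 2" using key by linarith
qed

text \<open>In \<open>k - 2\<close> the identity and \<open>x\<close> itself are discounted. The
  estimate fails for \<open>n = 12\<close> and \<open>n = 13\<close>, both at \<open>k = 4\<close>,
  whence the start at 14.\<close>

lemma small_row_numeric:
  fixes n k :: nat
  assumes "14 \<le> n" "n < 24" "2 \<le> k" "3 * k \<le> n"
  shows "real (n - 1) * (real (k - 2) * commuting_risk (n - k) + real (n - k) / 2 ^ ((4 * n + 8) div 9)) < 2"
proof -
  have n: "n \<in> {14,15,16,17,18,19,20,21,22,23}" using assms(1,2) unfolding insert_iff empty_iff by presburger
  have k: "k \<in> {2,3,4,5,6,7}" using assms by auto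
  show ?thesis using n k assms(4) by (elim insertE emptyE; simp add: commuting_risk_def)
qed

lemma separating_index_3_medium:
  assumes fin: "finite (carrier G)" and nc: "\<not> commutative G (carrier G)"
    and idx: "\<And>x. x \<in> carrier G - group_center G \<Longrightarrow> 3 * card (cent G x) \<le> card (carrier G)"
    and n: "14 \<le> card (carrier G)" "card (carrier G) < 24"
  shows "\<exists>\<kappa>. separating G \<kappa>"
proof (rule separating_by_rows[OF fin nc])
  fix x assume x: "x \<in> carrier G - group_center G"
  let ?n = "card (carrier G)" and ?k = "card (cent G x)" and ?z = "card (group_center G)"
  define m where "m = (4 * ?n + 8) div 9"
  have M: "m \<le> card (common_nbrs G x y)" if "y \<in> carrier G - group_center G" for y
    using index_3_common_nbrs[OF fin _ _ idx[OF x] idx[OF that]] x that unfolding m_def by simp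
  have C: "?n - ?k \<le> card (common_nbrs G x y)" if y: "y \<in> carrier G - group_center G" "y \<in> cent G x" for y
  proof -
    have "commutative G (cent G x)" "commutative G (cent G y)"
      using commutative_cent[OF fin x] commutative_cent[OF fin y(1)] idx[OF x] idx[OF y(1)] n by simp_all
    then have "cent G y = cent G x" using cent_eq_if_commutative x y by blast
    then show ?thesis using card_common_nbrs_same_cent[OF fin] x by simp
  qed
  have k: "3 * ?k \<le> ?n" "2 \<le> ?k" "0 < ?z" using idx[OF x] card_cent_ge[OF fin x] by simp_all
  have "(\<Sum>y \<in> carrier G - group_center G - {x}. risk G x y)
      \<le> real (?k - ?z - 1) * commuting_risk (?n - ?k) + real (?n - ?k) / 2 ^ m"
    using row_risk_le[OF fin x, of "?n - ?k" m] M C by blast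
  also have "\<dots> \<le> real (?k - 2) * commuting_risk (?n - ?k) + real (?n - ?k) / 2 ^ m"
    using k(3) by (intro add_right_mono mult_right_mono commuting_risk_nonneg) simp
  finally have "real (?n - 1) * (\<Sum>y \<in> carrier G - group_center G - {x}. risk G x y)
      \<le> real (?n - 1) * (real (?k - 2) * commuting_risk (?n - ?k) + real (?n - ?k) / 2 ^ m)"
    by (rule mult_left_mono) simp
  also have "\<dots> < 2" unfolding m_def by (rule small_row_numeric[OF n k(2,1)])
  finally show "real (?n - 1) * (\<Sum>y \<in> carrier G - group_center G - {x}. risk G x y) < 2" .
qed

text \<open>All noncentral centralizers would have order 3, and Burnside's lemma would make 9 divide \<open>9 + 8 * 3\<close>.\<close>

lemma card_ne_9:
  assumes fin: "finite (carrier G)" and nine: "card (carrier G) = 9"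
    and idx: "\<And>x. x \<in> carrier G - group_center G \<Longrightarrow> 3 * card (cent G x) \<le> card (carrier G)"
    and nc: "\<not> commutative G (carrier G)"
  shows False
proof -
  let ?Z = "group_center G"
  have k3: "card (cent G x) = 3 \<and> card ?Z = 1" if x: "x \<in> carrier G - ?Z" for x
  proof -
    have "card (cent G x) = 2 \<or> card (cent G x) = 3"
      using idx[OF x] card_cent_ge[OF fin x] nine by linarith
    then have 3: "card (cent G x) = 3" using card_cent_ge(4)[OF fin x] nine by auto
    have "card ?Z = 1 \<or> card ?Z = 2" using card_cent_ge[OF fin x] 3 by linarith
    then show ?thesis using 3 card_cent_ge(3)[OF fin x] by auto
  qed
  obtain v where "v \<in> carrier G - ?Z" using nc by (auto simp: commutative_def group_center_def)
  then have Z1: "card ?Z = 1" using k3 by blast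
  interpret A: group_action G "carrier G" "\<lambda>g. (\<lambda>h \<in> carrier G. g \<otimes> h \<otimes> inv g)"
    by (rule action_by_conjugation)
  have inv: "invariants (carrier G) (\<lambda>g. (\<lambda>h \<in> carrier G. g \<otimes> h \<otimes> inv g)) g = cent G g"
    if g: "g \<in> carrier G" for g
  proof -
    have "g \<otimes> h \<otimes> inv g = h \<longleftrightarrow> g \<otimes> h = h \<otimes> g" if "h \<in> carrier G" for h
      using g that by (metis inv_solve_right' m_closed)
    then show ?thesis by (auto simp: invariants_def cent_def)
  qed
  have "(\<Sum>g \<in> carrier G. card (cent G g)) = (\<Sum>g \<in> ?Z. card (cent G g)) + (\<Sum>g \<in> carrier G - ?Z. card (cent G g))"
    using fin subgroup.subset[OF subgroup_center] by (metis sum.subset_diff add.commute)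
  also have "(\<Sum>g \<in> ?Z. card (cent G g)) = (\<Sum>g \<in> ?Z. 9)"
    using center_iff_cent subgroup.subset[OF subgroup_center] nine by (intro sum.cong) auto
  also have "(\<Sum>g \<in> carrier G - ?Z. card (cent G g)) = (\<Sum>g \<in> carrier G - ?Z. 3)"
    using k3 by (intro sum.cong) auto
  finally have "(\<Sum>g \<in> carrier G. card (cent G g)) = 33"
    using Z1 card_noncentral[OF fin] nine by simp
  moreover have "card (orbits G (carrier G) (\<lambda>g. (\<lambda>h \<in> carrier G. g \<otimes> h \<otimes> inv g))) * order G
      = (\<Sum>g \<in> carrier G. card (cent G g))"
    using A.burnside[OF fin fin] inv by simp
  ultimately have "card (orbits G (carrier G) (\<lambda>g. (\<lambda>h \<in> carrier G. g \<otimes> h \<otimes> inv g))) * 9 = 33"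
    using nine by (simp add: order_def)
  then show False by presburger
qed

text \<open>Here 11 times the worst row bound exceeds 2, so the rows are told apart. If the center
  is nontrivial, it has order 2 and only 10 rows remain. If it is trivial, at most three elements
  have a centralizer of order 4, and any two others have seven common neighbors instead of
  six.\<close>

lemma separating_card_12:
  assumes fin: "finite (carrier G)" and nc: "\<not> commutative G (carrier G)"
    and idx: "\<And>x. x \<in> carrier G - group_center G \<Longrightarrow> 3 * card (cent G x) \<le> card (carrier G)"
    and n: "card (carrier G) = 12"
  shows "\<exists>\<kappa>. separating G \<kappa>"
proof (rule exists_separating[OF fin])
  let ?Z = "group_center G"
  let ?V = "carrier G - ?Z"
  let ?k = "\<lambda>x. card (cent G x)" and ?z = "card ?Z"
  have finV: "finite ?V" using fin by simp
  obtain v where v: "v \<in> ?V" using nc by (auto simp: commutative_def group_center_def)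
  have z0: "0 < ?z" using card_cent_ge(5)[OF fin v] .
  have cV: "card ?V = 12 - ?z" using card_noncentral[OF fin] n by simp
  have k4: "?k x \<le> 4" if "x \<in> ?V" for x using idx[OF that] n by simp
  have abel: "commutative G (cent G x)" if "x \<in> ?V" for x
    using commutative_cent[OF fin that] k4[OF that] by simp
  have M: "6 \<le> card (common_nbrs G x y)" if "x \<in> ?V" "y \<in> ?V" for x y
    using index_3_common_nbrs[OF fin _ _ idx[OF that(1)] idx[OF that(2)]] n that by simp
  have C: "card (common_nbrs G x y) = 12 - ?k x" if "x \<in> ?V" "y \<in> ?V" "y \<in> cent G x" for x y
    using card_common_nbrs_same_cent[OF fin, of x y] cent_eq_if_commutative[of x y] abel that n by simp
  show "(\<Sum>x \<in> ?V. \<Sum>y \<in> ?V - {x}. risk G x y) < 2"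
  proof (cases "?z = 1")
    case False
    have row: "(\<Sum>y \<in> ?V - {x}. risk G x y) \<le> 9 / 256 + 1 / 8" if x: "x \<in> ?V" for x
    proof -
      have "?k x = 4 \<and> ?z = 2"
      proof -
        have "?k x = 2 \<or> ?k x = 3 \<or> ?k x = 4" "?z = 2 \<or> ?z = 3"
          using card_cent_ge[OF fin x] k4[OF x] z0 False by linarith+
        then show ?thesis using card_cent_ge(1,3)[OF fin x] by auto
      qed
      then show ?thesis
        using row_risk_le[OF fin x, of 8 6] M[OF x] C[OF x] n by (simp add: commuting_risk_def)
    qed
    have "(\<Sum>x \<in> ?V. \<Sum>y \<in> ?V - {x}. risk G x y) \<le> of_nat (card ?V) * (9 / 256 + 1 / 8)"
      using row by (intro sum_bounded_above) auto
    also have "\<dots> \<le> 10 * (9 / 256 + 1 / 8)" using cV z0 False by (intro mult_right_mono) auto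
    finally show ?thesis by simp
  next
    case True
    define F where "F = {x \<in> ?V. ?k x = 4}"
    have "F \<subseteq> ?V" by (auto simp: F_def)
    then have finF: "finite F" "F \<subseteq> ?V" using finV finite_subset by auto
    \<comment> \<open>Two centralizers of order 4 share at least \<open>16 / 12\<close>, hence at
      least 2 elements. A noncentral one among them has the same centralizer as both
      \<open>x\<close> and \<open>y\<close>.\<close>
    have same: "cent G x = cent G y" if "x \<in> F" "y \<in> F" for x y
    proof (rule ccontr)
      assume ne: "cent G x \<noteq> cent G y"
      have xy: "x \<in> ?V" "y \<in> ?V" "?k x = 4" "?k y = 4" using that by (auto simp: F_def)
      have xyc: "x \<in> carrier G" "y \<in> carrier G" using xy by auto
      have "4 * 4 \<le> 12 * card (cent G x \<inter> cent G y)"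
        using card_prod_subgroups[OF fin subgroup_cent subgroup_cent, of x y] xy n by simp
      then have "2 \<le> card (cent G x \<inter> cent G y)" by simp
      then have "\<not> cent G x \<inter> cent G y \<subseteq> ?Z"
        using True card_mono[OF finite_center[OF fin], of "cent G x \<inter> cent G y"] by auto
      then obtain d where d: "d \<in> cent G x" "d \<in> cent G y" "d \<notin> ?Z" by blast
      then have dV: "d \<in> ?V" by (simp add: cent_def)
      have "cent G d = cent G x" "cent G d = cent G y"
        using cent_eq_if_commutative[OF xyc(1) d(1) abel[OF xy(1)] abel[OF dV]]
          cent_eq_if_commutative[OF xyc(2) d(2) abel[OF xy(2)] abel[OF dV]] by simp_all
      then show False using ne by simp
    qed
    have cF: "card F \<le> 3"
    proof (cases "F = {}")
      case False
      then obtain x where x: "x \<in> F" by blast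
      then have xV: "x \<in> ?V" "?k x = 4" by (auto simp: F_def)
      have "F \<subseteq> cent G x - ?Z"
      proof
        fix y assume y: "y \<in> F"
        then have "y \<in> carrier G" "y \<notin> ?Z" by (auto simp: F_def)
        then show "y \<in> cent G x - ?Z" using same[OF x y] self_in_cent[of y] by simp
      qed
      then have "card F \<le> card (cent G x - ?Z)" using finite_cent[OF fin] by (intro card_mono) auto
      also have "\<dots> = 3" using True xV center_subset_cent[of x] finite_center[OF fin] by (simp add: card_Diff_subset)
      finally show ?thesis .
    qed simp
    have rowF: "(\<Sum>y \<in> ?V - {x}. risk G x y) \<le> 2 * (9 / 256) + 1 / 8" if x: "x \<in> F" for x
    proof -
      have x': "x \<in> ?V" "?k x = 4" using x by (auto simp: F_def)
      then show ?thesis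
        using row_risk_le[OF fin x'(1), of 8 6] M[OF x'(1)] C[OF x'(1)] n True by (simp add: commuting_risk_def)
    qed
    \<comment> \<open>The summands stand for at most one commuting partner with nine common
      neighbors, at most three elements of \<open>F\<close> with six, and at most ten further
      neighbors with seven, where \<open>7 = 12 + 1 - 3 - 3\<close>.\<close>
    have rowN: "(\<Sum>y \<in> ?V - {x}. risk G x y) \<le> 10 / 512 + 3 / 64 + 10 / 128" if x: "x \<in> ?V - F" for x
    proof -
      have xV: "x \<in> ?V" "?k x \<le> 3" using x k4[of x] by (auto simp: F_def)
      have "(\<Sum>y \<in> ?V - {x}. risk G x y) = (\<Sum>y \<in> F. risk G x y) + (\<Sum>y \<in> ?V - {x} - F. risk G x y)"
        using finV finF x by (subst sum.subset_diff[of F]) auto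
      moreover have "(\<Sum>y \<in> F. risk G x y) \<le> of_nat (card F) * (1 / 64)"
      proof (rule sum_bounded_above)
        fix y assume y: "y \<in> F"
        then have yV: "y \<in> ?V" "?k y = 4" by (auto simp: F_def)
        have "y \<notin> cent G x"
        proof
          assume "y \<in> cent G x"
          then have "cent G y = cent G x" using cent_eq_if_commutative[of x y] abel xV(1) yV(1) by blast
          then show False using xV yV by simp
        qed
        then show "risk G x y \<le> 1 / 64" using risk_le_adjacent[OF _ M[OF xV(1) yV(1)]] by simp
      qed
      moreover have "(\<Sum>y \<in> ?V - {x} - F. risk G x y) \<le> 10 / 512 + 10 / 128"
      proof -
        let ?S = "?V - {x} - F"
        have "(\<Sum>y \<in> ?S. risk G x y) \<le> card (?S \<inter> cent G x) * commuting_risk 9 + card (?S - cent G x) / 2 ^ 7"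
        proof (rule sum_risk_le)
          show "finite ?S" using finV by simp
          fix y assume y: "y \<in> ?S"
          then have yV: "y \<in> ?V" "?k y \<le> 3" using k4[of y] by (auto simp: F_def)
          show "9 \<le> card (common_nbrs G x y)" if "y \<in> cent G x" using C[OF xV(1) yV(1) that] xV by simp
          have one: "0 < card (cent G x \<inter> cent G y)"
            using subgroup.finite_imp_card_positive[OF subgroup_Int[OF subgroup_cent subgroup_cent] fin] xV(1) yV(1) by simp
          show "7 \<le> card (common_nbrs G x y)"
            using card_common_nbrs[OF fin, of x y] one xV yV n by simp
        qed
        moreover have "card (?S \<inter> cent G x) \<le> 1"
        proof -
          have "card (?S \<inter> cent G x) \<le> card ((?V - {x}) \<inter> cent G x)" using finV by (intro card_mono) auto
          then show ?thesis using card_cent_noncentral(1)[OF fin xV(1)] xV(2) True by simp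
        qed
        moreover have "card (?S - cent G x) \<le> 10"
        proof -
          have "card (?S - cent G x) \<le> card (?V - {x} - cent G x)" using finV by (intro card_mono) auto
          then show ?thesis using card_cent_noncentral(2)[OF fin xV(1)] card_cent_ge(2)[OF fin xV(1)] n by simp
        qed
        ultimately have "(\<Sum>y \<in> ?S. risk G x y) \<le> card (?S \<inter> cent G x) * (10 / 512) + card (?S - cent G x) / 128"
          "real (card (?S \<inter> cent G x)) \<le> 1" "real (card (?S - cent G x)) \<le> 10" by (simp_all add: commuting_risk_def)
        then show ?thesis by linarith
      qed
      moreover have "real (card F) \<le> 3" using cF by simp
      ultimately show ?thesis by linarith
    qed
    have "(\<Sum>x \<in> ?V. \<Sum>y \<in> ?V - {x}. risk G x y)
        = (\<Sum>x \<in> F. \<Sum>y \<in> ?V - {x}. risk G x y) + (\<Sum>x \<in> ?V - F. \<Sum>y \<in> ?V - {x}. risk G x y)"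
      using sum.subset_diff[OF finF(2) finV, of "\<lambda>x. \<Sum>y \<in> ?V - {x}. risk G x y"] by simp
    moreover have "(\<Sum>x \<in> F. \<Sum>y \<in> ?V - {x}. risk G x y) \<le> of_nat (card F) * (2 * (9 / 256) + 1 / 8)"
      using rowF by (rule sum_bounded_above)
    moreover have "(\<Sum>x \<in> ?V - F. \<Sum>y \<in> ?V - {x}. risk G x y) \<le> of_nat (card (?V - F)) * (10 / 512 + 3 / 64 + 10 / 128)"
      using rowN by (rule sum_bounded_above)
    moreover have "real (card (?V - F)) = 11 - real (card F)"
      using cV True finF cF card_mono[OF finV finF(2)] by (simp add: card_Diff_subset of_nat_diff)
    moreover have "real (card F) \<le> 3" using cF by simp
    ultimately show ?thesis by (simp add: field_simps)
  qed
qed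

text \<open>Below 14, some noncentral centralizer has at least three elements, since otherwise all
  elements would square to \<open>\<one>\<close> and the group would be abelian. Its order is then 3
  or 4 and divides that of the group, which leaves 9 and 12.\<close>

lemma separating_index_3:
  assumes fin: "finite (carrier G)" and nc: "\<not> commutative G (carrier G)"
    and idx: "\<And>x. x \<in> carrier G - group_center G \<Longrightarrow> 3 * card (cent G x) \<le> card (carrier G)"
  shows "\<exists>\<kappa>. separating G \<kappa>"
proof (cases "14 \<le> card (carrier G)")
  case True
  then show ?thesis
    using separating_index_3_large[OF fin nc idx] separating_index_3_medium[OF fin nc idx]
    by (cases "24 \<le> card (carrier G)") auto
next
  case False
  let ?V = "carrier G - group_center G"
  have "\<exists>x \<in> ?V. 3 \<le> card (cent G x)"
  proof (rule ccontr)
    assume contra: "\<not> ?thesis"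
    have k2: "card (cent G x) = 2" if x: "x \<in> ?V" for x
    proof -
      have "\<not> 3 \<le> card (cent G x)" using contra x by blast
      then show ?thesis using card_cent_ge(2)[OF fin x] by linarith
    qed
    have "x \<otimes> x = \<one>" if x: "x \<in> carrier G" for x
    proof (cases "x = \<one>")
      case False
      obtain v where v: "v \<in> ?V" using nc by (auto simp: commutative_def group_center_def)
      have "card (group_center G) = 1" using card_cent_ge[OF fin v] k2[OF v] by linarith
      then have "group_center G = {\<one>}"
        using subgroup.one_closed[OF subgroup_center] by (metis card_1_singletonE singletonD)
      then have xV: "x \<in> ?V" using x False by simp
      have "\<one> \<in> cent G x" "x \<in> cent G x" "x \<otimes> x \<in> cent G x"
        using x by (simp_all add: cent_def m_assoc)
      moreover have "cent G x = {\<one>, x}"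
        using k2[OF xV] finite_cent[OF fin] calculation False by (intro card_seteq[symmetric]) auto
      ultimately show ?thesis using x False by auto
    qed simp
    then have "comm_group G" by (rule all_involutions_comm)
    then show False using nc by (simp add: commutative_def comm_group_def comm_monoid.m_comm)
  qed
  then obtain x where x: "x \<in> ?V" "3 \<le> card (cent G x)" by blast
  let ?n = "card (carrier G)" and ?k = "card (cent G x)"
  have "?k \<in> {3, 4}" "?n \<in> {9, 10, 11, 12, 13}" using x(2) idx[OF x(1)] False by auto
  moreover have "?k dvd ?n" "3 * ?k \<le> ?n" using card_cent_ge(4)[OF fin x(1)] idx[OF x(1)] by simp_all
  ultimately have "?n = 9 \<or> ?n = 12" by auto
  then show ?thesis using card_ne_9[OF fin _ idx nc] separating_card_12[OF fin nc idx] by blast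
qed

end

section \<open>Commuting elements with centralizers of index 2\<close>

context group
begin

lemma index_2_or_3:
  assumes fin: "finite (carrier G)" and x: "x \<in> carrier G - group_center G"
  shows "2 * card (cent G x) = card (carrier G) \<or> 3 * card (cent G x) \<le> card (carrier G)"
    "2 * card (cent G x) \<le> card (carrier G)"
proof -
  have sub: "cent G x \<subset> carrier G" using x center_iff_cent[of x] by (auto simp: cent_def)
  show le: "2 * card (cent G x) \<le> card (carrier G)"
    using card_subgroup_proper[OF fin subgroup_cent subgroup_self sub] x by simp
  obtain q where q: "card (carrier G) = card (cent G x) * q" using card_cent_ge(4)[OF fin x] by (auto elim: dvdE)
  then have "2 \<le> q" using le card_cent_ge(2)[OF fin x] by simp
  then consider "q = 2" | "3 \<le> q" by linarith
  then show "2 * card (cent G x) = card (carrier G) \<or> 3 * card (cent G x) \<le> card (carrier G)"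
    using q by cases auto
qed

text \<open>With \<open>n \<le> 4 * m\<close>, this yields the requirement
  \<open>n^2 * (m + 2) / (2 * 2^m) < 2\<close> on the rows. It fails at \<open>m = 13\<close>, and
  \<open>n / 4\<close> rounded up reaches 14 at \<open>n = 53\<close>.\<close>

lemma power_bound_14: "14 \<le> m \<Longrightarrow> 4 * m ^ 2 * (m + 2) < 2 ^ m" for m :: nat
proof (induction m rule: nat_induct_at_least)
  case base show ?case by simp
next
  case (Suc m)
  have "14 * m \<le> m * m" "14 * (m * m) \<le> m * (m * m)" using Suc.hyps by simp_all
  then have "7 * m + 3 \<le> m * (m * m)" using Suc.hyps by linarith
  moreover have "Suc m ^ 2 * (Suc m + 2) = m * (m * m) + 5 * (m * m) + (7 * m + 3)"
    "2 * (m ^ 2 * (m + 2)) = 2 * (m * (m * m)) + 4 * (m * m)"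
    by (simp_all add: power2_eq_square algebra_simps)
  moreover have "m * m + (7 * m + 3) \<le> m * (m * m)"
    using \<open>14 * (m * m) \<le> m * (m * m)\<close> \<open>14 * m \<le> m * m\<close> Suc.hyps by linarith
  ultimately have "Suc m ^ 2 * (Suc m + 2) \<le> 2 * (m ^ 2 * (m + 2))" by linarith
  then show ?case using Suc.IH by simp
qed

lemma separating_large:
  assumes fin: "finite (carrier G)" and nc: "\<not> commutative G (carrier G)"
    and n: "53 \<le> card (carrier G)"
  shows "\<exists>\<kappa>. separating G \<kappa>"
proof (rule separating_by_rows[OF fin nc])
  fix x assume x: "x \<in> carrier G - group_center G"
  let ?n = "card (carrier G)" and ?k = "card (cent G x)" and ?z = "card (group_center G)"
  define m where "m = (?n + 3) div 4"
  have m: "?n \<le> 4 * m" "14 \<le> m" using n unfolding m_def by linarith+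
  have M: "m \<le> card (common_nbrs G x y)" if "y \<in> carrier G - group_center G" for y
    using card_common_nbrs_ge[OF fin _ _ index_2_or_3(2)[OF fin x] index_2_or_3(2)[OF fin that]] x that
    unfolding m_def by simp
  have k: "2 * ?k \<le> ?n" using index_2_or_3(2)[OF fin x] .
  have "(\<Sum>y \<in> carrier G - group_center G - {x}. risk G x y)
      \<le> real (?k - ?z - 1) * commuting_risk m + real (?n - ?k) / 2 ^ m"
    using row_risk_le[OF fin x, of m m] M by blast
  also have "\<dots> \<le> real ?k * commuting_risk m + real (?n - ?k) / 2 ^ m"
    by (intro add_right_mono mult_right_mono commuting_risk_nonneg) simp
  also have "\<dots> = (real ?k * real m + real ?n) / 2 ^ m"
    using k by (simp add: commuting_risk_def of_nat_diff field_simps)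
  also have "\<dots> \<le> (real ?n / 2 * real m + real ?n) / 2 ^ m"
    using k by (intro divide_right_mono add_right_mono mult_right_mono) auto
  finally have row: "(\<Sum>y \<in> carrier G - group_center G - {x}. risk G x y) \<le> real ?n * (real m + 2) / (2 * 2 ^ m)"
    by (simp add: field_simps)
  have "real ?n * real ?n \<le> 16 * (real m * real m)"
  proof -
    have "?n * ?n \<le> (4 * m) * (4 * m)" by (rule mult_le_mono[OF m(1) m(1)])
    then have "real (?n * ?n) \<le> real (4 * m * (4 * m))" by (rule of_nat_mono)
    then show ?thesis by simp
  qed
  then have "(real ?n * real ?n) * (real m + 2) \<le> 16 * (real m * real m) * (real m + 2)"
    by (intro mult_right_mono) auto
  also have "\<dots> < 4 * 2 ^ m"
  proof -
    have "real (4 * m ^ 2 * (m + 2)) < real (2 ^ m)"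
      using power_bound_14[OF m(2)] by (simp only: of_nat_less_iff)
    then show ?thesis by (simp add: power2_eq_square algebra_simps)
  qed
  finally have key: "real ?n * (real ?n * (real m + 2) / (2 * 2 ^ m)) < 2" by (simp add: field_simps)
  have "real (?n - 1) * (\<Sum>y \<in> carrier G - group_center G - {x}. risk G x y)
      \<le> real ?n * (real ?n * (real m + 2) / (2 * 2 ^ m))"
    using row by (intro mult_mono) (auto intro!: sum_nonneg simp: risk_def)
  then show "real (?n - 1) * (\<Sum>y \<in> carrier G - group_center G - {x}. risk G x y) < 2" using key by linarith
qed

text \<open>The power need not be the maximal one, so \<open>a = 1\<close> is Cauchy's
  theorem.\<close>

lemma subgroup_card_prime_power:
  assumes fin: "finite (carrier G)" and H: "subgroup H G" and p: "prime (p :: nat)"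
    and card: "card H = p ^ a * m"
  obtains K where "subgroup K G" "K \<subseteq> H" "card K = p ^ a"
proof -
  interpret H: group "G\<lparr>carrier := H\<rparr>" by (rule subgroup_imp_group[OF H])
  have "finite H" using finite_subset[OF subgroup.subset[OF H] fin] .
  then obtain K where K: "subgroup K (G\<lparr>carrier := H\<rparr>)" "card K = p ^ a"
    using sylow_thm[OF p H.is_group, of a m] card by (auto simp: order_def)
  have "K \<subseteq> H" using subgroup.subset[OF K(1)] by simp
  moreover have "subgroup K G" using incl_subgroup[OF H K(1)] .
  ultimately show thesis using that K(2) by blast
qed

text \<open>Excludes \<open>p * q = 4\<close> over a center of odd order when the possible group
  orders are determined.\<close>

lemma index_4_center_not_odd:
  assumes fin: "finite (carrier G)" and H: "subgroup H G"
    and four: "card H = 4 * card (center_of G H)" and odd: "odd (card (center_of G H))"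
  shows False
proof -
  let ?C = "center_of G H"
  \<comment> \<open>A Sylow 2-subgroup commutes with itself and with the center, so it would be central.\<close>
  obtain K where K: "subgroup K G" "K \<subseteq> H" "card K = 4"
    using subgroup_card_prime_power[OF fin H two_is_prime_nat, of 2 "card ?C"] four by auto
  interpret K: subgroup K G by (rule K(1))
  have finH: "finite H" using finite_subset[OF subgroup.subset[OF H] fin] .
  then have finK: "finite K" using K(2) finite_subset by blast
  \<comment> \<open>A group of order 4 is abelian: otherwise \<open>\<one>\<close>,
    \<open>a\<close>, \<open>b\<close>, \<open>a \<otimes> b\<close> and
    \<open>b \<otimes> a\<close> would be five elements.\<close>
  have com: "a \<otimes> b = b \<otimes> a" if ab: "a \<in> K" "b \<in> K" for a b
  proof (rule ccontr)
    assume ne: "a \<otimes> b \<noteq> b \<otimes> a"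
    have G: "a \<in> carrier G" "b \<in> carrier G" using ab by simp_all
    have "a \<noteq> \<one>" "b \<noteq> \<one>" "a \<noteq> b" using ne G by auto
    moreover have "a \<otimes> b \<noteq> \<one>"
    proof
      assume "a \<otimes> b = \<one>"
      moreover from this have "b \<otimes> a = \<one>" using inv_equality[of a b] r_inv[of b] G by simp
      ultimately show False using ne by simp
    qed
    moreover have "b \<otimes> a \<noteq> \<one>"
    proof
      assume "b \<otimes> a = \<one>"
      moreover from this have "a \<otimes> b = \<one>" using inv_equality[of b a] r_inv[of a] G by simp
      ultimately show False using ne by simp
    qed
    moreover have "a \<otimes> b \<noteq> a" "a \<otimes> b \<noteq> b" "b \<otimes> a \<noteq> a" "b \<otimes> a \<noteq> b"
      using G \<open>a \<noteq> \<one>\<close> \<open>b \<noteq> \<one>\<close> by simp_all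
    ultimately have "card {\<one>, a, b, a \<otimes> b, b \<otimes> a} = 5" using ne by auto
    moreover have "card {\<one>, a, b, a \<otimes> b, b \<otimes> a} \<le> card K" using ab finK by (intro card_mono) auto
    ultimately show False using K(3) by simp
  qed
  have C: "subgroup ?C G" by (rule subgroup_center_of[OF H])
  have "k \<in> ?C" if k: "k \<in> K" for k
  proof -
    let ?M = "H \<inter> cent G k"
    have kG: "k \<in> carrier G" using k by simp
    have M: "subgroup ?M G" by (rule subgroup_Int[OF H subgroup_cent[OF kG]])
    have "K \<subseteq> ?M" using K(2) com[OF k] by (auto simp: cent_def)
    then have 4: "4 dvd card ?M" using card_subgroup_dvd[OF K(1) M] K(3) by simp
    have "?C \<subseteq> ?M"
    proof
      fix c assume c: "c \<in> ?C"
      have "k \<in> H" using k K(2) by blast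
      then have "c \<in> H" "c \<otimes> k = k \<otimes> c" using c unfolding center_of_def by blast+
      then show "c \<in> ?M" using subgroup.mem_carrier[OF H] cent_iff[of c k] by auto
    qed
    then have "card ?C dvd card ?M" using card_subgroup_dvd[OF C M] by simp
    moreover have "coprime 4 (card ?C)"
      using odd coprime_power_left_iff[of 2 2 "card ?C"] by simp
    ultimately have "card H dvd card ?M" using 4 four divides_mult by metis
    moreover have "card ?M \<noteq> 0" using subgroup.finite_imp_card_positive[OF M fin] by simp
    ultimately have "card H \<le> card ?M" by (simp add: dvd_imp_le)
    then have "?M = H" using finH by (intro card_seteq) auto
    then have "\<forall>g \<in> H. k \<otimes> g = g \<otimes> k" unfolding cent_def by blast
    then show ?thesis using k K(2) unfolding center_of_def by blast
  qed
  then have "card K dvd card ?C" using card_subgroup_dvd[OF K(1) C] by blast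
  then show False using K(3) odd by (metis dvd_trans even_numeral)
qed

text \<open>Otherwise \<open>?C\<close> contains an involution \<open>u\<close>. Being noncentral,
  it has centralizer exactly \<open>?H\<close> by maximality, hence two conjugates, and their
  product would be a nontrivial central element.\<close>

lemma odd_center_of_index_2:
  assumes fin: "finite (carrier G)" and x: "x \<in> carrier G"
    and idx: "2 * card (cent G x) = card (carrier G)" and Z1: "group_center G = {\<one>}"
  shows "odd (card (center_of G (cent G x)))"
proof
  let ?H = "cent G x" and ?C = "center_of G (cent G x)"
  assume ev: "even (card ?C)"
  have H: "subgroup ?H G" by (rule subgroup_cent[OF x])
  have C: "subgroup ?C G" by (rule subgroup_center_of[OF H])
  obtain m where "card ?C = 2 ^ 1 * m" using ev by auto
  then obtain K where K: "subgroup K G" "K \<subseteq> ?C" "card K = 2"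
    using subgroup_card_prime_power[OF fin C two_is_prime_nat] by (metis power_one_right)
  interpret K: subgroup K G by (rule K(1))
  obtain u where u: "K = {\<one>, u}" "u \<noteq> \<one>"
    using K(3) K.one_closed by (metis card_2_iff doubleton_eq_iff insertE singletonD)
  have uG: "u \<in> carrier G" using u K.subset by auto
  have uC: "u \<in> ?C" using u K(2) by auto
  have "u \<otimes> u \<in> K" using u(1) K.m_closed by blast
  moreover have "u \<otimes> u \<noteq> u" using uG u by simp
  ultimately have uu: "u \<otimes> u = \<one>" using u(1) by blast
  have Hu: "h \<in> cent G u" if h: "h \<in> ?H" for h
    using uC h by (auto simp: center_of_def cent_def)
  have uZ: "u \<notin> group_center G" using Z1 u by simp
  have cu: "cent G u = ?H"
  proof (rule ccontr)
    assume "cent G u \<noteq> ?H"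
    then obtain g where "g \<in> cent G u" "g \<notin> ?H" using Hu by blast
    then have "cent G u = carrier G"
      using index_2_maximal[OF fin H idx subgroup_cent[OF uG]] Hu by blast
    then show False using uZ center_iff_cent[OF uG] by simp
  qed
  have "0 < card ?H" using subgroup.finite_imp_card_positive[OF H fin] .
  then have "?H \<noteq> carrier G" using idx by auto
  then obtain t where t: "t \<in> carrier G" "t \<notin> ?H" using subgroup.subset[OF H] by blast
  \<comment> \<open>The product of the involution \<open>u\<close> with its only other conjugate is central, hence trivial.\<close>
  define v where "v = inv t \<otimes> u \<otimes> t"
  have vG: "v \<in> carrier G" using t uG by (simp add: v_def)
  have uH: "u \<in> ?H" using self_in_cent[OF uG] cu by simp
  have vH: "v \<in> ?H" unfolding v_def by (rule index_2_conj[OF fin H idx uH t(1)])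
  have uv: "u \<otimes> v = v \<otimes> u" using Hu[OF vH] by (rule centD)
  \<comment> \<open>\<open>t \<otimes> t\<close> lies in \<open>?H\<close>, the centralizer of
    \<open>u\<close>, so conjugation by \<open>t\<close> swaps \<open>u\<close> and
    \<open>v\<close>.\<close>
  have conj_v: "inv t \<otimes> v \<otimes> t = u"
  proof -
    have "t \<otimes> t \<in> cent G u" using index_2_mult[OF fin H idx, of t t] t cu by simp
    then have "u \<otimes> (t \<otimes> t) = t \<otimes> t \<otimes> u" by (rule centD)
    then have "inv t \<otimes> v \<otimes> t = inv t \<otimes> inv t \<otimes> (t \<otimes> t \<otimes> u)"
      unfolding v_def using t uG by (simp add: m_assoc)
    also have "\<dots> = inv t \<otimes> (inv t \<otimes> t) \<otimes> t \<otimes> u"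
      using t(1) uG by (simp only: m_assoc m_closed inv_closed)
    finally show ?thesis using t(1) uG by simp
  qed
  have "inv t \<otimes> (u \<otimes> v) \<otimes> t = (inv t \<otimes> u \<otimes> t) \<otimes> (inv t \<otimes> v \<otimes> t)"
    using t uG vG by (simp add: m_assoc) (simp flip: m_assoc)
  also have "\<dots> = v \<otimes> u" unfolding conj_v v_def[symmetric] ..
  finally have "inv t \<otimes> (u \<otimes> v) \<otimes> t = u \<otimes> v" using uv by simp
  then have "t \<otimes> (inv t \<otimes> (u \<otimes> v) \<otimes> t) = t \<otimes> (u \<otimes> v)" by (rule arg_cong)
  moreover have "t \<otimes> (inv t \<otimes> (u \<otimes> v) \<otimes> t) = u \<otimes> v \<otimes> t"
    using t uG vG by (simp flip: m_assoc)
  ultimately have tuv: "t \<in> cent G (u \<otimes> v)" using t by (simp add: cent_iff)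
  have "h \<in> cent G (u \<otimes> v)" if h: "h \<in> ?H" for h
  proof -
    have hG: "h \<in> carrier G" using h by (simp add: cent_def)
    have "u \<otimes> h = h \<otimes> u" using Hu[OF h] by (rule centD)
    moreover have "v \<otimes> h = h \<otimes> v"
      using conj_cent_index_2[OF fin uG t(1), of h] cu idx h unfolding v_def by (intro centD) simp
    ultimately have "h \<otimes> (u \<otimes> v) = u \<otimes> v \<otimes> h" using commute_mult[OF hG uG vG] by simp
    then show ?thesis using hG by (simp add: cent_iff)
  qed
  then have "cent G (u \<otimes> v) = carrier G"
    using index_2_maximal[OF fin H idx subgroup_cent _ tuv t(2)] uG vG by blast
  then have "u \<otimes> v = \<one>" using center_iff_cent[of "u \<otimes> v"] uG vG Z1 by simp
  then have "u \<otimes> v = u \<otimes> u" using uu by simp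
  then have "v = u" using uG vG by simp
  then have "t \<otimes> u = u \<otimes> t" using t uG unfolding v_def by (metis inv_solve_left m_assoc m_closed inv_closed)
  then have "t \<in> cent G u" using t by (simp add: cent_iff)
  then show False using t cu by simp
qed

text \<open>The product is the order of a centralizer of index 2, at most 26 because the group has
  fewer than 53 elements. From \<open>p * q \<ge> 4\<close> follows \<open>z * e \<le> 6\<close>,
  and the parity conditions leave few cases.\<close>

lemma small_products:
  fixes z e p q :: nat
  assumes ge: "1 \<le> z" "2 \<le> e" "2 \<le> p" "2 \<le> q" and le: "z * e * p * q \<le> 26"
    and odd: "z = 1 \<Longrightarrow> odd e" "odd (z * e) \<Longrightarrow> p * q \<noteq> 4"
  shows "z * e * p * q = 16 \<and> z = 2 \<or> z * e * p * q = 18 \<and> z = 1 \<or> z * e * p * q = 24"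
proof -
  have "z * e * 4 \<le> z * e * (p * q)"
    using mult_le_mono[OF ge(3,4)] by (intro mult_le_mono2) simp
  then have ze: "z * e \<le> 6" using le by (simp only: mult.assoc)
  have "z * 2 \<le> z * e" "1 * e \<le> z * e" using mult_le_mono2[OF ge(2)] mult_le_mono1[OF ge(1)] by simp_all
  then have "z \<le> 3" "e \<le> 6" using ze by linarith+
  then have "z \<in> {1, 2, 3}" "e \<in> {2, 3, 4, 5, 6}" using ge unfolding insert_iff empty_iff by presburger+
  then have "z = 1 \<and> e = 3 \<or> z = 1 \<and> e = 5 \<or> z = 2 \<and> e = 2 \<or> z = 2 \<and> e = 3 \<or> z = 3 \<and> e = 2"
    using ze odd(1) by (elim insertE emptyE; simp)
  then consider "z = 1" "e = 3" | "z = 1" "e = 5" | "z = 2" "e = 2" | "z = 2" "e = 3" | "z = 3" "e = 2"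
    by blast
  note ze_cases = this
  have le': "z * e * (p * q) \<le> 26" using le by (simp only: mult.assoc)
  then have pq8: "p * q \<le> 8" by (cases rule: ze_cases; simp)
  moreover have "2 * q \<le> p * q" "p * 2 \<le> p * q" using mult_le_mono1[OF ge(3)] mult_le_mono2[OF ge(4)] by simp_all
  ultimately have "p \<le> 4" "q \<le> 4" by linarith+
  then have "p \<in> {2, 3, 4}" "q \<in> {2, 3, 4}" using ge unfolding insert_iff empty_iff by presburger+
  then have "p * q = 4 \<or> p * q = 6 \<or> p * q = 8" using pq8 by (elim insertE emptyE; simp)
  then have "z * e * (p * q) = 16 \<and> z = 2 \<or> z * e * (p * q) = 18 \<and> z = 1 \<or> z * e * (p * q) = 24"
    using le' odd(2) by (cases rule: ze_cases; elim disjE; simp)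
  then show ?thesis by (simp only: mult.assoc)
qed

text \<open>\<open>A\<close> counts the noncentral elements with centralizers of index 2. The
  summands bound the risk of pairs among these, of mixed pairs in both orders, and of the other
  pairs. The exponents are \<open>n / 4\<close>, and \<open>n / 3\<close> and
  \<open>4 * n / 9\<close> rounded up, for indices 2 and 2, 2 and 3, 3 and 3.\<close>

lemma commuting_index_2_numeric:
  fixes n z A :: nat
  assumes "n = 32 \<and> z = 2 \<or> n = 36 \<and> z = 1 \<or> n = 48" "4 * A + 4 * z \<le> n" "1 \<le> z"
  shows "real (A * (A - 1)) * commuting_risk (n div 4)
    + 2 * (real A * (real (n div 2 - z - A) * commuting_risk ((n + 2) div 3) + real (n div 2) / 2 ^ ((n + 2) div 3)))
    + real n * ((real n / 3 * real ((4 * n + 8) div 9) + real n) / 2 ^ ((4 * n + 8) div 9)) < 2"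
proof -
  consider "n = 32" "z = 2" | "n = 36" "z = 1" | "n = 48" using assms(1) by blast
  then show ?thesis
  proof cases
    case 1
    then have "A \<in> {0, 1, 2, 3, 4, 5, 6}" using assms(2) unfolding insert_iff empty_iff by presburger
    then show ?thesis using 1 by (elim insertE emptyE; simp add: commuting_risk_def)
  next
    case 2
    then have "A \<in> {0, 1, 2, 3, 4, 5, 6, 7, 8}" using assms(2) unfolding insert_iff empty_iff by presburger
    then show ?thesis using 2 by (elim insertE emptyE; simp add: commuting_risk_def)
  next
    case 3
    \<comment> \<open>For \<open>n = 48\<close> there is enough slack to bound each summand
      separately by the largest \<open>A\<close>, whatever \<open>z\<close> is.\<close>
    have A: "A \<le> 11" using 3 assms(2,3) by linarith
    have "A * (A - 1) \<le> 11 * 10" using A by (intro mult_le_mono) auto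
    then have "real (A * (A - 1)) \<le> 110" by linarith
    moreover have "real A * (real (24 - z - A) * (17 / 65536) + 24 / 65536) \<le> 11 * (24 * (17 / 65536) + 24 / 65536)"
      using A by (intro mult_mono add_right_mono mult_right_mono) auto
    ultimately show ?thesis using 3 by (simp add: commuting_risk_def)
  qed
qed

lemma separating_commuting_index_2:
  assumes fin: "finite (carrier G)" and nc: "\<not> commutative G (carrier G)"
    and na: "\<And>H. subgroup H G \<Longrightarrow> 2 * card H = card (carrier G) \<Longrightarrow> \<not> commutative G H"
    and x0: "x0 \<in> carrier G - group_center G" "2 * card (cent G x0) = card (carrier G)"
    and comm: "\<And>x y. x \<in> carrier G - group_center G \<Longrightarrow> 2 * card (cent G x) = card (carrier G) \<Longrightarrow>
      y \<in> carrier G - group_center G \<Longrightarrow> 2 * card (cent G y) = card (carrier G) \<Longrightarrow> y \<in> cent G x"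
    and n: "card (carrier G) < 53"
  shows "\<exists>\<kappa>. separating G \<kappa>"
proof (rule exists_separating[OF fin])
  let ?Z = "group_center G"
  let ?V = "carrier G - ?Z" and ?n = "card (carrier G)" and ?z = "card ?Z"
  let ?H = "cent G x0" and ?C = "center_of G (cent G x0)"
  define S where "S = {x \<in> ?V. 2 * card (cent G x) = ?n}"
  define N where "N = ?V - S"
  have x0G: "x0 \<in> carrier G" using x0 by simp
  have H: "subgroup ?H G" by (rule subgroup_cent[OF x0G])
  have C: "subgroup ?C G" by (rule subgroup_center_of[OF H])
  have finV: "finite ?V" using fin by simp
  have SV: "S \<subseteq> ?V" by (auto simp: S_def)
  then have finS: "finite S" and finN: "finite N" using finV finite_subset by (auto simp: N_def)
  have S: "2 * card (cent G x) = ?n" "x \<in> ?V" if "x \<in> S" for x using that by (auto simp: S_def)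
  have N: "3 * card (cent G x) \<le> ?n" "x \<in> ?V" if "x \<in> N" for x
    using that index_2_or_3(1)[OF fin, of x] by (auto simp: N_def S_def)
  have Scent: "S \<subseteq> cent G x" if "x \<in> S" for x using comm[of x] that by (auto simp: S_def)
  have x0S: "x0 \<in> S" using x0 by (simp add: S_def)
  have cardSZ: "card (S \<union> ?Z) = card S + ?z"
    using SV finS finite_center[OF fin] by (intro card_Un_disjoint) auto
  obtain p q where pq: "2 \<le> p" "2 \<le> q" "card ?H = card ?C * p * q"
    using noncommutative_card[OF fin H na[OF H x0(2)]] by blast
  \<comment> \<open>The inclusion is strict because \<open>x0\<close> is central in its own
    centralizer; this will give \<open>e \<ge> 2\<close>.\<close>
  have ZC: "?Z \<subset> ?C"
  proof -
    have "?Z \<subseteq> ?C"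
    proof
      fix c assume c: "c \<in> ?Z"
      have "c \<in> ?H" using c center_subset_cent[OF x0G] by blast
      moreover have "c \<otimes> g = g \<otimes> c" if "g \<in> ?H" for g using center_comm[OF c] that by (simp add: cent_def)
      ultimately show "c \<in> ?C" by (simp add: center_of_def)
    qed
    moreover have "x0 \<in> ?C" using x0G by (auto simp: center_of_def cent_def)
    ultimately show ?thesis using x0(1) by blast
  qed
  \<comment> \<open>\<open>S\<close> and the center lie in a subgroup of index at least 4: the
    intersection of two different centralizers of index 2 or, if all of these coincide, the center
    of \<open>?H\<close>, whose index in \<open>?H\<close> is at least \<open>2 * 2\<close>.\<close>
  have four: "4 * card S + 4 * ?z \<le> ?n"
  proof (cases "\<exists>y \<in> S. cent G y \<noteq> ?H")
    case True
    then obtain y where y: "y \<in> S" "cent G y \<noteq> ?H" by blast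
    have yG: "y \<in> carrier G" using S(2)[OF y(1)] by simp
    let ?D = "?H \<inter> cent G y"
    have "?D \<subset> ?H"
    proof (rule ccontr)
      assume "\<not> ?D \<subset> ?H"
      then have "?H \<subseteq> cent G y" by blast
      moreover have "card ?H = card (cent G y)" using S(1)[OF y(1)] x0(2) by linarith
      ultimately have "?H = cent G y" using finite_cent[OF fin] by (intro card_subset_eq) auto
      then show False using y(2) by simp
    qed
    then have "2 * card ?D \<le> card ?H"
      using card_subgroup_proper[OF fin subgroup_Int[OF H subgroup_cent[OF yG]] H] by blast
    moreover have "S \<union> ?Z \<subseteq> ?D"
      using Scent[OF x0S] Scent[OF y(1)] center_subset_cent[OF x0G] center_subset_cent[OF yG] by blast
    then have "card (S \<union> ?Z) \<le> card ?D" using finite_cent[OF fin] by (intro card_mono) auto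
    ultimately show ?thesis using cardSZ x0(2) by linarith
  next
    case False
    have "S \<subseteq> ?C"
    proof
      fix y assume y: "y \<in> S"
      then have "cent G y = ?H" using False by blast
      then show "y \<in> ?C" using self_in_cent[of y] S(2)[OF y] by (auto simp: center_of_def cent_def)
    qed
    then have "card (S \<union> ?Z) \<le> card ?C"
      using ZC finite_subset[OF center_of_subset finite_cent[OF fin]] by (intro card_mono) auto
    moreover have "card ?C * (2 * 2) \<le> card ?C * (p * q)" using pq(1,2) by (intro mult_le_mono) auto
    then have "4 * card ?C \<le> card ?H" using pq(3) by (simp add: mult.assoc)
    ultimately show ?thesis using cardSZ x0(2) by linarith
  qed
  have z0: "1 \<le> ?z" using card_cent_ge(5)[OF fin x0(1)] by linarith
  have shape: "?n = 32 \<and> ?z = 2 \<or> ?n = 36 \<and> ?z = 1 \<or> ?n = 48"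
  proof -
    obtain e where e: "card ?C = ?z * e" using card_subgroup_dvd[OF subgroup_center C] ZC by (auto elim: dvdE)
    have "?z < card ?C" using psubset_card_mono[OF _ ZC] finite_subset[OF center_of_subset finite_cent[OF fin]] by blast
    then have e2: "2 \<le> e" using e by (cases e; cases "e - 1"; auto)
    have nform: "?n = 2 * (?z * e * p * q)" using x0(2) pq(3) e by simp
    have o: "odd e" if "?z = 1"
    proof -
      have "?Z = {\<one>}" using that subgroup.one_closed[OF subgroup_center] by (metis card_1_singletonE singletonD)
      then show ?thesis using odd_center_of_index_2[OF fin x0G x0(2)] e that by simp
    qed
    have o4: "p * q \<noteq> 4" if "odd (?z * e)"
      using index_4_center_not_odd[OF fin H] pq(3) e that by (auto simp: mult.assoc)
    have le: "?z * e * p * q \<le> 26" using nform n by linarith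
    have double: "2 * m = 32 \<and> ?z = 2 \<or> 2 * m = 36 \<and> ?z = 1 \<or> 2 * m = 48"
      if "m = 16 \<and> ?z = 2 \<or> m = 18 \<and> ?z = 1 \<or> m = 24" for m :: nat
      using that by auto
    show ?thesis unfolding nform by (rule double[OF small_products[OF z0 e2 pq(1,2) le o o4]])
  qed
  have bSS: "?n div 4 \<le> card (common_nbrs G x y)" if "x \<in> S" "y \<in> S" for x y
    using card_common_nbrs_ge[OF fin, of x y 2 2] S[OF that(1)] S[OF that(2)] by simp
  have bSN: "(?n + 2) div 3 \<le> card (common_nbrs G x y)" if "x \<in> S" "y \<in> N" for x y
    using card_common_nbrs_ge[OF fin, of x y 2 3] S[OF that(1)] N[OF that(2)] by simp
  have bNN: "(4 * ?n + 8) div 9 \<le> card (common_nbrs G x y)" if "x \<in> N" "y \<in> N" for x y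
    using index_3_common_nbrs[OF fin, of x y] N[OF that(1)] N[OF that(2)] by simp
  have SS: "(\<Sum>x \<in> S. \<Sum>y \<in> S - {x}. risk G x y) \<le> real (card S * (card S - 1)) * commuting_risk (?n div 4)"
  proof -
    have "(\<Sum>y \<in> S - {x}. risk G x y) \<le> of_nat (card (S - {x})) * commuting_risk (?n div 4)" if x: "x \<in> S" for x
      using bSS[OF x] by (intro sum_bounded_above risk_le_commuting_risk) auto
    then have "(\<Sum>y \<in> S - {x}. risk G x y) \<le> real (card S - 1) * commuting_risk (?n div 4)" if "x \<in> S" for x
      using that finS by simp
    then have "(\<Sum>x \<in> S. \<Sum>y \<in> S - {x}. risk G x y) \<le> of_nat (card S) * (real (card S - 1) * commuting_risk (?n div 4))"
      by (rule sum_bounded_above)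
    then show ?thesis by (simp add: mult.assoc)
  qed
  have SN: "(\<Sum>x \<in> S. \<Sum>y \<in> N. risk G x y) \<le> real (card S) *
     (real (?n div 2 - ?z - card S) * commuting_risk ((?n + 2) div 3) + real (?n div 2) / 2 ^ ((?n + 2) div 3))"
  proof (rule sum_bounded_above)
    fix x assume x: "x \<in> S"
    have xG: "x \<in> carrier G" using S(2)[OF x] by simp
    have half: "card (cent G x) = ?n div 2" using S(1)[OF x] by linarith
    have "N \<inter> cent G x = cent G x - (S \<union> ?Z)" by (auto simp: N_def cent_def)
    then have c1: "card (N \<inter> cent G x) = ?n div 2 - ?z - card S"
      using Scent[OF x] center_subset_cent[OF xG] finS finite_center[OF fin] cardSZ half
      by (simp add: card_Diff_subset)
    have "card (N - cent G x) \<le> card (carrier G - cent G x)" using fin by (intro card_mono) (auto simp: N_def)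
    also have "\<dots> = ?n - card (cent G x)"
      using finite_cent[OF fin] by (intro card_Diff_subset) (auto simp: cent_def)
    also have "\<dots> = ?n div 2" using S(1)[OF x] by linarith
    finally have c2: "card (N - cent G x) \<le> ?n div 2" .
    have "(\<Sum>y \<in> N. risk G x y) \<le> card (N \<inter> cent G x) * commuting_risk ((?n + 2) div 3)
        + card (N - cent G x) / 2 ^ ((?n + 2) div 3)"
      using bSN[OF x] by (intro sum_risk_le[OF finN]) auto
    also have "\<dots> \<le> real (?n div 2 - ?z - card S) * commuting_risk ((?n + 2) div 3) + real (?n div 2) / 2 ^ ((?n + 2) div 3)"
      using c1 c2 by (intro add_mono divide_right_mono) auto
    finally show "(\<Sum>y \<in> N. risk G x y) \<le> real (?n div 2 - ?z - card S) * commuting_risk ((?n + 2) div 3)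
        + real (?n div 2) / 2 ^ ((?n + 2) div 3)" .
  qed
  have NN: "(\<Sum>x \<in> N. \<Sum>y \<in> N - {x}. risk G x y)
      \<le> real ?n * ((real ?n / 3 * real ((4 * ?n + 8) div 9) + real ?n) / 2 ^ ((4 * ?n + 8) div 9))"
    (is "_ \<le> real ?n * ?r")
  proof -
    define m where "m = (4 * ?n + 8) div 9"
    have "(\<Sum>y \<in> N - {x}. risk G x y) \<le> (real ?n / 3 * real m + real ?n) / 2 ^ m" if x: "x \<in> N" for x
    proof -
      let ?k = "card (cent G x)"
      have k: "3 * ?k \<le> ?n" using N(1)[OF x] .
      have "(\<Sum>y \<in> N - {x}. risk G x y) \<le> card ((N - {x}) \<inter> cent G x) * commuting_risk m + card (N - {x} - cent G x) / 2 ^ m"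
        using bNN[OF x] finN unfolding m_def by (intro sum_risk_le) auto
      also have "\<dots> \<le> real ?k * commuting_risk m + real (?n - ?k) / 2 ^ m"
      proof (intro add_mono mult_right_mono divide_right_mono commuting_risk_nonneg)
        show "real (card ((N - {x}) \<inter> cent G x)) \<le> real ?k"
          using finite_cent[OF fin] by (simp add: card_mono)
        have "card (N - {x} - cent G x) \<le> card (carrier G - cent G x)" using fin by (intro card_mono) (auto simp: N_def)
        also have "\<dots> = ?n - ?k"
          using finite_cent[OF fin] by (intro card_Diff_subset) (auto simp: cent_def)
        finally show "real (card (N - {x} - cent G x)) \<le> real (?n - ?k)" by simp
      qed simp
      also have "\<dots> = (real ?k * real m + real ?n) / 2 ^ m"
        using k by (simp add: commuting_risk_def of_nat_diff field_simps)
      also have "\<dots> \<le> (real ?n / 3 * real m + real ?n) / 2 ^ m"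
        using k by (intro divide_right_mono add_right_mono mult_right_mono) auto
      finally show ?thesis .
    qed
    then have "(\<Sum>x \<in> N. \<Sum>y \<in> N - {x}. risk G x y) \<le> of_nat (card N) * ?r"
      unfolding m_def by (rule sum_bounded_above)
    also have "\<dots> \<le> real ?n * ?r"
    proof (intro mult_right_mono)
      have "card N \<le> ?n" using fin by (intro card_mono) (auto simp: N_def)
      then show "of_nat (card N) \<le> real ?n" by simp
    qed simp
    finally show ?thesis .
  qed
  have NS: "(\<Sum>x \<in> N. \<Sum>y \<in> S. risk G x y) = (\<Sum>x \<in> S. \<Sum>y \<in> N. risk G x y)"
  proof -
    have "(\<Sum>x \<in> N. \<Sum>y \<in> S. risk G x y) = (\<Sum>y \<in> S. \<Sum>x \<in> N. risk G x y)" by (rule sum.swap)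
    also have "\<dots> = (\<Sum>y \<in> S. \<Sum>x \<in> N. risk G y x)"
      using S(2) N(2) by (intro sum.cong refl risk_commute) auto
    finally show ?thesis .
  qed
  have rowS: "(\<Sum>y \<in> ?V - {x}. risk G x y) = (\<Sum>y \<in> S - {x}. risk G x y) + (\<Sum>y \<in> N. risk G x y)" if x: "x \<in> S" for x
  proof -
    have "?V - {x} = (S - {x}) \<union> N" "(S - {x}) \<inter> N = {}" using x SV by (auto simp: N_def)
    then show ?thesis using finS finN by (simp add: sum.union_disjoint)
  qed
  have rowN: "(\<Sum>y \<in> ?V - {x}. risk G x y) = (\<Sum>y \<in> S. risk G x y) + (\<Sum>y \<in> N - {x}. risk G x y)" if x: "x \<in> N" for x
  proof -
    have "?V - {x} = S \<union> (N - {x})" "S \<inter> (N - {x}) = {}" using x SV by (auto simp: N_def)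
    then show ?thesis using finS finN by (simp add: sum.union_disjoint)
  qed
  have "?V = S \<union> N" "S \<inter> N = {}" using SV by (auto simp: N_def)
  then have "(\<Sum>x \<in> ?V. \<Sum>y \<in> ?V - {x}. risk G x y)
      = (\<Sum>x \<in> S. \<Sum>y \<in> ?V - {x}. risk G x y) + (\<Sum>x \<in> N. \<Sum>y \<in> ?V - {x}. risk G x y)"
    using sum.union_disjoint[OF finS finN, of "\<lambda>x. \<Sum>y \<in> ?V - {x}. risk G x y"] by metis
  also have "(\<Sum>x \<in> S. \<Sum>y \<in> ?V - {x}. risk G x y) = (\<Sum>x \<in> S. \<Sum>y \<in> S - {x}. risk G x y) + (\<Sum>x \<in> S. \<Sum>y \<in> N. risk G x y)"
    using rowS by (simp add: sum.distrib)
  also have "(\<Sum>x \<in> N. \<Sum>y \<in> ?V - {x}. risk G x y) = (\<Sum>x \<in> S. \<Sum>y \<in> N. risk G x y) + (\<Sum>x \<in> N. \<Sum>y \<in> N - {x}. risk G x y)"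
    using rowN NS by (simp add: sum.distrib)
  finally show "(\<Sum>x \<in> ?V. \<Sum>y \<in> ?V - {x}. risk G x y) < 2"
    using SS SN NN commuting_index_2_numeric[OF shape four z0] by linarith
qed

text \<open>The intersection has index at most 4, so together with \<open>x\<close> it generates
  \<open>cent G x\<close>, where \<open>x\<close> is central. Read backwards, the intersection is
  nonabelian whenever no subgroup of index 2 is abelian.\<close>

lemma commutative_cent_if_Int:
  assumes fin: "finite (carrier G)" and x: "x \<in> carrier G" and y: "y \<in> carrier G"
    and idx: "2 * card (cent G x) = card (carrier G)" and idy: "2 * card (cent G y) = card (carrier G)"
    and nc: "y \<notin> cent G x" and comm: "commutative G (cent G x \<inter> cent G y)"
  shows "commutative G (cent G x)"
proof -
  let ?X = "cent G x" and ?D = "cent G x \<inter> cent G y"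
  have X: "subgroup ?X G" and D: "subgroup ?D G"
    using subgroup_cent[OF x] subgroup_cent[OF y] subgroup_Int by blast+
  have xD: "x \<notin> ?D" using nc cent_sym[OF x y] by simp
  have n0: "0 < card (carrier G)" using fin x by (auto simp: card_gt_0_iff)
  have "card ?X * card (cent G y) \<le> card (carrier G) * card ?D"
    by (rule card_prod_subgroups[OF fin subgroup_cent[OF x] subgroup_cent[OF y]])
  then have "4 * (card ?X * card (cent G y)) \<le> 4 * (card (carrier G) * card ?D)" by simp
  then have "(2 * card ?X) * (2 * card (cent G y)) \<le> card (carrier G) * (4 * card ?D)" by (simp add: mult.assoc mult.left_commute)
  then have quarter: "card (carrier G) \<le> 4 * card ?D" unfolding idx idy using n0 by simp
  \<comment> \<open>\<open>?D\<close> has index at most 2 in \<open>?X\<close>, which leaves no room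
    for a proper subgroup of \<open>?X\<close> strictly above it. This is applied to
    \<open>?X \<inter> cent G d\<close> and to the center of \<open>?X\<close>.\<close>
  have XM: "?X \<subseteq> M" if M: "subgroup M G" "M \<subseteq> ?X" "?D \<subseteq> M" "x \<in> M" for M
  proof -
    have "2 * card ?D \<le> card M" using card_subgroup_proper[OF fin D M(1)] M xD by blast
    then have "card ?X \<le> card M" using quarter idx by linarith
    then have "M = ?X" by (rule card_seteq[OF finite_cent[OF fin] M(2)])
    then show ?thesis by simp
  qed
  have Dc: "?X \<subseteq> cent G d" if d: "d \<in> ?D" for d
  proof -
    have dG: "d \<in> carrier G" using d by (simp add: cent_def)
    have "?D \<subseteq> cent G d" using comm d unfolding commutative_def cent_def by blast
    moreover have "x \<in> cent G d" using d cent_sym[OF x dG] by simp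
    ultimately have "?X \<subseteq> ?X \<inter> cent G d"
      using XM[of "?X \<inter> cent G d"] subgroup_Int[OF X subgroup_cent[OF dG]] self_in_cent[OF x] by blast
    then show ?thesis by blast
  qed
  have "?X \<subseteq> center_of G ?X"
  proof (rule XM[OF subgroup_center_of[OF X] center_of_subset])
    show "?D \<subseteq> center_of G ?X"
    proof
      fix d assume d: "d \<in> ?D"
      have "d \<otimes> g = g \<otimes> d" if "g \<in> ?X" for g using Dc[OF d] that centD by blast
      then show "d \<in> center_of G ?X" using d by (simp add: center_of_def)
    qed
    have "x \<otimes> g = g \<otimes> x" if "g \<in> ?X" for g using that by (rule centD)
    then show "x \<in> center_of G ?X" using self_in_cent[OF x] by (simp add: center_of_def)
  qed
  then show ?thesis unfolding commutative_def center_of_def by blast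
qed

end

text \<open>The induction hypothesis serves the central product, where \<open>?D\<close> is a
  smaller nonabelian group; as \<open>G\<close> with a restricted carrier it has the same
  type.\<close>

lemma exists_separating_coloring:
  fixes G :: "('a, 'm) monoid_scheme"
  assumes "group G" "finite (carrier G)" "\<not> commutative G (carrier G)"
  shows "\<exists>\<kappa>. separating G \<kappa>"
  using assms
proof (induction "card (carrier G)" arbitrary: G rule: less_induct)
  case less
  interpret group G by (rule less.prems(1))
  note fin = less.prems(2) and nc = less.prems(3)
  let ?V = "carrier G - group_center G" and ?n = "card (carrier G)"
  let ?half = "\<lambda>x. x \<in> ?V \<and> 2 * card (cent G x) = ?n"
  consider (abelian) H where "subgroup H G" "2 * card H = ?n" "commutative G H"
    | (index_3) "\<forall>x. \<not> ?half x"
    | (large) "53 \<le> ?n"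
    | (central_product) x y where "\<And>H. subgroup H G \<Longrightarrow> 2 * card H = ?n \<Longrightarrow> \<not> commutative G H"
        "?half x" "?half y" "y \<notin> cent G x"
    | (commuting) x where "\<And>H. subgroup H G \<Longrightarrow> 2 * card H = ?n \<Longrightarrow> \<not> commutative G H"
        "?half x" "\<forall>x y. ?half x \<longrightarrow> ?half y \<longrightarrow> y \<in> cent G x" "?n < 53"
  proof (cases "\<exists>H. subgroup H G \<and> 2 * card H = ?n \<and> commutative G H")
    case True then show thesis using that(1) by blast
  next
    case na: False
    show thesis
    proof (cases "(\<exists>x. ?half x) \<and> ?n < 53")
      case True
      then obtain x where x: "?half x" "?n < 53" by blast
      show thesis
      proof (cases "\<forall>x y. ?half x \<longrightarrow> ?half y \<longrightarrow> y \<in> cent G x")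
        case True then show thesis using that(5)[of x] na x by blast
      next
        case False then show thesis using that(4) na by blast
      qed
    next
      case False
      then have "(\<forall>x. \<not> ?half x) \<or> 53 \<le> ?n" by (simp add: not_less)
      then show thesis using that(2,3) by blast
    qed
  qed
  then show ?case
  proof cases
    case abelian
    then show ?thesis using separating_abelian_index_2[OF fin nc] by blast
  next
    case index_3
    then have "3 * card (cent G x) \<le> ?n" if "x \<in> ?V" for x using index_2_or_3(1)[OF fin that] that by blast
    then show ?thesis by (rule separating_index_3[OF fin nc])
  next
    case large
    then show ?thesis by (rule separating_large[OF fin nc])
  next
    case central_product
    let ?D = "cent G x \<inter> cent G y"
    have xy: "x \<in> carrier G" "y \<in> carrier G"
      and half: "2 * card (cent G x) = ?n" "2 * card (cent G y) = ?n" using central_product by auto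
    have D: "subgroup ?D G" using subgroup_Int subgroup_cent xy by blast
    \<comment> \<open>Otherwise \<open>cent G x\<close> would be an abelian subgroup of index
      2.\<close>
    have Dnc: "\<not> commutative G ?D"
      using commutative_cent_if_Int[OF fin xy half central_product(4)]
        central_product(1)[OF subgroup_cent[OF xy(1)] half(1)] by blast
    have "?D \<subset> carrier G" using central_product(4) xy by (auto simp: cent_def)
    then have "card ?D < ?n" using fin by (rule psubset_card_mono[rotated])
    then have "\<exists>\<kappa>. separating (G\<lparr>carrier := ?D\<rparr>) \<kappa>"
      using less.hyps[of "G\<lparr>carrier := ?D\<rparr>"] subgroup_imp_group[OF D] Dnc finite_cent[OF fin]
      by (simp add: commutative_def)
    then show ?thesis
      using separating_central_product[OF fin xy half central_product(4) refl Dnc] by blast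
  next
    case commuting
    have x: "x \<in> ?V" "2 * card (cent G x) = ?n" using commuting(2) by simp_all
    show ?thesis
    proof (rule separating_commuting_index_2[OF fin nc commuting(1) x _ commuting(4)])
      show "v \<in> cent G u" if "u \<in> ?V" "2 * card (cent G u) = ?n" "v \<in> ?V" "2 * card (cent G v) = ?n" for u v
        using commuting(3) that by simp
    qed
  qed
qed

theorem theorem1p1:
  fixes G :: "('a, 'm) monoid_scheme"
  assumes "group G" and "finite (carrier G)" and "\<not> comm_group G"
  shows "rainbow_connectivity 2 (non_commuting_graph G) = 2
       \<and> rainbow_connection_number (non_commuting_graph G) = 2"
proof -
  interpret group G by fact
  have "\<not> commutative G (carrier G)"
    using assms(3) group_comm_groupI by (auto simp: commutative_def)
  then obtain \<kappa> where "separating G \<kappa>" using exists_separating_coloring[OF assms(1,2)] by blast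
  then show ?thesis by (rule rainbow_of_separating[OF assms(2,3)])
qed

end
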